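(* Let $1\le p\le\infty$, let $\alpha \in L^{1}(\mathbb{R})$ and let $w\in C^{2}(\mathbb{R})$ with $w(0)=0$. Consider the Cauchy problem $$u_{tt}(x,t)=\int_{\mathbb{R}} \alpha(y-x)\, w\big(u(y,t)-u(x,t)\big)\,dy,\quad x\in\mathbb{R},\ t>0,\qquad u(x,0)=\varphi(x),\ u_t(x,0)=\psi(x).$$ Then for initial data $\varphi,\psi\in W^{1,p}(\mathbb{R})$ there is some $T>0$ such that this Cauchy problem is well posed with solution in $C^{2}([0,T],W^{1,p}(\mathbb{R}))$.
   Context: $W^{1,p}(\mathbb{R})$ is the Sobolev space of $L^p$ functions whose distributional derivative is in $L^p$, with norm $\|u\|_p+\|u'\|_p$. "Well posed with solution in $C^2([0,T],X)$" means: there exists a unique solution $u\in C^2([0,T],X)$ of the Cauchy problem, and the solution depends continuously on the initial data $(\varphi,\psi)\in X\times X$ (in the norm of $C([0,T],X)$). *)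

theory Defs
  imports "HOL-Analysis.Analysis"
begin

definition Lp_norm :: "ennreal \<Rightarrow> (real \<Rightarrow> real) \<Rightarrow> ennreal" where
  "Lp_norm p f =
     (if p = top then Inf {C. AE x in lborel. ennreal \<bar>f x\<bar> \<le> C}
      else (let I = (\<integral>\<^sup>+ x. ennreal (\<bar>f x\<bar> powr enn2real p) \<partial>lborel)
            in if I = top then top else ennreal ((enn2real I) powr (1 / enn2real p))))"

definition test_fun :: "(real \<Rightarrow> real) \<Rightarrow> bool" where
  "test_fun \<phi> \<longleftrightarrow> (\<forall>n x. ((deriv ^^ n) \<phi>) differentiable (at x)) \<and> bounded {x. \<phi> x \<noteq> 0}"

definition weak_deriv :: "(real \<Rightarrow> real) \<Rightarrow> (real \<Rightarrow> real) \<Rightarrow> bool" where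
  "weak_deriv f g \<longleftrightarrow>
     (\<forall>K. compact K \<longrightarrow> set_integrable lborel K f \<and> set_integrable lborel K g) \<and>
     (\<forall>\<phi>. test_fun \<phi> \<longrightarrow>
        (\<integral>x. f x * deriv \<phi> x \<partial>lborel) = - (\<integral>x. g x * \<phi> x \<partial>lborel))"

definition W1p :: "ennreal \<Rightarrow> (real \<Rightarrow> real) set" where
  "W1p p = {f. f \<in> borel_measurable lborel \<and> Lp_norm p f < top \<and>
               (\<exists>g. g \<in> borel_measurable lborel \<and> weak_deriv f g \<and> Lp_norm p g < top)}"

definition W1p_norm :: "ennreal \<Rightarrow> (real \<Rightarrow> real) \<Rightarrow> ennreal" where
  "W1p_norm p f = Lp_norm p f + Lp_norm p (SOME g. g \<in> borel_measurable lborel \<and> weak_deriv f g)"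

definition W1p_dist :: "ennreal \<Rightarrow> (real \<Rightarrow> real) \<Rightarrow> (real \<Rightarrow> real) \<Rightarrow> ennreal" where
  "W1p_dist p f g = W1p_norm p (\<lambda>x. f x - g x)"

definition C2_fun :: "(real \<Rightarrow> real) \<Rightarrow> bool" where
  "C2_fun w \<longleftrightarrow> (\<exists>w1 w2. (\<forall>x. (w has_real_derivative w1 x) (at x)) \<and>
                         (\<forall>x. (w1 has_real_derivative w2 x) (at x)) \<and> continuous_on UNIV w2)"

definition C2_W :: "ennreal \<Rightarrow> real \<Rightarrow> (real \<Rightarrow> real \<Rightarrow> real) \<Rightarrow> (real \<Rightarrow> real \<Rightarrow> real)
                     \<Rightarrow> (real \<Rightarrow> real \<Rightarrow> real) \<Rightarrow> bool" where
  "C2_W p T u u1 u2 \<longleftrightarrow>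
     (\<forall>t\<in>{0..T}. u t \<in> W1p p \<and> u1 t \<in> W1p p \<and> u2 t \<in> W1p p) \<and>
     (\<forall>t\<in>{0..T}. ((\<lambda>s. W1p_norm p (\<lambda>x. (u s x - u t x) / (s - t) - u1 t x)) \<longlongrightarrow> 0)
                    (at t within {0..T})) \<and>
     (\<forall>t\<in>{0..T}. ((\<lambda>s. W1p_norm p (\<lambda>x. (u1 s x - u1 t x) / (s - t) - u2 t x)) \<longlongrightarrow> 0)
                    (at t within {0..T})) \<and>
     (\<forall>t\<in>{0..T}. ((\<lambda>s. W1p_dist p (u2 s) (u2 t)) \<longlongrightarrow> 0) (at t within {0..T}))"

text \<open>u is a solution in C^2([0,T], W^{1,p}) of the Cauchy problem with data (\<phi>, \<psi>).
  Equalities of elements of W^{1,p} are almost-everywhere equalities.\<close>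
definition is_solution :: "ennreal \<Rightarrow> (real \<Rightarrow> real) \<Rightarrow> (real \<Rightarrow> real) \<Rightarrow> real
     \<Rightarrow> (real \<Rightarrow> real) \<Rightarrow> (real \<Rightarrow> real) \<Rightarrow> (real \<Rightarrow> real \<Rightarrow> real) \<Rightarrow> bool" where
  "is_solution p \<alpha> w T \<phi> \<psi> u \<longleftrightarrow>
     (\<exists>u1 u2. C2_W p T u u1 u2 \<and>
        (\<forall>t\<in>{0<..T}. AE x in lborel.
            u2 t x = (\<integral>y. \<alpha> (y - x) * w (u t y - u t x) \<partial>lborel)) \<and>
        (AE x in lborel. u 0 x = \<phi> x) \<and> (AE x in lborel. u1 0 x = \<psi> x))"

definition well_posed :: "ennreal \<Rightarrow> (real \<Rightarrow> real) \<Rightarrow> (real \<Rightarrow> real) \<Rightarrow> real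
     \<Rightarrow> (real \<Rightarrow> real) \<Rightarrow> (real \<Rightarrow> real) \<Rightarrow> bool" where
  "well_posed p \<alpha> w T \<phi> \<psi> \<longleftrightarrow>
     (\<exists>u. is_solution p \<alpha> w T \<phi> \<psi> u) \<and>
     (\<forall>u v. is_solution p \<alpha> w T \<phi> \<psi> u \<and> is_solution p \<alpha> w T \<phi> \<psi> v \<longrightarrow>
            (\<forall>t\<in>{0..T}. AE x in lborel. u t x = v t x)) \<and>
     (\<forall>u. is_solution p \<alpha> w T \<phi> \<psi> u \<longrightarrow>
        (\<forall>\<epsilon>>0. \<exists>\<delta>>0. \<forall>\<phi>' \<psi>'. \<phi>' \<in> W1p p \<and> \<psi>' \<in> W1p p \<and>
              W1p_dist p \<phi>' \<phi> + W1p_dist p \<psi>' \<psi> < ennreal \<delta> \<longrightarrow>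
              (\<exists>u'. is_solution p \<alpha> w T \<phi>' \<psi>' u') \<and>
              (\<forall>u'. is_solution p \<alpha> w T \<phi>' \<psi>' u' \<longrightarrow>
                  (\<forall>t\<in>{0..T}. W1p_dist p (u' t) (u t) \<le> ennreal \<epsilon>))))"

end

theory Submission
  imports Defs
begin

text \<open>
  Write \<open>F(u)(x) = \<integral>\<alpha>(z) w(u(x + z) - u(x)) dz\<close> for the right-hand side and
  \<open>A h(x) = \<integral>|\<alpha>(z)| (h(x + z) + h(x)) dz\<close>, a positive operator that is bounded on \<open>L\<^sup>p\<close> by Minkowski's
  integral inequality. An element of \<open>W\<^sup>1\<^sup>,\<^sup>p\<close> is a function bounded pointwise, and in its
  increments \<open>|f(b) - f(a)| \<le> \<integral>\<^sub>a\<^sup>b G\<close>, by \<open>L\<^sup>p\<close> functions, and a four-point mean value estimate for \<open>w\<close>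
  transports such bounds from \<open>u\<close> and \<open>u - v\<close> to \<open>F(u) - F(v)\<close> through \<open>A\<close>. In particular \<open>F\<close> is
  locally Lipschitz on \<open>W\<^sup>1\<^sup>,\<^sup>p\<close>.

  For existence, a Neumann series yields \<open>H \<in> L\<^sup>p\<close> that dominates the data and satisfies \<open>A H \<le> c H\<close>. The
  functions dominated by a multiple of \<open>H\<close>, pointwise and in their increments, form a closed subset of the
  bounded continuous functions of \<open>(t, x)\<close> that is invariant under the Picard operator, which is a
  contraction in the supremum norm for short times; this avoids integrating curves with values in
  \<open>W\<^sup>1\<^sup>,\<^sup>p\<close>. Uniqueness and continuous dependence follow from the mean value inequality in
  the norm of \<open>W\<^sup>1\<^sup>,\<^sup>p\<close> and a first-exit argument.
\<close>

section \<open>Smooth functions and bump functions\<close>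

text \<open>\<open>W1p_norm\<close> picks a weak derivative by \<open>SOME\<close>, so it can be
  computed only through the almost everywhere uniqueness of weak derivatives; this is why the
  development starts from bump functions. The derivative of \<open>F(u) - F(v)\<close> contains
  \<open>u'\<close> multiplied by a difference of values of \<open>w'\<close>, so a Lipschitz bound
  for \<open>F\<close> involves both the size of \<open>u\<close> in W^{1,p} and the sup norm of
  \<open>u - v\<close>. The Lipschitz constant is therefore local, and the Picard map is contracted
  in the sup norm alone, while the W^{1,p} information sits in a bound that survives limits.
  Differentiability in time is recovered afterwards: the integrands turn out Lipschitz in time with
  respect to the weight \<open>H\<close>, so the difference quotients converge in norm. A competing
  solution carries no a priori bound; the first-exit argument keeps it in a ball where the Lipschitz
  constant is known. The equation is second order in time, so the closing estimates gain a factor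
  \<open>T^2\<close>, and \<open>T^2 * kappa R M \<le> 1 / 2\<close> together with
  \<open>T \<le> 1\<close> is the whole smallness condition.\<close>

definition smooth :: "(real \<Rightarrow> real) \<Rightarrow> bool" where
  "smooth f \<longleftrightarrow> (\<forall>n x. ((deriv ^^ n) f) differentiable (at x))"

text \<open>Exhibiting a class of differentiable functions closed under \<open>deriv\<close>
  replaces any formula for the n-th derivative.\<close>

lemma smooth_coinduct:
  assumes "f \<in> S" "\<And>g x. g \<in> S \<Longrightarrow> g differentiable (at x)" "\<And>g. g \<in> S \<Longrightarrow> deriv g \<in> S"
  shows "smooth f"
proof -
  have "(deriv ^^ n) f \<in> S" for n
    by (induction n) (use assms in auto)
  then show ?thesis using assms(2) by (auto simp: smooth_def)
qed

lemma smooth_differentiable: "smooth f \<Longrightarrow> f differentiable (at x)"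
  unfolding smooth_def by (metis funpow_0)

lemma smooth_deriv: "smooth f \<Longrightarrow> smooth (deriv f)"
  unfolding smooth_def by (metis comp_apply funpow_Suc_right)

lemma smooth_DERIV: "smooth f \<Longrightarrow> (f has_real_derivative deriv f x) (at x)"
  using smooth_differentiable by (simp add: DERIV_deriv_iff_real_differentiable)

lemma smooth_iff_deriv:
  "smooth f \<longleftrightarrow> (\<forall>x. f differentiable (at x)) \<and> smooth (deriv f)"
proof (intro iffI conjI)
  assume *: "(\<forall>x. f differentiable (at x)) \<and> smooth (deriv f)"
  show "smooth f"
    by (rule smooth_coinduct[of _ "insert f (Collect smooth)"])
       (use * in \<open>auto simp: smooth_differentiable smooth_deriv\<close>)
qed (auto simp: smooth_differentiable smooth_deriv)

lemma test_fun_iff: "test_fun f \<longleftrightarrow> smooth f \<and> bounded {x. f x \<noteq> 0}"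
  by (simp add: test_fun_def smooth_def)

text \<open>The derivative of a product is a sum of two products, so the class handed to
  \<open>smooth_coinduct\<close> has to contain sums of products.\<close>

inductive_set prod_span :: "(real \<Rightarrow> real) set" where
  prod: "smooth f \<Longrightarrow> smooth g \<Longrightarrow> (\<lambda>x. f x * g x) \<in> prod_span"
| plus: "f \<in> prod_span \<Longrightarrow> g \<in> prod_span \<Longrightarrow> (\<lambda>x. f x + g x) \<in> prod_span"

lemma prod_span_deriv:
  "f \<in> prod_span \<Longrightarrow> (\<forall>x. f differentiable (at x)) \<and> deriv f \<in> prod_span"
proof (induction rule: prod_span.induct)
  case (prod f g)
  have "((\<lambda>x. f x * g x) has_real_derivative deriv f x * g x + f x * deriv g x) (at x)" for x
    using DERIV_mult'[OF smooth_DERIV[OF prod(1)] smooth_DERIV[OF prod(2)], of x]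
    by (simp add: algebra_simps)
  then have "deriv (\<lambda>x. f x * g x) = (\<lambda>x. deriv f x * g x + f x * deriv g x)"
    and "\<forall>x. (\<lambda>x. f x * g x) differentiable (at x)"
    using DERIV_imp_deriv real_differentiable_def by (fast, blast)
  then show ?case using prod
    by (auto intro!: prod_span.intros smooth_deriv)
next
  case (plus f g)
  then have "((\<lambda>x. f x + g x) has_real_derivative deriv f x + deriv g x) (at x)" for x
    by (intro DERIV_add) (auto simp: DERIV_deriv_iff_real_differentiable)
  then have "deriv (\<lambda>x. f x + g x) = (\<lambda>x. deriv f x + deriv g x)"
    and "\<forall>x. (\<lambda>x. f x + g x) differentiable (at x)"
    using DERIV_imp_deriv real_differentiable_def by (fast, blast)
  then show ?case using plus
    by (auto intro!: prod_span.intros)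
qed

lemma prod_span_smooth: "f \<in> prod_span \<Longrightarrow> smooth f"
  by (rule smooth_coinduct[of _ prod_span]) (use prod_span_deriv in auto)

lemma smooth_mult: "smooth f \<Longrightarrow> smooth g \<Longrightarrow> smooth (\<lambda>x. f x * g x)"
  by (simp add: prod_span_smooth prod_span.prod)

lemma smooth_const: "smooth (\<lambda>x. c)"
  by (rule smooth_coinduct[of _ "range (\<lambda>c x. c)"]) auto

lemma smooth_add: "smooth f \<Longrightarrow> smooth g \<Longrightarrow> smooth (\<lambda>x. f x + g x)"
  using prod_span_smooth[OF prod_span.plus[OF prod_span.prod[of f "\<lambda>x. 1"] prod_span.prod[of g "\<lambda>x. 1"]]]
  by (simp add: smooth_const)

lemma smooth_affine:
  assumes "smooth f"
  shows "smooth (\<lambda>x. f (c * x + d))"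
proof -
  \<comment> \<open>The scalar \<open>r\<close> absorbs the factor \<open>c\<close> that each use of
    the chain rule produces.\<close>
  let ?S = "{\<lambda>x. r * f (c * x + d) | r f. smooth f}"
  have D: "((\<lambda>x. r * f (c * x + d)) has_real_derivative r * c * deriv f (c * x + d)) (at x)"
    if "smooth f" for r f x
  proof -
    have "((\<lambda>x. c * x + d) has_real_derivative c) (at x)"
      by (auto intro!: derivative_eq_intros)
    from DERIV_cmult[OF DERIV_chain2[OF smooth_DERIV[OF that] this], of r]
    show ?thesis by (simp add: mult_ac)
  qed
  show ?thesis
  proof (rule smooth_coinduct[of _ ?S])
    show "(\<lambda>x. f (c * x + d)) \<in> ?S" using assms by (intro CollectI exI[of _ 1] exI[of _ f]) auto
  next
    fix g x assume "g \<in> ?S"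
    then show "g differentiable (at x)" using D real_differentiable_def by blast
  next
    fix g assume "g \<in> ?S"
    then obtain r f where g: "g = (\<lambda>x. r * f (c * x + d))" "smooth f" by auto
    then have "deriv g = (\<lambda>x. (r * c) * deriv f (c * x + d))"
      using D[OF g(2)] DERIV_imp_deriv by fast
    then show "deriv g \<in> ?S" using smooth_deriv[OF g(2)] by blast
  qed
qed

text \<open>The functions \<open>P (1/x) exp (- 1/x)\<close>, with \<open>P\<close> a polynomial, are closed under differentiation.\<close>
definition flat :: "real poly \<Rightarrow> real \<Rightarrow> real" where
  "flat P x = (if x > 0 then poly P (1 / x) * exp (- (1 / x)) else 0)"

lemma poly_exp_decay: "((\<lambda>y. poly P y * exp (- y)) \<longlongrightarrow> (0::real)) at_top"
proof -
  have "((\<lambda>y. \<Sum>i\<le>degree P. coeff P i * (y ^ i / exp y)) \<longlongrightarrow> (\<Sum>i\<le>degree P. coeff P i * 0)) at_top"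
    by (intro tendsto_intros tendsto_power_div_exp_0)
  then show ?thesis
    by (simp add: poly_altdef sum_distrib_right exp_minus divide_inverse mult.assoc)
qed

text \<open>With \<open>y = 1 / x\<close> the derivative of \<open>P(y) exp(-y)\<close> in
  \<open>y\<close> is \<open>(P' - P)(y) exp(-y)\<close>, and \<open>dy/dx = -y^2\<close>; this is
  the polynomial of the statement. At 0 the difference quotient from the right is again of the form
  \<open>poly Q y * exp (- y)\<close> with \<open>y\<close> tending to infinity.\<close>

lemma flat_deriv: "(flat P has_real_derivative flat ([:0, 0, 1:] * (P - pderiv P)) x) (at x)"
proof -
  consider "x > 0" | "x < 0" | "x = 0" by linarith
  then show ?thesis
  proof cases
    case 1
    have "((\<lambda>x. poly P (1 / x) * exp (- (1 / x))) has_real_derivative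
       poly (pderiv P) (1 / x) * (- 1 / x^2) * exp (- (1 / x)) + poly P (1 / x) * (exp (- (1 / x)) * (1 / x^2))) (at x)"
      using 1 by (auto intro!: derivative_eq_intros poly_DERIV DERIV_chain2[where f="poly P"] simp: power2_eq_square)
    then have "((\<lambda>x. poly P (1 / x) * exp (- (1 / x))) has_real_derivative flat ([:0, 0, 1:] * (P - pderiv P)) x) (at x)"
      using 1 by (simp add: flat_def algebra_simps power2_eq_square)
    moreover have "\<forall>\<^sub>F y in nhds x. poly P (1 / y) * exp (- (1 / y)) = flat P y"
      using eventually_nhds_in_open[of "{0<..}" x] 1 by (auto simp: flat_def elim: eventually_mono)
    ultimately show ?thesis by (subst (asm) DERIV_cong_ev[OF refl _ refl])
  next
    case 2
    have "((\<lambda>x. 0) has_real_derivative flat ([:0, 0, 1:] * (P - pderiv P)) x) (at x)"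
      using 2 by (simp add: flat_def)
    moreover have "\<forall>\<^sub>F y in nhds x. 0 = flat P y"
      using eventually_nhds_in_open[of "{..<0}" x] 2 by (auto simp: flat_def elim: eventually_mono)
    ultimately show ?thesis by (subst (asm) DERIV_cong_ev[OF refl _ refl])
  next
    case 3
    have R: "((\<lambda>y. flat P y / y) \<longlongrightarrow> 0) (at_right 0)"
    proof -
      have "((\<lambda>y. poly ([:0,1:] * P) (inverse y) * exp (- (inverse y))) \<longlongrightarrow> 0) (at_right 0)"
        using poly_exp_decay filterlim_inverse_at_top_right by (rule filterlim_compose)
      moreover have "\<forall>\<^sub>F y::real in at_right 0. poly ([:0,1:] * P) (inverse y) * exp (- (inverse y)) = flat P y / y"
        by (auto simp: eventually_at_right_less flat_def field_simps intro: eventually_at_right_less[THEN eventually_mono])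
      ultimately show ?thesis using tendsto_cong by fast
    qed
    have L: "((\<lambda>y. flat P y / y) \<longlongrightarrow> 0) (at_left 0)"
      by (rule tendsto_eventually) (auto simp: flat_def eventually_at_filter)
    have "((\<lambda>y. flat P y / y) \<longlongrightarrow> 0) (at 0)"
      using L R filterlim_split_at by blast
    then show ?thesis
      using 3 by (simp add: has_field_derivative_iff flat_def)
  qed
qed

lemma smooth_flat: "smooth (flat P)"
proof (rule smooth_coinduct[of _ "range flat"])
  fix g x assume "g \<in> range flat"
  then show "g differentiable (at x)" using flat_deriv real_differentiable_def by blast
next
  fix g assume "g \<in> range flat"
  then obtain Q where Q: "g = flat Q" by auto
  have "deriv (flat Q) = flat ([:0, 0, 1:] * (Q - pderiv Q))"
    using flat_deriv DERIV_imp_deriv by fast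
  then show "deriv g \<in> range flat" using Q by blast
qed auto

text \<open>Stretching both factors by \<open>Suc n\<close> sends the exponents to 0 inside the
  interval, so the bumps tend to the indicator of the open interval while staying below it. This is
  the approximation required for dominated convergence.\<close>

definition bump :: "real \<Rightarrow> real \<Rightarrow> nat \<Rightarrow> real \<Rightarrow> real" where
  "bump a b n x = flat 1 (real (Suc n) * (x - a)) * flat 1 (real (Suc n) * (b - x))"

lemma test_fun_bump: "test_fun (bump a b n)"
proof -
  let ?m = "real (Suc n)"
  have "smooth (\<lambda>x. flat 1 (?m * x + (- ?m * a)) * flat 1 ((- ?m) * x + (?m * b)))"
    by (intro smooth_mult smooth_affine smooth_flat)
  also have "(\<lambda>x. flat 1 (?m * x + (- ?m * a)) * flat 1 ((- ?m) * x + (?m * b))) = bump a b n"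
    by (rule ext) (simp add: bump_def algebra_simps)
  finally have "smooth (bump a b n)" .
  moreover have "{x. bump a b n x \<noteq> 0} \<subseteq> {a..b}"
    by (auto simp: bump_def flat_def zero_less_mult_iff split: if_splits)
  ultimately show ?thesis
    using bounded_subset[OF bounded_closed_interval] by (auto simp: test_fun_iff)
qed

lemma bump_nonneg: "0 \<le> bump a b n x" and bump_le: "bump a b n x \<le> indicator {a<..<b} x"
  by (auto simp: bump_def flat_def zero_less_mult_iff indicator_def mult_le_one)

lemma bump_tendsto: "(\<lambda>n. bump a b n x) \<longlonglongrightarrow> indicator {a<..<b} x"
proof (cases "a < x \<and> x < b")
  case True
  have E: "(\<lambda>n. exp (- (1 / (real (Suc n) * c)))) \<longlonglongrightarrow> 1" if "c > 0" for c
  proof -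
    have "(\<lambda>n. exp (- (inverse (real (Suc n)) * (1 / c)))) \<longlonglongrightarrow> exp (- (0 * (1 / c)))"
      by (intro tendsto_intros LIMSEQ_inverse_real_of_nat)
    then show ?thesis by (simp add: field_simps)
  qed
  have "(\<lambda>n. exp (- (1 / (real (Suc n) * (x - a)))) * exp (- (1 / (real (Suc n) * (b - x))))) \<longlonglongrightarrow> 1 * 1"
    using True by (intro tendsto_mult E) auto
  moreover have "bump a b n x = exp (- (1 / (real (Suc n) * (x - a)))) * exp (- (1 / (real (Suc n) * (b - x))))" for n
    using True by (simp add: bump_def flat_def)
  ultimately show ?thesis using True by (simp del: of_nat_Suc)
next
  case False
  then have "bump a b n x = 0" for n
    by (auto simp: bump_def flat_def zero_less_mult_iff)
  then show ?thesis using False by (auto simp: indicator_def)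
qed

section \<open>Weak derivatives\<close>

lemma test_fun_deriv: "test_fun f \<Longrightarrow> test_fun (deriv f)"
proof -
  assume f: "test_fun f"
  \<comment> \<open>Off the closure of the nonzero set \<open>f\<close> vanishes in a whole
    neighbourhood; off the set itself this may fail.\<close>
  have "deriv f x = 0" if "x \<notin> closure {x. f x \<noteq> 0}" for x
  proof -
    have "\<forall>\<^sub>F y in nhds x. y \<in> - closure {x. f x \<noteq> 0}"
      using that by (intro eventually_nhds_in_open) auto
    then have "\<forall>\<^sub>F y in nhds x. 0 = f y"
      by eventually_elim (use closure_subset[of "{x. f x \<noteq> 0}"] in auto)
    then have "(f has_real_derivative 0) (at x)"
      using DERIV_cong_ev[of x x "\<lambda>_. 0" f 0 0] by simp
    then show ?thesis by (rule DERIV_imp_deriv)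
  qed
  then have "{x. deriv f x \<noteq> 0} \<subseteq> closure {x. f x \<noteq> 0}" by blast
  then show ?thesis
    using f bounded_subset bounded_closure by (auto simp: test_fun_iff smooth_deriv)
qed

lemma smooth_continuous_on: "smooth f \<Longrightarrow> continuous_on S f"
  by (meson DERIV_isCont continuous_at_imp_continuous_on smooth_DERIV)

lemma test_fun_support:
  assumes "test_fun f" obtains R where "R > 0" "\<And>x. \<bar>x\<bar> \<ge> R \<Longrightarrow> f x = 0" "\<And>x. \<bar>x\<bar> \<ge> R \<Longrightarrow> deriv f x = 0"
proof -
  have "bounded {x. f x \<noteq> 0}" "bounded {x. deriv f x \<noteq> 0}"
    using assms test_fun_deriv by (auto simp: test_fun_iff)
  then obtain B C where "\<And>x. f x \<noteq> 0 \<Longrightarrow> \<bar>x\<bar> \<le> B" "\<And>x. deriv f x \<noteq> 0 \<Longrightarrow> \<bar>x\<bar> \<le> C"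
    by (auto simp: bounded_iff)
  then show ?thesis by (intro that[of "max 1 (max B C + 1)"]) (auto, force+)
qed

lemma test_fun_measurable [measurable_dest]: "test_fun f \<Longrightarrow> f \<in> borel_measurable borel"
  by (simp add: borel_measurable_continuous_onI smooth_continuous_on test_fun_iff)

lemma test_fun_bound:
  assumes "test_fun f" obtains C where "C > 0" "\<And>x. \<bar>f x\<bar> \<le> C"
proof -
  obtain R where R: "R > 0" "\<And>x. \<bar>x\<bar> \<ge> R \<Longrightarrow> f x = 0" using test_fun_support[OF assms] by metis
  have "compact (f ` {-R..R})"
    using assms by (intro compact_continuous_image) (auto simp: test_fun_iff smooth_continuous_on)
  then have "\<exists>C. \<forall>x\<in>{-R..R}. \<bar>f x\<bar> \<le> C"
    using compact_imp_bounded[of "f ` {-R..R}"] by (auto simp: bounded_iff)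
  then obtain C where C: "\<And>x. x \<in> {-R..R} \<Longrightarrow> \<bar>f x\<bar> \<le> C" by blast
  show ?thesis
  proof (rule that[of "max C 1"])
    show "\<bar>f x\<bar> \<le> max C 1" for x using C[of x] R(2)[of x] abs_le_iff[of x R] by (cases "\<bar>x\<bar> \<ge> R") (auto intro: le_max_iff_disj[THEN iffD2])
  qed auto
qed

section \<open>Locally integrable functions\<close>

definition loc_integrable :: "(real \<Rightarrow> real) \<Rightarrow> bool" where
  "loc_integrable f \<longleftrightarrow> (\<forall>a b. set_integrable lborel {a..b} f)"

lemma loc_integrable_iff_compact:
  "loc_integrable f \<longleftrightarrow> (\<forall>K. compact K \<longrightarrow> set_integrable lborel K f)"
proof (intro iffI allI impI)
  fix K :: "real set" assume f: "loc_integrable f" and K: "compact K"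
  then obtain B where "\<And>x. x \<in> K \<Longrightarrow> \<bar>x\<bar> \<le> B" using compact_imp_bounded[OF K] by (auto simp: bounded_iff)
  then have "K \<subseteq> {-B..B}" by (auto simp: abs_le_iff) (meson minus_le_iff)
  then show "set_integrable lborel K f"
    using f K set_integrable_subset borel_compact by (fastforce simp: loc_integrable_def)
qed (auto simp: loc_integrable_def)

text \<open>Set integrability yields measurability of the truncations to bounded intervals; these
  converge pointwise.\<close>

lemma loc_integrable_measurable: assumes "loc_integrable f" shows "f \<in> borel_measurable borel"
proof (rule borel_measurable_LIMSEQ_real)
  show "(\<lambda>x. indicator {-real n..real n} x * f x) \<in> borel_measurable borel" for n
    using assms borel_measurable_integrable[of lborel "\<lambda>x. indicator {-real n..real n} x * f x"]
    by (auto simp: loc_integrable_def set_integrable_def)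
  show "(\<lambda>n. indicator {-real n..real n} x * f x) \<longlonglongrightarrow> f x" for x
  proof (rule tendsto_eventually)
    obtain N where N: "\<bar>x\<bar> < real N" using reals_Archimedean2 by blast
    show "\<forall>\<^sub>F n in sequentially. indicator {-real n..real n} x * f x = f x"
      using eventually_ge_at_top[of N] by eventually_elim (use N in \<open>auto simp: indicator_def\<close>)
  qed
qed

lemma loc_integrable_diff: "loc_integrable f \<Longrightarrow> loc_integrable g \<Longrightarrow> loc_integrable (\<lambda>x. f x - g x)"
  and loc_integrable_add: "loc_integrable f \<Longrightarrow> loc_integrable g \<Longrightarrow> loc_integrable (\<lambda>x. f x + g x)"
  and loc_integrable_cmult: "loc_integrable f \<Longrightarrow> loc_integrable (\<lambda>x. c * f x)"
  by (auto simp: loc_integrable_def)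

lemma loc_integrable_continuous: "continuous_on UNIV f \<Longrightarrow> loc_integrable f"
  unfolding loc_integrable_def set_integrable_def
  by (intro allI borel_integrable_compact) (auto intro: continuous_on_subset)

lemma loc_integrable_mult_test_fun:
  assumes f: "loc_integrable f" and \<phi>: "test_fun \<phi>"
  shows "integrable lborel (\<lambda>x. f x * \<phi> x)"
proof -
  obtain C where C: "C > 0" "\<And>x. \<bar>\<phi> x\<bar> \<le> C" using test_fun_bound[OF \<phi>] by metis
  obtain R where R: "\<And>x. \<bar>x\<bar> \<ge> R \<Longrightarrow> \<phi> x = 0" using test_fun_support[OF \<phi>] by metis
  have [measurable]: "f \<in> borel_measurable borel" "\<phi> \<in> borel_measurable borel"
    using loc_integrable_measurable[OF f] test_fun_measurable[OF \<phi>] by auto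
  have "integrable lborel (\<lambda>x. C * (indicator {-R..R} x *\<^sub>R f x))"
    using f by (auto simp: loc_integrable_def set_integrable_def)
  then show ?thesis
  proof (rule Bochner_Integration.integrable_bound)
    show "AE x in lborel. norm (f x * \<phi> x) \<le> norm (C * (indicator {-R..R} x *\<^sub>R f x))"
    proof (rule AE_I2)
      fix x show "norm (f x * \<phi> x) \<le> norm (C * (indicator {-R..R} x *\<^sub>R f x))"
        using R[of x] mult_left_mono[OF C(2)[of x], of "\<bar>f x\<bar>"] C(1)
        by (cases "\<bar>x\<bar> \<ge> R") (auto simp: abs_mult mult_ac indicator_def)
    qed
  qed auto
qed

section \<open>The fundamental lemma of the calculus of variations\<close>

lemma enn2real_inject: "x < top \<Longrightarrow> y < top \<Longrightarrow> enn2real x = enn2real y \<Longrightarrow> x = y"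
  by (metis ennreal_enn2real)

text \<open>Half-open intervals form a pi-system and are the sets on which Stieltjes measures have a
  formula. Besides the next lemma, this serves to identify the sum of two such measures in
  \<open>incr_primitive\<close>.\<close>

lemma measure_eqI_Ioc:
  fixes M N :: "real measure"
  assumes sets: "sets M = sets borel" "sets N = sets borel"
  assumes fin: "\<And>a b. a \<le> b \<Longrightarrow> emeasure M {a<..b} < \<infinity>"
  assumes eq: "\<And>a b. a \<le> b \<Longrightarrow> emeasure M {a<..b} = emeasure N {a<..b}"
  shows "M = N"
proof -
  let ?E = "range (\<lambda>(a, b). {a<..b::real})"
  let ?A = "range (\<lambda>n::nat. {- real n<..real n})"
  show ?thesis
  proof (rule measure_eqI_generator_eq_countable[where E="?E" and A="?A" and \<Omega>=UNIV])
    show "Int_stable ?E"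
      unfolding Int_stable_def
    proof (intro ballI)
      fix X Y assume "X \<in> ?E" "Y \<in> ?E"
      then obtain a b c d where "X = {a<..b}" "Y = {c<..d}" by auto
      then have "X \<inter> Y = {max a c<..min b d}" by auto
      then show "X \<inter> Y \<in> ?E" by auto
    qed
    show "?E \<subseteq> Pow UNIV" "sets M = sigma_sets UNIV ?E" "sets N = sigma_sets UNIV ?E"
      unfolding sets borel_sigma_sets_Ioc by auto
    show "?A \<subseteq> ?E" by auto
    show "\<Union>?A = UNIV"
    proof -
      have "x \<in> \<Union>?A" for x :: real
      proof -
        obtain n :: nat where "\<bar>x\<bar> < real n" using reals_Archimedean2 by blast
        then show ?thesis by (auto intro!: exI[of _ n])
      qed
      then show ?thesis by blast
    qed
    show "countable ?A" by auto
    show "emeasure M a \<noteq> \<infinity>" if "a \<in> ?A" for a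
    proof -
      from that obtain n :: nat where "a = {- real n<..real n}" by auto
      then show ?thesis using fin[of "- real n" "real n"] by (auto simp: less_top)
    qed
    show "emeasure M X = emeasure N X" if "X \<in> ?E" for X
    proof -
      from that obtain a b where "X = {a<..b}" by auto
      then show ?thesis using eq[of a b] by (cases "a \<le> b") auto
    qed
  qed
qed

text \<open>Since \<open>ennreal\<close> cuts off at 0, \<open>ennreal (d x)\<close> and
  \<open>ennreal (- d x)\<close> are the positive and the negative part of \<open>d\<close>. As
  densities they give the same measure to every interval, so they agree almost everywhere; at most
  one of them is nonzero at a point, so both vanish.\<close>

lemma AE_zero_of_interval_integrals:
  assumes d: "loc_integrable d" and z: "\<And>a b. a < b \<Longrightarrow> (\<integral>x. d x * indicator {a<..<b} x \<partial>lborel) = 0"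
  shows "AE x in lborel. d x = 0"
proof -
  have [measurable]: "d \<in> borel_measurable borel" using loc_integrable_measurable[OF d] .
  have fin: "integrable lborel (\<lambda>x. d x * indicator {a<..b} x)" for a b
    using set_integrable_subset[of lborel "{a..b}" d "{a<..b}"] d
    by (force simp: loc_integrable_def set_integrable_def mult.commute)
  have eq: "(\<integral>x. d x * indicator {a<..b} x \<partial>lborel) = 0" if "a \<le> b" for a b
  proof (cases "a = b")
    case False
    have "(\<integral>x. d x * indicator {a<..b} x \<partial>lborel) = (\<integral>x. d x * indicator {a<..<b} x \<partial>lborel)"
      using AE_lborel_singleton[of b]
      by (intro integral_cong_AE) (auto simp: indicator_def elim!: eventually_mono)
    then show ?thesis using z False that by auto
  qed auto
  have ind: "ennreal (x * indicator A y) = ennreal x * indicator A y" for x :: real and A and y :: real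
    by (auto simp: indicator_def)
  have ind': "ennreal (- (x * indicator A y)) = ennreal (- x) * indicator A y" for x :: real and A and y :: real
    by (auto simp: indicator_def)
  have fin': "(\<integral>\<^sup>+x. ennreal (d x) * indicator {a<..b} x \<partial>lborel) < \<infinity>"
    "(\<integral>\<^sup>+x. ennreal (- d x) * indicator {a<..b} x \<partial>lborel) < \<infinity>" for a b
    using fin[of a b] unfolding real_integrable_def ind ind' by (auto simp: less_top[symmetric])
  have "density lborel (\<lambda>x. ennreal (d x)) = density lborel (\<lambda>x. ennreal (- d x))"
  proof (rule measure_eqI_Ioc)
    fix a b :: real assume "a \<le> b"
    show "emeasure (density lborel (\<lambda>x. ennreal (d x))) {a<..b} < \<infinity>"
      using fin' by (simp add: emeasure_density)
    have "enn2real (\<integral>\<^sup>+x. ennreal (d x * indicator {a<..b} x) \<partial>lborel)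
        = enn2real (\<integral>\<^sup>+x. ennreal (- (d x * indicator {a<..b} x)) \<partial>lborel)"
      using eq[OF \<open>a \<le> b\<close>] by (simp add: real_lebesgue_integral_def[OF fin])
    then have "(\<integral>\<^sup>+x. ennreal (d x) * indicator {a<..b} x \<partial>lborel)
      = (\<integral>\<^sup>+x. ennreal (- d x) * indicator {a<..b} x \<partial>lborel)"
      by (intro enn2real_inject fin'[unfolded infinity_ennreal_def]) (simp add: ind ind')
    then show "emeasure (density lborel (\<lambda>x. ennreal (d x))) {a<..b}
      = emeasure (density lborel (\<lambda>x. ennreal (- d x))) {a<..b}"
      by (simp add: emeasure_density)
  qed auto
  then have "AE x in lborel. ennreal (d x) = ennreal (- d x)"
    by (subst (asm) sigma_finite_measure.density_unique_iff[OF sigma_finite_lborel]) auto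
  then show ?thesis
    by eventually_elim (smt (verit) ennreal_eq_0_iff)
qed

text \<open>Indicators of open intervals are dominated pointwise limits of the bumps, which reduces
  the claim to integrals over intervals.\<close>

lemma AE_zero_of_test_fun:
  assumes d: "loc_integrable d" and z: "\<And>\<phi>. test_fun \<phi> \<Longrightarrow> (\<integral>x. d x * \<phi> x \<partial>lborel) = 0"
  shows "AE x in lborel. d x = 0"
proof (rule AE_zero_of_interval_integrals[OF d])
  fix a b :: real assume "a < b"
  have [measurable]: "d \<in> borel_measurable borel" using loc_integrable_measurable[OF d] .
  have [measurable]: "bump a b n \<in> borel_measurable borel" for n
    using test_fun_measurable[OF test_fun_bump] by auto
  have "(\<lambda>n. \<integral>x. d x * bump a b n x \<partial>lborel) \<longlonglongrightarrow> (\<integral>x. d x * indicator {a<..<b} x \<partial>lborel)"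
  proof (rule integral_dominated_convergence)
    show "integrable lborel (\<lambda>x. indicator {a..b} x * \<bar>d x\<bar>)"
      using set_integrable_abs[of lborel "{a..b}" d] d
      by (auto simp: loc_integrable_def set_integrable_def)
    show "AE x in lborel. norm (d x * bump a b n x) \<le> indicator {a..b} x * \<bar>d x\<bar>" for n
    proof (rule AE_I2)
      fix x
      have "bump a b n x \<le> indicator {a..b} x"
        using order_trans[OF bump_le[of a b n x], of "indicator {a..b} x"] by (auto simp: indicator_def)
      then show "norm (d x * bump a b n x) \<le> indicator {a..b} x * \<bar>d x\<bar>"
        using mult_right_mono[of "bump a b n x" "indicator {a..b} x" "\<bar>d x\<bar>"] bump_nonneg[of a b n x]
        by (simp add: abs_mult mult.commute)
    qed
    show "AE x in lborel. (\<lambda>n. d x * bump a b n x) \<longlonglongrightarrow> d x * indicator {a<..<b} x"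
      by (intro AE_I2 tendsto_mult tendsto_const bump_tendsto)
  qed auto
  then show "(\<integral>x. d x * indicator {a<..<b} x \<partial>lborel) = 0"
    by (simp add: z[OF test_fun_bump] LIMSEQ_const_iff)
qed

lemma weak_deriv_iff:
  "weak_deriv f g \<longleftrightarrow> loc_integrable f \<and> loc_integrable g \<and>
     (\<forall>\<phi>. test_fun \<phi> \<longrightarrow> (\<integral>x. f x * deriv \<phi> x \<partial>lborel) = - (\<integral>x. g x * \<phi> x \<partial>lborel))"
  by (auto simp: weak_deriv_def loc_integrable_iff_compact)

text \<open>This makes the value of \<open>W1p_norm\<close> independent of the weak derivative that
  \<open>SOME\<close> selects.\<close>

lemma weak_deriv_unique:
  assumes "weak_deriv f g" "weak_deriv f h"
  shows "AE x in lborel. g x = h x"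
proof -
  have "AE x in lborel. g x - h x = 0"
  proof (rule AE_zero_of_test_fun)
    show "loc_integrable (\<lambda>x. g x - h x)" using assms by (auto simp: weak_deriv_iff intro: loc_integrable_diff)
    fix \<phi> assume "test_fun \<phi>"
    then show "(\<integral>x. (g x - h x) * \<phi> x \<partial>lborel) = 0"
      using assms by (simp add: weak_deriv_iff left_diff_distrib loc_integrable_mult_test_fun)
  qed
  then show ?thesis by simp
qed

lemma weak_deriv_diff:
  assumes "weak_deriv f g" "weak_deriv f' g'"
  shows "weak_deriv (\<lambda>x. f x - f' x) (\<lambda>x. g x - g' x)"
  using assms by (auto simp: weak_deriv_iff loc_integrable_diff left_diff_distrib
      loc_integrable_mult_test_fun test_fun_deriv)

lemma loc_integrable_cong_AE:
  assumes "loc_integrable f" "AE x in lborel. f x = f' x" "f' \<in> borel_measurable lborel"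
  shows "loc_integrable f'"
  unfolding loc_integrable_def
proof (intro allI)
  fix a b
  have "set_integrable lborel {a..b} f" using assms(1) by (simp add: loc_integrable_def)
  then show "set_integrable lborel {a..b} f'"
    using assms loc_integrable_measurable[OF assms(1)]
    by (subst set_integrable_cong_AE[of f' lborel f]) (auto elim: eventually_mono)
qed

lemma weak_deriv_cong_AE:
  assumes w: "weak_deriv f g" and eq: "AE x in lborel. f x = f' x" and [measurable]: "f' \<in> borel_measurable lborel"
  shows "weak_deriv f' g"
proof -
  have [measurable]: "f \<in> borel_measurable lborel"
    using w loc_integrable_measurable by (auto simp: weak_deriv_iff)
  have "(\<integral>x. f' x * deriv \<phi> x \<partial>lborel) = (\<integral>x. f x * deriv \<phi> x \<partial>lborel)" if "test_fun \<phi>" for \<phi>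
  proof -
    have [measurable]: "deriv \<phi> \<in> borel_measurable borel"
      using that test_fun_deriv test_fun_measurable by blast
    show ?thesis using eq by (intro integral_cong_AE) auto
  qed
  then show ?thesis
    using w loc_integrable_cong_AE[OF _ eq] by (auto simp: weak_deriv_iff)
qed

section \<open>Weak derivatives and primitives\<close>

text \<open>Local absolute continuity with derivative \<open>g\<close>, encoded by increments so
  that neither pointwise differentiability nor a base point enters.\<close>

definition primitive :: "(real \<Rightarrow> real) \<Rightarrow> (real \<Rightarrow> real) \<Rightarrow> bool" where
  "primitive F g \<longleftrightarrow> loc_integrable g \<and> (\<forall>a b. a \<le> b \<longrightarrow> F b - F a = integral {a..b} g)"

lemma loc_integrable_integrable_on: "loc_integrable g \<Longrightarrow> g integrable_on {a..b}"
  by (simp add: loc_integrable_def set_borel_integral_eq_integral)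

lemma loc_integrable_integral:
  "loc_integrable g \<Longrightarrow> integral {a..b} g = (\<integral>x. g x * indicator {a..b} x \<partial>lborel)"
  using set_borel_integral_eq_integral(2)[of "{a..b}" g]
  by (simp add: loc_integrable_def set_lebesgue_integral_def mult.commute)

lemma primitive_exists: assumes g: "loc_integrable g" shows "\<exists>F. primitive F g"
proof -
  \<comment> \<open>An oriented integral: for each \<open>x\<close> one of the two intervals is
    empty or a point and contributes 0.\<close>
  define F where "F x = integral {0..x} g - integral {x..0} g" for x
  have c: "integral {x..z} g = integral {x..y} g + integral {y..z} g" if "x \<le> y" "y \<le> z" for x y z
    using Henstock_Kurzweil_Integration.integral_combine[OF that loc_integrable_integrable_on[OF g]] by simp
  have z: "integral {x..y} g = 0" if "y \<le> x" for x y
    using that by (cases "x = y") auto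
  have "F b - F a = integral {a..b} g" if "a \<le> b" for a b
  proof -
    consider "0 \<le> a" | "b \<le> 0" | "a \<le> 0" "0 \<le> b" using that by linarith
    then show ?thesis
    proof cases
      case 1 then show ?thesis using c[of 0 a b] that z[of 0 a] z[of 0 b] by (simp add: F_def)
    next
      case 2 then show ?thesis using c[of a b 0] that z[of a 0] z[of b 0] by (simp add: F_def)
    next
      case 3 then show ?thesis using c[of a 0 b] that z[of a 0] z[of 0 b] by (simp add: F_def)
    qed
  qed
  then show ?thesis using g by (auto simp: primitive_def)
qed

lemma primitive_eq:
  assumes "primitive F g" "a \<le> x" shows "F x = F a + integral {a..x} g"
  using assms by (simp add: primitive_def algebra_simps)

lemma primitive_continuous: assumes "primitive F g" shows "continuous_on UNIV F"
proof -
  have "isCont F x" for x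
  proof -
    have "continuous_on {x - 1..x + 1} (\<lambda>y. F (x - 1) + integral {x - 1..y} g)"
      using assms by (intro continuous_intros indefinite_integral_continuous_1 loc_integrable_integrable_on)
        (simp add: primitive_def)
    moreover have "continuous_on {x - 1..x + 1} (\<lambda>y. F (x - 1) + integral {x - 1..y} g)
      = continuous_on {x - 1..x + 1} F"
      using primitive_eq[OF assms] by (intro continuous_on_cong) auto
    ultimately show ?thesis by (simp add: continuous_on_interior)
  qed
  then show ?thesis by (simp add: continuous_at_imp_continuous_on)
qed

lemma test_fun_primitive: assumes "test_fun \<phi>" shows "primitive \<phi> (deriv \<phi>)"
proof -
  have D: "(\<phi> has_real_derivative deriv \<phi> x) (at x)" for x
    using assms smooth_DERIV by (auto simp: test_fun_iff)
  have "loc_integrable (deriv \<phi>)"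
    using test_fun_deriv[OF assms] by (intro loc_integrable_continuous) (simp add: smooth_continuous_on test_fun_iff)
  moreover have "\<phi> b - \<phi> a = integral {a..b} (deriv \<phi>)" if "a \<le> b" for a b
    using fundamental_theorem_of_calculus[OF that, of \<phi> "deriv \<phi>"] D
    by (auto simp: has_real_derivative_iff_has_vector_derivative has_vector_derivative_at_within integral_unique)
  ultimately show ?thesis by (simp add: primitive_def)
qed

text \<open>Integration by parts through Fubini: \<open>F x\<close> is replaced by
  \<open>F (-R)\<close> plus the integral of \<open>g\<close> up to \<open>x\<close>, and the order
  of integration is exchanged, so no derivative of \<open>F\<close> at a point is involved.\<close>

lemma primitive_weak_deriv: assumes F: "primitive F g" shows "weak_deriv F g"
proof -
  have g: "loc_integrable g" using F by (simp add: primitive_def)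
  have cF: "loc_integrable F" using primitive_continuous[OF F] by (rule loc_integrable_continuous)
  have "(\<integral>x. F x * deriv \<phi> x \<partial>lborel) = - (\<integral>y. g y * \<phi> y \<partial>lborel)" if \<phi>: "test_fun \<phi>" for \<phi>
  proof -
    obtain R where R: "R > 0" "\<And>x. \<bar>x\<bar> \<ge> R \<Longrightarrow> \<phi> x = 0" "\<And>x. \<bar>x\<bar> \<ge> R \<Longrightarrow> deriv \<phi> x = 0"
      using test_fun_support[OF \<phi>] by metis

    have nz: "\<bar>x\<bar> < R" if "deriv \<phi> x \<noteq> 0" for x using R(3)[of x] that by force
    have dphi: "test_fun (deriv \<phi>)" using \<phi> by (rule test_fun_deriv)
    have [measurable]: "g \<in> borel_measurable borel" "\<phi> \<in> borel_measurable borel" "deriv \<phi> \<in> borel_measurable borel"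
      using loc_integrable_measurable[OF g] test_fun_measurable \<phi> dphi by auto
    have P: "primitive \<phi> (deriv \<phi>)" by (rule test_fun_primitive[OF \<phi>])
    then have dl: "loc_integrable (deriv \<phi>)" by (simp add: primitive_def)
    have gR: "integrable lborel (\<lambda>y. g y * indicator {-R..R} y)"
      using g by (simp add: loc_integrable_def set_integrable_def mult.commute)
    have di: "integrable lborel (deriv \<phi>)"
      using loc_integrable_mult_test_fun[of "\<lambda>_. 1", OF loc_integrable_continuous dphi] by simp
    \<comment> \<open>The integrand on the triangle \<open>-R \<le> y \<le> x \<le> R\<close>.
      Integrating out \<open>y\<close> gives \<open>(F x - F (-R)) * deriv \<phi> x\<close>;
      integrating out \<open>x\<close> gives \<open>- (g y * \<phi> y)\<close>, because
      \<open>\<phi> R = 0\<close>.\<close>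
    define h where "h = (\<lambda>y x. g y * indicator {-R..R} y * (deriv \<phi> x * indicator {y..R} x))"
    have hm [measurable]: "case_prod h \<in> borel_measurable (lborel \<Otimes>\<^sub>M lborel)"
    proof -
      have "case_prod h = (\<lambda>z. g (fst z) * indicator {-R..R} (fst z) * (deriv \<phi> (snd z) *
          (if fst z \<le> snd z \<and> snd z \<le> R then 1 else 0)))"
        by (auto simp: h_def indicator_def)
      then show ?thesis by simp
    qed
    have hi: "integrable (lborel \<Otimes>\<^sub>M lborel) (case_prod h)"
    proof (rule Bochner_Integration.integrable_bound)
      show "integrable (lborel \<Otimes>\<^sub>M lborel) (\<lambda>(y, x). (g y * indicator {-R..R} y) * deriv \<phi> x)"
      proof (rule lborel_pair.Fubini_integrable)
        show "integrable lborel (\<lambda>y. LBINT x. norm (case (y, x) of (y, x) \<Rightarrow> (g y * indicator {-R..R} y) * deriv \<phi> x))"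
          using integrable_norm[OF gR] by (simp add: abs_mult)
      qed (use di in auto)
      show "AE z in lborel \<Otimes>\<^sub>M lborel. norm (case z of (y, x) \<Rightarrow> h y x)
        \<le> norm (case z of (y, x) \<Rightarrow> (g y * indicator {-R..R} y) * deriv \<phi> x)"
        by (rule AE_I2) (auto simp: h_def indicator_def)
    qed auto
    have "(\<integral>x. F x * deriv \<phi> x \<partial>lborel) = (\<integral>x. F (-R) * deriv \<phi> x + (\<integral>y. h y x \<partial>lborel) \<partial>lborel)"
    proof (rule Bochner_Integration.integral_cong[OF refl])
      fix x
      show "F x * deriv \<phi> x = F (-R) * deriv \<phi> x + (\<integral>y. h y x \<partial>lborel)"
      proof (cases "\<bar>x\<bar> \<ge> R")
        case True
        then show ?thesis by (simp add: R(3) h_def)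
      next
        case False
        then have *: "h y x = deriv \<phi> x * (g y * indicator {-R..x} y)" for y
          by (auto simp: h_def indicator_def)
        have "F x = F (-R) + (\<integral>y. g y * indicator {-R..x} y \<partial>lborel)"
          using primitive_eq[OF F, of "-R" x] False by (simp add: loc_integrable_integral[OF g])
        then show ?thesis unfolding * by (subst integral_mult_right_zero) (simp add: algebra_simps)
      qed
    qed
    also have "\<dots> = F (-R) * (\<integral>x. deriv \<phi> x \<partial>lborel) + (\<integral>x. (\<integral>y. h y x \<partial>lborel) \<partial>lborel)"
      using di lborel_pair.integrable_snd[OF hi] by (subst Bochner_Integration.integral_add) auto
    also have "(\<integral>x. (\<integral>y. h y x \<partial>lborel) \<partial>lborel) = (\<integral>y. (\<integral>x. h y x \<partial>lborel) \<partial>lborel)"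
      by (rule lborel_pair.Fubini_integral[OF hi])
    also have "(\<integral>x. deriv \<phi> x \<partial>lborel) = (\<integral>x. deriv \<phi> x * indicator {-R..R} x \<partial>lborel)"
      by (rule Bochner_Integration.integral_cong[OF refl]) (use nz in \<open>force simp: indicator_def\<close>)
    also have "\<dots> = 0"
      using P R by (simp add: primitive_def flip: loc_integrable_integral[OF dl])
         (metis R(2) abs_minus_cancel abs_of_pos diff_zero less_eq_real_def neg_le_iff_le order_trans neg_less_0_iff_less)
    also have "(\<integral>y. (\<integral>x. h y x \<partial>lborel) \<partial>lborel) = (\<integral>y. - (g y * \<phi> y) \<partial>lborel)"
    proof (rule Bochner_Integration.integral_cong[OF refl])
      fix y
      show "(\<integral>x. h y x \<partial>lborel) = - (g y * \<phi> y)"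
      proof (cases "y \<in> {-R..R}")
        case True
        have "(\<integral>x. h y x \<partial>lborel) = g y * integral {y..R} (deriv \<phi>)"
          using True by (simp add: h_def loc_integrable_integral[OF dl])
        also have "integral {y..R} (deriv \<phi>) = \<phi> R - \<phi> y"
          using P True by (auto simp: primitive_def)
        finally show ?thesis using R by simp
      next
        case False
        then have "R \<le> \<bar>y\<bar>" by auto
        then show ?thesis using False R(2)[of y] by (auto simp: h_def)
      qed
    qed
    finally show ?thesis by simp
  qed
  then show ?thesis using g cF by (simp add: weak_deriv_iff)
qed

text \<open>An antiderivative is constant on each side of the support, and the zero mean makes the
  two constants equal; subtracting the common value restores bounded support.\<close>

lemma test_fun_antiderivative:
  assumes \<psi>: "test_fun \<psi>" and zero: "(\<integral>x. \<psi> x \<partial>lborel) = 0"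
  shows "\<exists>\<phi>. test_fun \<phi> \<and> deriv \<phi> = \<psi>"
proof -
  have cont: "continuous_on UNIV \<psi>" using \<psi> by (simp add: test_fun_iff smooth_continuous_on)
  obtain \<Phi> where "\<forall>x::real. -\<infinity> < ereal x \<longrightarrow> ereal x < \<infinity> \<longrightarrow> (\<Phi> has_vector_derivative \<psi> x) (at x)"
    using einterval_antiderivative[of "-\<infinity>" \<infinity> \<psi>] cont by (auto simp: continuous_on_eq_continuous_at)
  then have D: "(\<Phi> has_real_derivative \<psi> x) (at x)" for x
    by (simp add: has_real_derivative_iff_has_vector_derivative)
  then have dP: "deriv \<Phi> = \<psi>" using DERIV_imp_deriv by blast
  have sm: "smooth \<Phi>" unfolding smooth_iff_deriv[of \<Phi>] dP
    using D \<psi> real_differentiable_def by (auto simp: test_fun_iff)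
  obtain R where R: "R > 0" "\<And>x. \<bar>x\<bar> \<ge> R \<Longrightarrow> \<psi> x = 0" using test_fun_support[OF \<psi>] by metis
  have nz: "\<bar>x\<bar> < R" if "\<psi> x \<noteq> 0" for x using R(2)[of x] that by force
  have ftc: "integral {a..b} \<psi> = \<Phi> b - \<Phi> a" if "a \<le> b" for a b
    using fundamental_theorem_of_calculus[OF that, of \<Phi> \<psi>] D
    by (auto simp: has_real_derivative_iff_has_vector_derivative has_vector_derivative_at_within integral_unique)
  have z: "integral {a..b} \<psi> = 0" if "\<And>x. x \<in> {a..b} \<Longrightarrow> \<bar>x\<bar> \<ge> R" for a b
    using integral_cong[of "{a..b}" \<psi> "\<lambda>_. 0"] that R by auto
  have tot: "\<Phi> R - \<Phi> (-R) = 0"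
  proof -
    have "integral {-R..R} \<psi> = (\<integral>x. \<psi> x * indicator {-R..R} x \<partial>lborel)"
      by (rule loc_integrable_integral[OF loc_integrable_continuous[OF cont]])
    also have "\<dots> = (\<integral>x. \<psi> x \<partial>lborel)"
      by (rule Bochner_Integration.integral_cong[OF refl]) (use nz in \<open>force simp: indicator_def\<close>)
    finally show ?thesis using zero ftc[of "-R" R] R by simp
  qed
  have out: "\<Phi> x = \<Phi> (-R)" if "\<bar>x\<bar> \<ge> R" for x
  proof (cases "x \<ge> R")
    case True
    then have "integral {R..x} \<psi> = 0" by (intro z) auto
    then show ?thesis using tot ftc[OF True] by simp
  next
    case False
    then have *: "x \<le> - R" using that by auto
    then have "integral {x..-R} \<psi> = 0" using R by (intro z) auto
    then show ?thesis using ftc[OF *] by simp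
  qed
  let ?\<phi> = "\<lambda>x. \<Phi> x + (- \<Phi> (-R))"
  have "{x. ?\<phi> x \<noteq> 0} \<subseteq> {-R..R}"
  proof
    fix x assume "x \<in> {x. ?\<phi> x \<noteq> 0}"
    then have "\<not> \<bar>x\<bar> \<ge> R" using out[of x] by auto
    then show "x \<in> {-R..R}" by auto
  qed
  then have "bounded {x. ?\<phi> x \<noteq> 0}" by (rule bounded_subset[OF bounded_closed_interval])
  moreover have "smooth ?\<phi>" by (intro smooth_add sm smooth_const)
  moreover have "deriv ?\<phi> = \<psi>"
  proof
    fix x have "(?\<phi> has_real_derivative \<psi> x + 0) (at x)" by (intro DERIV_add D DERIV_const)
    then show "deriv ?\<phi> x = \<psi> x" by (simp add: DERIV_imp_deriv)
  qed
  ultimately show ?thesis by (intro exI[of _ ?\<phi>]) (simp add: test_fun_iff)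
qed

text \<open>Any test function minus the right multiple of one fixed bump has zero mean and so is the
  derivative of a test function, against which \<open>d\<close> integrates to 0. Hence
  \<open>d\<close> acts on test functions as a constant does.\<close>

lemma weak_deriv_zero:
  assumes d: "weak_deriv d (\<lambda>_. 0)"
  shows "\<exists>c. AE x in lborel. d x = c"
proof -
  let ?b = "bump 0 1 0"
  have b: "test_fun ?b" by (rule test_fun_bump)
  have dl: "loc_integrable d" using d by (simp add: weak_deriv_iff)
  have int1: "integrable lborel \<phi>" if "test_fun \<phi>" for \<phi>
    using loc_integrable_mult_test_fun[of "\<lambda>_. 1", OF loc_integrable_continuous that] by simp
  have intd: "integrable lborel (\<lambda>x. d x * \<phi> x)" if "test_fun \<phi>" for \<phi>
    by (rule loc_integrable_mult_test_fun[OF dl that])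
  define I where "I = (\<integral>x. ?b x \<partial>lborel)"
  have "I \<noteq> 0"
  proof
    assume "I = 0"
    then have "AE x in lborel. ?b x = 0"
      unfolding I_def using integral_nonneg_eq_0_iff_AE[OF int1[OF b]] bump_nonneg by auto
    moreover have "?b x \<noteq> 0" if "x \<in> {0<..<1}" for x using that by (simp add: bump_def flat_def)
    ultimately have "AE x in lborel. x \<notin> {0<..<1::real}" by (auto elim: eventually_mono)
    then have "emeasure lborel {0<..<1::real} = 0" by (subst (asm) AE_iff_measurable[of "{0<..<1}"]) auto
    then show False using emeasure_lborel_Ioo[of 0 1] by (simp del: emeasure_lborel_Ioo)
  qed
  \<comment> \<open>The average of \<open>d\<close> with respect to the normalized bump; a constant
    \<open>d\<close> would force this value.\<close>
  define c where "c = (\<integral>x. d x * ?b x \<partial>lborel) / I"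
  have "AE x in lborel. d x - c = 0"
  proof (rule AE_zero_of_test_fun)
    show "loc_integrable (\<lambda>x. d x - c)"
      by (intro loc_integrable_diff dl loc_integrable_continuous continuous_on_const)
    fix \<psi> assume \<psi>: "test_fun \<psi>"
    define J where "J = (\<integral>x. \<psi> x \<partial>lborel) / I"
    let ?p = "\<lambda>x. \<psi> x + (- J) * ?b x"
    have p: "test_fun ?p"
    proof -
      have "{x. ?p x \<noteq> 0} \<subseteq> {x. \<psi> x \<noteq> 0} \<union> {x. ?b x \<noteq> 0}" by auto
      moreover have "bounded ({x. \<psi> x \<noteq> 0} \<union> {x. ?b x \<noteq> 0})"
        using b \<psi> by (simp add: test_fun_iff)
      ultimately have "bounded {x. ?p x \<noteq> 0}" using bounded_subset by blast
      moreover have "smooth ?p"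
        using b \<psi> by (intro smooth_add smooth_mult smooth_const) (auto simp: test_fun_iff)
      ultimately show ?thesis by (simp add: test_fun_iff)
    qed
    have "(\<integral>x. ?p x \<partial>lborel) = 0"
      using int1[OF b] int1[OF \<psi>] \<open>I \<noteq> 0\<close> by (simp add: J_def I_def[symmetric])
    then obtain \<phi> where \<phi>: "test_fun \<phi>" "deriv \<phi> = ?p" using test_fun_antiderivative[OF p] by blast
    then have "(\<integral>x. d x * ?p x \<partial>lborel) = 0" using d by (auto simp: weak_deriv_iff)
    then have "(\<integral>x. d x * \<psi> x - J * (d x * ?b x) \<partial>lborel) = 0"
      by (simp add: algebra_simps)
    then have "(\<integral>x. d x * \<psi> x \<partial>lborel) = J * (\<integral>x. d x * ?b x \<partial>lborel)"
      using intd[OF b] intd[OF \<psi>] by simp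
    moreover have "(\<integral>x. (d x - c) * \<psi> x \<partial>lborel) = (\<integral>x. d x * \<psi> x \<partial>lborel) - c * (\<integral>x. \<psi> x \<partial>lborel)"
      using intd[OF \<psi>] int1[OF \<psi>] by (simp add: left_diff_distrib)
    ultimately show "(\<integral>x. (d x - c) * \<psi> x \<partial>lborel) = 0"
      by (simp add: J_def c_def)
  qed
  then show ?thesis by auto
qed

text \<open>Subtracting any primitive of \<open>g\<close> leaves a function with weak derivative 0,
  that is, a constant. The result is the continuous representative on which all later pointwise
  estimates are made.\<close>

lemma weak_deriv_primitive:
  assumes f: "weak_deriv f g"
  obtains F where "primitive F g" "AE x in lborel. f x = F x"
proof -
  have g: "loc_integrable g" using f by (simp add: weak_deriv_iff)
  then obtain F0 where F0: "primitive F0 g" using primitive_exists by blast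
  have "weak_deriv (\<lambda>x. f x - F0 x) (\<lambda>x. g x - g x)"
    by (intro weak_deriv_diff f primitive_weak_deriv F0)
  then obtain c where c: "AE x in lborel. f x - F0 x = c" using weak_deriv_zero by auto
  show thesis
  proof (rule that[of "\<lambda>x. F0 x + c"])
    show "primitive (\<lambda>x. F0 x + c) g" using F0 by (simp add: primitive_def)
    show "AE x in lborel. f x = F0 x + c" using c by eventually_elim simp
  qed
qed

section \<open>Functions with dominated increments\<close>

definition loc_finite :: "(real \<Rightarrow> ennreal) \<Rightarrow> bool" where
  "loc_finite G \<longleftrightarrow> G \<in> borel_measurable borel \<and> (\<forall>a b. (\<integral>\<^sup>+x\<in>{a..b}. G x \<partial>lborel) < \<infinity>)"

text \<open>A bound on the derivative stated without a derivative. Unlike a bound on a weak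
  derivative it passes directly to pointwise limits, to integrals in time and, by Fubini, to the
  force; \<open>incr_primitive\<close> turns it back into one.\<close>

definition incr :: "(real \<Rightarrow> real) \<Rightarrow> (real \<Rightarrow> ennreal) \<Rightarrow> bool" where
  "incr f G \<longleftrightarrow> (\<forall>a b. a \<le> b \<longrightarrow> ennreal \<bar>f b - f a\<bar> \<le> (\<integral>\<^sup>+x\<in>{a..b}. G x \<partial>lborel))"

lemma primitive_incr: assumes F: "primitive F g" shows "incr F (\<lambda>x. ennreal \<bar>g x\<bar>)"
  unfolding incr_def
proof (intro allI impI)
  fix a b :: real assume ab: "a \<le> b"
  have g: "loc_integrable g" using F by (simp add: primitive_def)
  have i: "integrable lborel (\<lambda>x. g x * indicator {a..b} x)"
    using g by (simp add: loc_integrable_def set_integrable_def mult.commute)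
  have "ennreal \<bar>F b - F a\<bar> = ennreal (norm (\<integral>x. g x * indicator {a..b} x \<partial>lborel))"
    using F ab by (simp add: primitive_def loc_integrable_integral)
  also have "\<dots> \<le> (\<integral>\<^sup>+x. norm (g x * indicator {a..b} x) \<partial>lborel)"
    by (rule integral_norm_bound_ennreal[OF i])
  also have "\<dots> = (\<integral>\<^sup>+x\<in>{a..b}. ennreal \<bar>g x\<bar> \<partial>lborel)"
    by (intro nn_integral_cong) (auto simp: indicator_def)
  finally show "ennreal \<bar>F b - F a\<bar> \<le> (\<integral>\<^sup>+x\<in>{a..b}. ennreal \<bar>g x\<bar> \<partial>lborel)" .
qed

lemma loc_finite_AE: assumes "loc_finite G" shows "AE x in lborel. G x < \<infinity>"
proof -
  have [measurable]: "G \<in> borel_measurable borel" using assms by (simp add: loc_finite_def)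
  have "AE x in lborel. \<forall>n::nat. G x * indicator {-real n..real n} x \<noteq> \<infinity>"
    unfolding AE_all_countable
  proof
    fix n :: nat
    show "AE x in lborel. G x * indicator {-real n..real n} x \<noteq> \<infinity>"
      using assms by (intro nn_integral_PInf_AE) (auto simp: loc_finite_def less_top)
  qed
  then show ?thesis
  proof eventually_elim
    case (elim x)
    obtain n :: nat where "\<bar>x\<bar> < real n" using reals_Archimedean2 by blast
    then have "x \<in> {-real n..real n}" by auto
    then show ?case using elim[rule_format, of n] by (simp add: less_top)
  qed
qed

lemma loc_finite_real:
  assumes G: "loc_finite G"
  shows "loc_integrable (\<lambda>x. enn2real (G x))"
    and "integral {a..b} (\<lambda>x. enn2real (G x)) = enn2real (\<integral>\<^sup>+x\<in>{a..b}. G x \<partial>lborel)"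
proof -
  have [measurable]: "G \<in> borel_measurable borel" using assms by (simp add: loc_finite_def)
  have eq: "(\<integral>\<^sup>+x. ennreal (enn2real (G x) * indicator {a..b} x) \<partial>lborel) = (\<integral>\<^sup>+x\<in>{a..b}. G x \<partial>lborel)" for a b
    by (rule nn_integral_cong_AE, use loc_finite_AE[OF G] in eventually_elim) (auto simp: indicator_def)
  have "integrable lborel (\<lambda>x. enn2real (G x) * indicator {a..b} x)" for a b
    using G eq[of a b] by (intro integrableI_nonneg) (auto simp: loc_finite_def)
  then show *: "loc_integrable (\<lambda>x. enn2real (G x))"
    by (simp add: loc_integrable_def set_integrable_def mult.commute)
  show "integral {a..b} (\<lambda>x. enn2real (G x)) = enn2real (\<integral>\<^sup>+x\<in>{a..b}. G x \<partial>lborel)"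
    unfolding loc_integrable_integral[OF *] eq[symmetric]
    by (rule integral_eq_nn_integral) auto
qed

lemma enn2real_bound: "ennreal x \<le> y \<Longrightarrow> y < top \<Longrightarrow> x \<le> enn2real y"
  by (metis enn2real_leI enn2real_nonneg ennreal_enn2real ennreal_le_iff)

lemma incr_bound:
  assumes "incr f G" "loc_finite G" "a \<le> b"
  shows "\<bar>f b - f a\<bar> \<le> integral {a..b} (\<lambda>x. enn2real (G x))"
  using assms unfolding loc_finite_real(2)[OF assms(2)]
  by (intro enn2real_bound) (auto simp: incr_def loc_finite_def)

text \<open>The increments of \<open>f\<close> are dominated by those of a primitive of
  \<open>G\<close>, which is continuous.\<close>

lemma incr_continuous:
  assumes f: "incr f G" and G: "loc_finite G" shows "continuous_on UNIV f"
proof -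
  obtain \<Gamma> where \<Gamma>: "primitive \<Gamma> (\<lambda>x. enn2real (G x))"
    using primitive_exists[OF loc_finite_real(1)[OF G]] by blast
  have b: "\<bar>f y - f x\<bar> \<le> \<bar>\<Gamma> y - \<Gamma> x\<bar>" for x y
    using incr_bound[OF f G, of x y] incr_bound[OF f G, of y x] \<Gamma>
    by (cases "x \<le> y") (auto simp: primitive_def abs_minus_commute)
  have "isCont f x" for x
  proof -
    have "(\<Gamma> \<longlongrightarrow> \<Gamma> x) (at x)"
      using primitive_continuous[OF \<Gamma>] by (simp add: continuous_on_eq_continuous_at isCont_def)
    then have "((\<lambda>y. \<bar>\<Gamma> y - \<Gamma> x\<bar>) \<longlongrightarrow> 0) (at x)" by (simp add: LIM_zero tendsto_rabs_zero)
    then have "((\<lambda>y. f y - f x) \<longlongrightarrow> 0) (at x)"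
      by (rule Lim_null_comparison[rotated]) (use b in auto)
    then show ?thesis by (simp add: isCont_def LIM_zero_iff)
  qed
  then show ?thesis by (simp add: continuous_at_imp_continuous_on)
qed

lemma nn_integral_Ioc_Icc:
  assumes [measurable]: "f \<in> borel_measurable borel"
  shows "(\<integral>\<^sup>+x\<in>{a<..b}. f x \<partial>lborel) = (\<integral>\<^sup>+x\<in>{a..b::real}. f x \<partial>lborel)"
  using AE_lborel_singleton[of a]
  by (intro nn_integral_cong_AE) (auto simp: indicator_def elim!: eventually_mono)

text \<open>With \<open>\<Gamma>\<close> a primitive of \<open>G\<close>, the functions \<open>\<Gamma> + f\<close> and \<open>\<Gamma> - f\<close> are nondecreasing, and their
  Stieltjes measures add up to the measure with density \<open>2 G\<close>; hence both have Radon-Nikodym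
  densities, and half the difference of these densities is the derivative of \<open>f\<close>.\<close>
lemma incr_primitive:
  assumes f: "incr f G" and G: "loc_finite G"
  shows "\<exists>g. primitive f g \<and> (AE x in lborel. ennreal \<bar>g x\<bar> \<le> G x)"
proof -
  have [measurable]: "G \<in> borel_measurable borel" using G by (simp add: loc_finite_def)
  obtain \<Gamma> where \<Gamma>: "primitive \<Gamma> (\<lambda>x. enn2real (G x))"
    using primitive_exists[OF loc_finite_real(1)[OF G]] by blast
  have b: "\<bar>f y - f x\<bar> \<le> \<Gamma> y - \<Gamma> x" if "x \<le> y" for x y
    using incr_bound[OF f G that] \<Gamma> that by (auto simp: primitive_def)
  have \<Gamma>G: "ennreal (\<Gamma> b - \<Gamma> a) = (\<integral>\<^sup>+x\<in>{a..b}. G x \<partial>lborel)" if "a \<le> b" for a b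
    using \<Gamma> that loc_finite_real(2)[OF G, of a b] G by (simp add: primitive_def loc_finite_def)
  have cont: "isCont f x" "isCont \<Gamma> x" for x
    using primitive_continuous[OF \<Gamma>] incr_continuous[OF f G] by (auto simp: continuous_on_eq_continuous_at)
  define \<mu> where "\<mu> = interval_measure (\<lambda>x. \<Gamma> x + f x)"
  define \<nu> where "\<nu> = interval_measure (\<lambda>x. \<Gamma> x - f x)"
  have s [simp]: "sets \<mu> = sets borel" "sets \<nu> = sets borel" by (auto simp: \<mu>_def \<nu>_def)
  have \<mu>I: "emeasure \<mu> {a<..b} = ennreal ((\<Gamma> b + f b) - (\<Gamma> a + f a))" if "a \<le> b" for a b
    unfolding \<mu>_def using that
  proof (rule emeasure_interval_measure_Ioc)
    show "\<Gamma> x + f x \<le> \<Gamma> y + f y" if "x \<le> y" for x y using b[OF that] by linarith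
    show "continuous (at_right a) (\<lambda>x. \<Gamma> x + f x)" for a
      by (rule continuous_at_imp_continuous_at_within[OF continuous_add[OF cont(2) cont(1)]])
  qed
  have \<nu>I: "emeasure \<nu> {a<..b} = ennreal ((\<Gamma> b - f b) - (\<Gamma> a - f a))" if "a \<le> b" for a b
    unfolding \<nu>_def using that
  proof (rule emeasure_interval_measure_Ioc)
    show "\<Gamma> x - f x \<le> \<Gamma> y - f y" if "x \<le> y" for x y using b[OF that] by linarith
    show "continuous (at_right a) (\<lambda>x. \<Gamma> x - f x)" for a
      by (rule continuous_at_imp_continuous_at_within[OF continuous_diff[OF cont(2) cont(1)]])
  qed
  define N where "N = measure_of UNIV (sets borel) (\<lambda>A. emeasure \<mu> A + emeasure \<nu> A)"
  have sN [simp]: "sets N = sets borel"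
    unfolding N_def using sets.sigma_sets_eq[of "borel :: real measure"] by simp
  have eN: "emeasure N A = emeasure \<mu> A + emeasure \<nu> A" if "A \<in> sets borel" for A
    unfolding N_def
  proof (rule emeasure_measure_of_sigma)
    show "sigma_algebra UNIV (sets borel :: real set set)" using sets.sigma_algebra_axioms[of "borel :: real measure"] by (simp only: space_borel)
    show "positive (sets borel) (\<lambda>A. emeasure \<mu> A + emeasure \<nu> A)" unfolding positive_def by (simp only: emeasure_empty add_0_left)
    show "countably_additive (sets borel) (\<lambda>A. emeasure \<mu> A + emeasure \<nu> A)"
    proof (rule countably_additiveI)
      fix A :: "nat \<Rightarrow> real set" assume A: "range A \<subseteq> sets borel" "disjoint_family A"
      have "(\<Sum>i. emeasure \<mu> (A i) + emeasure \<nu> (A i)) = (\<Sum>i. emeasure \<mu> (A i)) + (\<Sum>i. emeasure \<nu> (A i))"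
        by (intro suminf_add[symmetric] summableI)
      then show "(\<Sum>i. emeasure \<mu> (A i) + emeasure \<nu> (A i)) = emeasure \<mu> (\<Union>(range A)) + emeasure \<nu> (\<Union>(range A))"
        using suminf_emeasure[of A \<mu>] suminf_emeasure[of A \<nu>] A by simp
    qed
  qed fact
  have dens: "density lborel (\<lambda>x. 2 * G x) = N"
  proof (rule measure_eqI_Ioc)
    fix a b :: real assume ab: "a \<le> b"
    have "emeasure (density lborel (\<lambda>x. 2 * G x)) {a<..b} = 2 * (\<integral>\<^sup>+x\<in>{a<..b}. G x \<partial>lborel)"
      by (simp add: emeasure_density nn_integral_cmult mult.assoc)
    also have "\<dots> = 2 * ennreal (\<Gamma> b - \<Gamma> a)" by (simp add: nn_integral_Ioc_Icc \<Gamma>G[OF ab])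
    finally have *: "emeasure (density lborel (\<lambda>x. 2 * G x)) {a<..b} = 2 * ennreal (\<Gamma> b - \<Gamma> a)" .
    then show "emeasure (density lborel (\<lambda>x. 2 * G x)) {a<..b} < \<infinity>" by (simp add: ennreal_mult_less_top)
    show "emeasure (density lborel (\<lambda>x. 2 * G x)) {a<..b} = emeasure N {a<..b}"
      unfolding * eN[OF greaterThanAtMost_borel] \<mu>I[OF ab] \<nu>I[OF ab] using b[OF ab]
      by (simp flip: ennreal_plus ennreal_numeral ennreal_mult)
  qed auto
  \<comment> \<open>Absolute continuity comes for free from the sum: \<open>N\<close> has a density,
    and both measures lie below \<open>N\<close>.\<close>
  have null: "emeasure \<mu> A = 0 \<and> emeasure \<nu> A = 0" if "A \<in> null_sets lborel" for A
  proof -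
    have "A \<in> sets borel" using that by auto
    moreover have "emeasure (density lborel (\<lambda>x. 2 * G x)) A = 0"
      using absolutely_continuousI_density[of "\<lambda>x. 2 * G x" lborel] that
      by (auto simp: absolutely_continuous_def)
    ultimately show ?thesis using dens eN by (metis add_eq_0_iff_both_eq_0)
  qed
  obtain m where [measurable]: "m \<in> borel_measurable lborel" and m: "density lborel m = \<mu>"
    using sigma_finite_measure.Radon_Nikodym[OF sigma_finite_lborel, of \<mu>] null
    by (auto simp: absolutely_continuous_def null_sets_def)
  obtain n where [measurable]: "n \<in> borel_measurable lborel" and n: "density lborel n = \<nu>"
    using sigma_finite_measure.Radon_Nikodym[OF sigma_finite_lborel, of \<nu>] null
    by (auto simp: absolutely_continuous_def null_sets_def)
  have "density lborel (\<lambda>x. m x + n x) = density lborel (\<lambda>x. 2 * G x)"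
  proof (rule measure_eqI)
    fix A assume "A \<in> sets (density lborel (\<lambda>x. m x + n x))"
    then have A [measurable]: "A \<in> sets borel" by simp
    have "emeasure (density lborel (\<lambda>x. m x + n x)) A = emeasure \<mu> A + emeasure \<nu> A"
      by (simp add: m[symmetric] n[symmetric] emeasure_density distrib_right nn_integral_add)
    then show "emeasure (density lborel (\<lambda>x. m x + n x)) A = emeasure (density lborel (\<lambda>x. 2 * G x)) A"
      using dens eN[OF A] by simp
  qed auto
  \<comment> \<open>Two nonnegative numbers with sum \<open>2 * G x\<close> have half their
    difference bounded by \<open>G x\<close>; this will be the bound on the derivative.\<close>
  then have mn: "AE x in lborel. m x + n x = 2 * G x"
    by (subst (asm) sigma_finite_measure.density_unique_iff[OF sigma_finite_lborel]) auto
  have mI: "(\<integral>\<^sup>+x\<in>{a..b}. m x \<partial>lborel) = ennreal ((\<Gamma> b + f b) - (\<Gamma> a + f a))" if "a \<le> b" for a b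
    using \<mu>I[OF that] by (simp add: m[symmetric] emeasure_density nn_integral_Ioc_Icc)
  have nI: "(\<integral>\<^sup>+x\<in>{a..b}. n x \<partial>lborel) = ennreal ((\<Gamma> b - f b) - (\<Gamma> a - f a))" if "a \<le> b" for a b
    using \<nu>I[OF that] by (simp add: n[symmetric] emeasure_density nn_integral_Ioc_Icc)
  have lf: "loc_finite m" "loc_finite n"
  proof -
    have "(\<integral>\<^sup>+x\<in>{a..b}. m x \<partial>lborel) < \<infinity> \<and> (\<integral>\<^sup>+x\<in>{a..b}. n x \<partial>lborel) < \<infinity>" for a b
      by (cases "a \<le> b") (simp_all add: mI nI)
    then show "loc_finite m" "loc_finite n" by (simp_all add: loc_finite_def)
  qed
  define g where "g x = (1/2) * (enn2real (m x) - enn2real (n x))" for x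
  have "primitive f g"
    unfolding primitive_def
  proof (intro conjI allI impI)
    show "loc_integrable g"
      unfolding g_def by (intro loc_integrable_cmult loc_integrable_diff loc_finite_real lf)
    fix a b :: real assume ab: "a \<le> b"
    have "integral {a..b} g = (1/2) * (integral {a..b} (\<lambda>x. enn2real (m x)) - integral {a..b} (\<lambda>x. enn2real (n x)))"
      unfolding g_def
      by (simp add: Henstock_Kurzweil_Integration.integral_diff loc_integrable_integrable_on loc_finite_real(1) lf)
    also have "\<dots> = f b - f a"
      unfolding loc_finite_real(2)[OF lf(1)] loc_finite_real(2)[OF lf(2)] mI[OF ab] nI[OF ab]
      using b[OF ab] by (simp add: field_simps)
    finally show "f b - f a = integral {a..b} g" by simp
  qed
  moreover have "AE x in lborel. ennreal \<bar>g x\<bar> \<le> G x"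
    using mn loc_finite_AE[OF G]
  proof eventually_elim
    case (elim x)
    then obtain r where r: "G x = ennreal r" "r \<ge> 0" by (cases "G x") auto
    then have e: "m x + n x = ennreal (2 * r)" using elim by (simp add: ennreal_mult)
    then obtain r1 r2 where q: "m x = ennreal r1" "r1 \<ge> 0" "n x = ennreal r2" "r2 \<ge> 0"
      by (cases "m x"; cases "n x") auto
    then have "r1 + r2 = 2 * r" using e r by (simp flip: ennreal_plus)
    then show ?case using q r by (simp add: g_def)
  qed
  ultimately show ?thesis by blast
qed

section \<open>\<open>L\<^sup>p\<close> bounds for nonnegative functions\<close>

definition epowr :: "ennreal \<Rightarrow> real \<Rightarrow> ennreal" where
  "epowr x q = (if x = top then top else ennreal (enn2real x powr q))"

lemma epowr_top [simp]: "epowr top q = top"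
  and epowr_ennreal [simp]: "0 \<le> x \<Longrightarrow> epowr (ennreal x) q = ennreal (x powr q)"
  and epowr_0 [simp]: "epowr 0 q = 0"
  by (auto simp: epowr_def)

lemma epowr_mono: "x \<le> y \<Longrightarrow> 0 \<le> q \<Longrightarrow> epowr x q \<le> epowr y q"
  by (cases x; cases y) (auto simp: powr_mono2 top_unique)

lemma epowr_mult: "epowr (x * y) q = epowr x q * epowr y q" if "q > 0"
proof (cases "x = 0 \<or> y = 0")
  case False
  then show ?thesis
    by (cases x; cases y)
      (auto simp: powr_mult ennreal_mult_top ennreal_top_mult simp flip: ennreal_mult)
qed auto

lemma epowr_inverse: "q > 0 \<Longrightarrow> epowr (epowr x q) (1 / q) = x" "q > 0 \<Longrightarrow> epowr (epowr x (1 / q)) q = x"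
  by (cases x; simp add: powr_powr)+

lemma borel_measurable_epowr [measurable (raw)]:
  assumes [measurable]: "f \<in> borel_measurable M" shows "(\<lambda>x. epowr (f x) q) \<in> borel_measurable M"
  unfolding epowr_def by measurable

text \<open>The norm \<open>Lp_norm\<close> extended to functions with values in
  \<open>[0, \<infinity>]\<close>, because majorants given by integrals or series may be infinite at
  some points.\<close>

definition eLp :: "ennreal \<Rightarrow> (real \<Rightarrow> ennreal) \<Rightarrow> ennreal" where
  "eLp p h = (if p = top then Inf {C. AE x in lborel. h x \<le> C}
     else epowr (\<integral>\<^sup>+x. epowr (h x) (enn2real p) \<partial>lborel) (1 / enn2real p))"

lemma Lp_norm_eq_eLp: "Lp_norm p f = eLp p (\<lambda>x. ennreal \<bar>f x\<bar>)"
  by (simp add: Lp_norm_def eLp_def Let_def epowr_def)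

lemma exponent_cases:
  assumes "1 \<le> p" obtains "p = top" | q where "p = ennreal q" "1 \<le> q"
  using assms by (cases p) auto

text \<open>The infimum is attained: the exceptional sets for the bounds
  \<open>C + 1 / (n + 1)\<close> have a null union.\<close>

lemma eLp_top_le_iff: "eLp top h \<le> C \<longleftrightarrow> (AE x in lborel. h x \<le> C)"
proof
  assume "AE x in lborel. h x \<le> C" then show "eLp top h \<le> C"
    by (auto simp: eLp_def intro: Inf_lower)
next
  assume le: "eLp top h \<le> C"
  show "AE x in lborel. h x \<le> C"
  proof (cases "C = top")
    case False
    have "AE x in lborel. h x \<le> C + ennreal (1 / Suc n)" for n
    proof -
      have "Inf {C. AE x in lborel. h x \<le> C} < C + ennreal (1 / Suc n)"
      proof (rule le_less_trans)
        show "Inf {C. AE x in lborel. h x \<le> C} \<le> C" using le by (simp add: eLp_def)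
        show "C < C + ennreal (1 / Suc n)"
          using False by (cases C) (simp_all add: ennreal_less_iff flip: ennreal_plus)
      qed
      then obtain D where "AE x in lborel. h x \<le> D" "D < C + ennreal (1 / Suc n)"
        by (auto simp: Inf_less_iff)
      then show ?thesis by (auto elim!: eventually_mono intro: order_trans less_imp_le)
    qed
    then have "AE x in lborel. \<forall>n. h x \<le> C + ennreal (1 / Suc n)"
      by (simp add: AE_all_countable)
    then show ?thesis
    proof eventually_elim
      case (elim x)
      show ?case
      proof (rule ennreal_le_epsilon)
        fix e :: real assume "e > 0"
        then obtain n where "1 / real (Suc n) < e" using nat_approx_posE by blast
        then show "h x \<le> C + ennreal e"
          using elim[rule_format, of n] by (meson add_left_mono ennreal_leI less_imp_le order_trans)
      qed
    qed
  qed simp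
qed

lemma eLp_le_iff:
  assumes "1 \<le> q" shows "eLp (ennreal q) h \<le> C \<longleftrightarrow> (\<integral>\<^sup>+x. epowr (h x) q \<partial>lborel) \<le> epowr C q"
proof -
  have eq: "eLp (ennreal q) h = epowr (\<integral>\<^sup>+x. epowr (h x) q \<partial>lborel) (1 / q)"
    using assms by (simp add: eLp_def)
  show ?thesis unfolding eq
    using assms epowr_mono[of "epowr (\<integral>\<^sup>+x. epowr (h x) q \<partial>lborel) (1 / q)" C q]
      epowr_mono[of "\<integral>\<^sup>+x. epowr (h x) q \<partial>lborel" "epowr C q" "1 / q"]
    by (auto simp: epowr_inverse)
qed

lemma eLp_mono_AE:
  assumes "1 \<le> p" "AE x in lborel. h x \<le> h' x" shows "eLp p h \<le> eLp p h'"
  using assms(1)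
proof (cases rule: exponent_cases)
  case 1
  have "AE x in lborel. h' x \<le> eLp top h'" using eLp_top_le_iff by blast
  then show ?thesis using assms(2) unfolding 1 eLp_top_le_iff
    by eventually_elim (rule order_trans)
next
  case (2 q)
  have "(\<integral>\<^sup>+x. epowr (h x) q \<partial>lborel) \<le> (\<integral>\<^sup>+x. epowr (h' x) q \<partial>lborel)"
    using assms(2) by (intro nn_integral_mono_AE) (use 2 in \<open>auto elim!: eventually_mono intro: epowr_mono\<close>)
  also have "\<dots> \<le> epowr (eLp p h') q" using 2 eLp_le_iff by blast
  finally show ?thesis using 2 eLp_le_iff by blast
qed

lemma eLp_mono: "1 \<le> p \<Longrightarrow> (\<And>x. h x \<le> h' x) \<Longrightarrow> eLp p h \<le> eLp p h'"
  by (rule eLp_mono_AE) auto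

lemma eLp_cong_AE: "1 \<le> p \<Longrightarrow> AE x in lborel. h x = h' x \<Longrightarrow> eLp p h = eLp p h'"
  by (intro antisym eLp_mono_AE) (auto elim: eventually_mono)

lemma eLp_cmult:
  assumes "1 \<le> p" and [measurable]: "h \<in> borel_measurable borel"
  shows "eLp p (\<lambda>x. c * h x) \<le> c * eLp p h"
  using assms(1)
proof (cases rule: exponent_cases)
  case 1
  have "AE x in lborel. h x \<le> eLp top h" using eLp_top_le_iff by blast
  then show ?thesis unfolding 1 eLp_top_le_iff
    by eventually_elim (rule mult_left_mono, auto)
next
  case (2 q)
  have "(\<integral>\<^sup>+x. epowr (c * h x) q \<partial>lborel) = epowr c q * (\<integral>\<^sup>+x. epowr (h x) q \<partial>lborel)"
    using 2 by (simp add: epowr_mult nn_integral_cmult)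
  also have "\<dots> \<le> epowr c q * epowr (eLp p h) q"
    using 2 eLp_le_iff[of q h "eLp p h"] by (intro mult_left_mono) auto
  also have "\<dots> = epowr (c * eLp p h) q" using 2 by (simp add: epowr_mult)
  finally show ?thesis using 2 eLp_le_iff by blast
qed

section \<open>Jensen's and Minkowski's inequalities\<close>

lemma tangent_powr:
  fixes y l q :: real
  assumes "1 \<le> q" "0 \<le> y" "0 < l"
  shows "q * l powr (q - 1) * y \<le> y powr q + (q - 1) * l powr q"
proof (cases "q = 1")
  case False
  define r where "r = q / (q - 1)"
  have r: "r > 1" "1 / q + 1 / r = 1" using False assms by (auto simp: r_def field_simps)
  \<comment> \<open>Young's inequality with the conjugate exponents \<open>q\<close> and
    \<open>q / (q - 1)\<close>; the outcome says that \<open>y powr q\<close> lies above its tangent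
    at \<open>l\<close>.\<close>
  have "y * l powr (q - 1) \<le> y powr q / q + (l powr (q - 1)) powr r / r"
    using False assms r by (intro Youngs_inequality) auto
  moreover have "(l powr (q - 1)) powr r = l powr q"
    using False assms by (simp add: powr_powr r_def)
  ultimately have "y * l powr (q - 1) \<le> y powr q / q + l powr q * (q - 1) / q"
    using False assms by (simp add: r_def)
  then show ?thesis using assms by (simp add: field_simps)
qed (use assms in auto)

lemma tangent_epowr:
  assumes "1 \<le> q" "0 < l"
  shows "ennreal (q * l powr (q - 1)) * y \<le> epowr y q + ennreal ((q - 1) * l powr q)"
proof (cases y)
  case (real r)
  then show ?thesis using tangent_powr[OF assms(1) _ assms(2), of r] assms
    by (simp flip: ennreal_mult ennreal_plus)
qed (use assms in auto)

text \<open>Integrate the tangent inequality over \<open>M\<close> and take the tangent at the mean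
  value of \<open>g\<close>. The mass \<open>m\<close> is general, hence the power
  \<open>q - 1\<close>.\<close>

lemma nn_integral_jensen:
  assumes q: "1 \<le> q" and m: "emeasure M (space M) = ennreal m" "0 \<le> m"
    and [measurable]: "g \<in> borel_measurable M"
  shows "epowr (\<integral>\<^sup>+x. g x \<partial>M) q \<le> ennreal (m powr (q - 1)) * (\<integral>\<^sup>+x. epowr (g x) q \<partial>M)"
proof -
  define a where "a = (\<integral>\<^sup>+x. g x \<partial>M)"
  define S where "S = (\<integral>\<^sup>+x. epowr (g x) q \<partial>M)"
  have tan: "ennreal (q * l powr (q - 1)) * a \<le> S + ennreal ((q - 1) * l powr q) * ennreal m"
    if "l > 0" for l
  proof -
    have "ennreal (q * l powr (q - 1)) * a = (\<integral>\<^sup>+x. ennreal (q * l powr (q - 1)) * g x \<partial>M)"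
      by (simp add: a_def nn_integral_cmult)
    also have "\<dots> \<le> (\<integral>\<^sup>+x. epowr (g x) q + ennreal ((q - 1) * l powr q) \<partial>M)"
      by (intro nn_integral_mono tangent_epowr q that)
    also have "\<dots> = S + ennreal ((q - 1) * l powr q) * ennreal m"
      by (simp add: S_def nn_integral_add m)
    finally show ?thesis .
  qed
  have "epowr a q \<le> ennreal (m powr (q - 1)) * S"
  proof (cases "m = 0")
    case True
    then have "a = 0" using m unfolding a_def
      by (subst nn_integral_0_iff_AE) (auto intro!: AE_I[of _ _ "space M"])
    then show ?thesis by simp
  next
    case False
    then have mp: "m > 0" using m by simp
    show ?thesis
    proof (cases "S = top")
      case True
      then show ?thesis using mp by (simp add: ennreal_mult_top)
    next
      case False
      then obtain s where s: "S = ennreal s" "s \<ge> 0" by (cases S) auto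
      \<comment> \<open>The tangent at 1 already shows that a finite \<open>S\<close> forces a
        finite integral, so that a real mean value exists.\<close>
      have "ennreal q * a < top"
        using tan[of 1] s by (simp add: le_less_trans[OF _ ennreal_less_top] flip: ennreal_mult'' ennreal_plus ) (metis (no_types) ennreal_add_less_top ennreal_less_top ennreal_mult_less_top le_less_trans m(2))
      then have "a < top" using q by (auto simp: ennreal_mult_less_top)
      then obtain r where r: "a = ennreal r" "r \<ge> 0" by (cases a) auto
      show ?thesis
      proof (cases "r = 0")
        case True then show ?thesis using r by simp
      next
        case False
        then have rp: "r > 0" using r by simp
        \<comment> \<open>The mean value of \<open>g\<close> makes the two powers of
          \<open>l\<close> below equal, and the terms with \<open>q - 1\<close> cancel.\<close>
        define l where "l = r / m"
        have l: "l > 0" using rp mp by (simp add: l_def)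
        have "q * l powr (q - 1) * r \<le> s + (q - 1) * l powr q * m"
          using tan[OF l] q mp rp s l unfolding r s
          by (simp flip: ennreal_mult ennreal_plus)
        then have "q * (l powr (q - 1) * r) \<le> s + (q - 1) * (l powr q * m)"
          by (simp only: mult.assoc)
        moreover have "l powr (q - 1) * r = r powr q / m powr (q - 1)"
          using rp mp by (simp add: l_def powr_divide powr_diff)
        moreover have "l powr q * m = r powr q / m powr (q - 1)"
          using rp mp by (simp add: l_def powr_divide powr_diff)
        ultimately have "q * (r powr q / m powr (q - 1)) \<le> s + (q - 1) * (r powr q / m powr (q - 1))"
          by (simp only:)
        then have "r powr q / m powr (q - 1) \<le> s" by (simp only: left_diff_distrib)
        then have "r powr q \<le> m powr (q - 1) * s" using mp by (simp add: field_simps)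
        then show ?thesis using r s by (simp flip: ennreal_mult)
      qed
    qed
  qed
  then show ?thesis by (simp add: a_def S_def)
qed

text \<open>With a uniform bound \<open>C\<close> on the slices, Jensen in \<open>z\<close> for
  fixed \<open>x\<close> followed by Tonelli suffices, and \<open>m powr (q - 1) * m\<close> becomes
  the \<open>q\<close>-th power of the mass. For \<open>p = top\<close> it is an exchange of almost
  everywhere quantifiers.\<close>

lemma eLp_Minkowski:
  assumes p: "1 \<le> p" and m: "emeasure M (space M) = ennreal m" "0 \<le> m"
    and f [measurable]: "(\<lambda>(z, x). f z x) \<in> borel_measurable (M \<Otimes>\<^sub>M borel)"
    and le: "\<And>z. z \<in> space M \<Longrightarrow> eLp p (f z) \<le> C"
  shows "eLp p (\<lambda>x. \<integral>\<^sup>+z. f z x \<partial>M) \<le> ennreal m * C"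
proof -
  interpret M: finite_measure M by (rule finite_measureI) (simp add: m)
  interpret P: pair_sigma_finite M lborel ..
  from p show ?thesis
  proof (cases rule: exponent_cases)
    case 1
    have "AE z in M. AE x in lborel. f z x \<le> C"
      using le unfolding 1 eLp_top_le_iff by auto
    moreover have [measurable]: "(\<lambda>(z, x). f z x) \<in> borel_measurable (M \<Otimes>\<^sub>M lborel)"
      using f by (simp only: measurable_cong_sets[OF sets_pair_measure_cong[OF refl sets_lborel] refl])
    ultimately have "AE x in lborel. AE z in M. f z x \<le> C"
      by (subst (asm) P.AE_commute) measurable
    then show ?thesis unfolding 1 eLp_top_le_iff
    proof eventually_elim
      case (elim x)
      have "(\<integral>\<^sup>+z. f z x \<partial>M) \<le> (\<integral>\<^sup>+z. C \<partial>M)" by (rule nn_integral_mono_AE[OF elim])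
      then show ?case using m by (simp add: mult.commute)
    qed
  next
    case (2 q)
    have "(\<integral>\<^sup>+x. epowr (\<integral>\<^sup>+z. f z x \<partial>M) q \<partial>lborel)
        \<le> (\<integral>\<^sup>+x. ennreal (m powr (q - 1)) * (\<integral>\<^sup>+z. epowr (f z x) q \<partial>M) \<partial>lborel)"
      using 2 m by (intro nn_integral_mono nn_integral_jensen) auto
    also have "\<dots> = ennreal (m powr (q - 1)) * (\<integral>\<^sup>+x. (\<integral>\<^sup>+z. epowr (f z x) q \<partial>M) \<partial>lborel)"
      by (rule nn_integral_cmult) measurable
    also have "(\<integral>\<^sup>+x. (\<integral>\<^sup>+z. epowr (f z x) q \<partial>M) \<partial>lborel) = (\<integral>\<^sup>+z. (\<integral>\<^sup>+x. epowr (f z x) q \<partial>lborel) \<partial>M)"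
      by (rule P.Fubini') measurable
    also have "\<dots> \<le> (\<integral>\<^sup>+z. epowr C q \<partial>M)"
      using le 2 eLp_le_iff by (intro nn_integral_mono) blast
    also have "\<dots> = epowr C q * ennreal m" using m by simp
    also have "ennreal (m powr (q - 1)) * (epowr C q * ennreal m) = epowr (ennreal m * C) q"
    proof -
      have "m powr (q - 1) * m = m powr q" using m 2 by (cases "m = 0") (auto simp: powr_diff)
      then have "ennreal (m powr (q - 1)) * ennreal m = epowr (ennreal m) q"
        using m by (simp flip: ennreal_mult)
      then have "ennreal (m powr (q - 1)) * (epowr C q * ennreal m) = epowr (ennreal m) q * epowr C q"
        by (metis mult.assoc mult.commute)
      then show ?thesis using 2 by (simp add: epowr_mult)
    qed
    finally show ?thesis using 2 eLp_le_iff by (simp add: mult_left_mono)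
  qed
qed

text \<open>The measure with two atoms whose masses are the norms, and the normalized functions as
  slices, turn the uniform-slice inequality into the triangle inequality.\<close>

lemma eLp_add:
  assumes p: "1 \<le> p" and [measurable]: "h \<in> borel_measurable borel" "h' \<in> borel_measurable borel"
  shows "eLp p (\<lambda>x. h x + h' x) \<le> eLp p h + eLp p h'"
proof (cases "eLp p h = top \<or> eLp p h' = top")
  case False
  then obtain a b where ab: "eLp p h = ennreal a" "eLp p h' = ennreal b" "a \<ge> 0" "b \<ge> 0"
    by (cases "eLp p h"; cases "eLp p h'") auto
  show ?thesis
  proof (rule ennreal_le_epsilon)
    fix e :: real assume e: "e > 0"
    \<comment> \<open>The surplus \<open>e / 2\<close> keeps both masses positive when a norm is 0,
      so that one can divide by them.\<close>
    define a' b' where "a' = a + e / 2" and "b' = b + e / 2"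
    have pos: "a' > 0" "b' > 0" using ab e by (auto simp: a'_def b'_def)
    define M where "M = density (count_space UNIV) (\<lambda>z. ennreal (if z then a' else b'))"
    define f where "f = (\<lambda>z x. if z then ennreal (1 / a') * h x else ennreal (1 / b') * h' x)"
    have "eLp p (\<lambda>x. \<integral>\<^sup>+z. f z x \<partial>M) \<le> ennreal (a' + b') * 1"
    proof (rule eLp_Minkowski[OF p])
      show "emeasure M (space M) = ennreal (a' + b')"
        using pos by (simp add: M_def emeasure_density nn_integral_count_space_finite UNIV_bool add.commute)
      show "(\<lambda>(z, x). f z x) \<in> borel_measurable (M \<Otimes>\<^sub>M borel)"
        unfolding f_def M_def by measurable
      fix z
      have "ennreal (1 / a') * eLp p h \<le> 1" "ennreal (1 / b') * eLp p h' \<le> 1"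
        using pos ab e by (auto simp: a'_def b'_def simp flip: ennreal_mult ennreal_1)
      then have "eLp p (\<lambda>x. ennreal (1 / a') * h x) \<le> 1" "eLp p (\<lambda>x. ennreal (1 / b') * h' x) \<le> 1"
        by (auto intro: order_trans[OF eLp_cmult[OF p]])
      then show "eLp p (f z) \<le> 1" by (cases z) (auto simp: f_def)
    qed (use pos in auto)
    also have "(\<lambda>x. \<integral>\<^sup>+z. f z x \<partial>M) = (\<lambda>x. h x + h' x)"
      using pos by (auto simp: M_def f_def nn_integral_density nn_integral_count_space_finite UNIV_bool
          add.commute mult.assoc[symmetric] simp flip: ennreal_mult)
    finally show "eLp p (\<lambda>x. h x + h' x) \<le> eLp p h + eLp p h' + ennreal e"
      using ab e by (simp add: a'_def b'_def ac_simps flip: ennreal_plus)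
  qed
qed auto

text \<open>The inequality for the measure on the naturals with mass \<open>2^-n\<close> at
  \<open>n\<close>, whose total mass is 2.\<close>

lemma eLp_suminf:
  assumes p: "1 \<le> p" and [measurable]: "\<And>n. h n \<in> borel_measurable borel" and le: "\<And>n. eLp p (h n) \<le> C"
  shows "eLp p (\<lambda>x. \<Sum>n. ennreal ((1 / 2) ^ n) * h n x) \<le> 2 * C"
proof -
  define M where "M = density (count_space UNIV) (\<lambda>n. ennreal ((1 / 2) ^ n))"
  have "eLp p (\<lambda>x. \<integral>\<^sup>+n. h n x \<partial>M) \<le> ennreal 2 * C"
  proof (rule eLp_Minkowski[OF p])
    have "(\<Sum>n. ennreal ((1 / 2) ^ n)) = ennreal 2"
      using suminf_geometric[of "1/2::real"] by (subst suminf_ennreal2) auto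
    then show "emeasure M (space M) = ennreal 2"
      by (simp add: M_def emeasure_density nn_integral_count_space_nat)
    show "(\<lambda>(n, x). h n x) \<in> borel_measurable (M \<Otimes>\<^sub>M borel)"
      unfolding M_def by measurable
  qed (use le in auto)
  then show ?thesis by (simp add: M_def nn_integral_density nn_integral_count_space_nat)
qed

lemma eLp_translate:
  assumes p: "1 \<le> p" and [measurable]: "h \<in> borel_measurable borel"
  shows "eLp p (\<lambda>x. h (x + z)) \<le> eLp p h"
  using p
proof (cases rule: exponent_cases)
  case 1
  have "AE x in lborel. h x \<le> eLp top h" using eLp_top_le_iff by blast
  then have "AE x in lborel. h (z + 1 * x) \<le> eLp top h"
    using AE_borel_affine[of 1 "\<lambda>x. h x \<le> eLp top h" z] by auto
  then show ?thesis unfolding 1 eLp_top_le_iff by (simp add: add.commute)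
next
  case (2 q)
  have "(\<integral>\<^sup>+x. epowr (h (x + z)) q \<partial>lborel) = (\<integral>\<^sup>+x. epowr (h x) q \<partial>lborel)"
    using nn_integral_real_affine[of "\<lambda>x. epowr (h x) q" 1 z] by (simp add: add.commute)
  also have "\<dots> \<le> epowr (eLp p h) q" using 2 eLp_le_iff by blast
  finally show ?thesis using 2 eLp_le_iff by blast
qed

section \<open>The positive operator that dominates the force\<close>

definition abs_conv :: "(real \<Rightarrow> real) \<Rightarrow> (real \<Rightarrow> ennreal) \<Rightarrow> real \<Rightarrow> ennreal" where
  "abs_conv \<alpha> h x = (\<integral>\<^sup>+z. ennreal \<bar>\<alpha> z\<bar> * (h (x + z) + h x) \<partial>lborel)"

lemma abs_conv_measurable [measurable]:
  assumes [measurable]: "\<alpha> \<in> borel_measurable borel" "h \<in> borel_measurable borel"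
  shows "abs_conv \<alpha> h \<in> borel_measurable borel"
  unfolding abs_conv_def by measurable

lemma abs_conv_eLp:
  assumes p: "1 \<le> p" and \<alpha>: "integrable lborel \<alpha>" and [measurable]: "h \<in> borel_measurable borel"
  shows "eLp p (abs_conv \<alpha> h) \<le> ennreal (2 * (\<integral>x. \<bar>\<alpha> x\<bar> \<partial>lborel)) * eLp p h"
proof -
  have [measurable]: "\<alpha> \<in> borel_measurable borel" using \<alpha> by auto
  define M where "M = density lborel (\<lambda>z. ennreal \<bar>\<alpha> z\<bar>)"
  let ?m = "\<integral>x. \<bar>\<alpha> x\<bar> \<partial>lborel"
  have "eLp p (\<lambda>x. \<integral>\<^sup>+z. h (x + z) + h x \<partial>M) \<le> ennreal ?m * (2 * eLp p h)"
  proof (rule eLp_Minkowski[OF p])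
    show "emeasure M (space M) = ennreal ?m"
      using \<alpha> by (simp add: M_def emeasure_density nn_integral_eq_integral)
    show "(\<lambda>(z, x). h (x + z) + h x) \<in> borel_measurable (M \<Otimes>\<^sub>M borel)"
      unfolding M_def by measurable
    show "eLp p (\<lambda>x. h (x + z) + h x) \<le> 2 * eLp p h" for z
      using order_trans[OF eLp_add[OF p, of "\<lambda>x. h (x + z)" h] add_right_mono[OF eLp_translate[OF p]]]
      by (simp flip: mult_2)
  qed auto
  also have "(\<lambda>x. \<integral>\<^sup>+z. h (x + z) + h x \<partial>M) = abs_conv \<alpha> h"
    by (auto simp: M_def abs_conv_def nn_integral_density)
  also have "ennreal ?m * (2 * eLp p h) = ennreal (2 * ?m) * eLp p h"
    by (simp add: ennreal_mult' mult_ac)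
  finally show ?thesis .
qed

text \<open>Lebesgue measure on an interval of length 1 is a probability measure, so Jensen holds
  with constant 1. This yields both local integrability and the sup bound.\<close>

lemma eLp_unit_interval:
  assumes p: "1 \<le> p" and [measurable]: "h \<in> borel_measurable borel"
  shows "(\<integral>\<^sup>+y\<in>{x..x+1}. h y \<partial>lborel) \<le> eLp p h"
proof -
  define M where "M = density lborel (indicator {x..x+1::real} :: real \<Rightarrow> ennreal)"
  have M1: "emeasure M (space M) = ennreal 1" by (simp add: M_def emeasure_density)
  have eq: "(\<integral>\<^sup>+y\<in>{x..x+1}. h y \<partial>lborel) = (\<integral>\<^sup>+y. h y \<partial>M)"
    by (simp add: M_def nn_integral_density mult.commute)
  from p show ?thesis
  proof (cases rule: exponent_cases)
    case 1
    have "AE y in lborel. h y \<le> eLp top h" using eLp_top_le_iff by blast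
    then have "(\<integral>\<^sup>+y\<in>{x..x+1}. h y \<partial>lborel) \<le> (\<integral>\<^sup>+y\<in>{x..x+1}. eLp top h \<partial>lborel)"
      by (intro nn_integral_mono_AE) (auto elim!: eventually_mono simp: indicator_def)
    then show ?thesis by (simp add: 1 nn_integral_cmult)
  next
    case (2 q)
    have "epowr (\<integral>\<^sup>+y. h y \<partial>M) q \<le> ennreal (1 powr (q - 1)) * (\<integral>\<^sup>+y. epowr (h y) q \<partial>M)"
      using 2 M1 by (intro nn_integral_jensen) (auto simp: M_def)
    also have "\<dots> \<le> (\<integral>\<^sup>+y. epowr (h y) q \<partial>lborel)"
      by (auto simp: M_def nn_integral_density indicator_def intro!: nn_integral_mono)
    also have "\<dots> \<le> epowr (eLp p h) q" using 2 eLp_le_iff by blast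
    finally have "epowr (\<integral>\<^sup>+y. h y \<partial>M) q \<le> epowr (eLp p h) q" .
    then have "epowr (epowr (\<integral>\<^sup>+y. h y \<partial>M) q) (1 / q) \<le> epowr (epowr (eLp p h) q) (1 / q)"
      using 2(2) by - (rule epowr_mono, auto)
    moreover have "q > 0" using 2(2) by simp
    ultimately show ?thesis by (simp only: epowr_inverse(1) eq)
  qed
qed

lemma eLp_loc_finite:
  assumes p: "1 \<le> p" and m [measurable]: "h \<in> borel_measurable borel" and fin: "eLp p h < top"
  shows "loc_finite h"
proof -
  have n: "(\<integral>\<^sup>+y\<in>{a..a + real n}. h y \<partial>lborel) < top" for a n
  proof (induction n)
    case 0
    have "(\<integral>\<^sup>+y\<in>{a}. h y \<partial>lborel) = (\<integral>\<^sup>+y\<in>{}. h y \<partial>lborel)"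
      using AE_lborel_singleton[of a] by (intro nn_integral_cong_AE) (auto simp: indicator_def elim!: eventually_mono)
    then show ?case by simp
  next
    case (Suc n)
    have "(\<integral>\<^sup>+y\<in>{a..a + real (Suc n)}. h y \<partial>lborel)
       \<le> (\<integral>\<^sup>+y. h y * indicator {a..a + real n} y + h y * indicator {a + real n..a + real n + 1} y \<partial>lborel)"
      by (intro nn_integral_mono) (auto simp: indicator_def)
    also have "\<dots> = (\<integral>\<^sup>+y\<in>{a..a + real n}. h y \<partial>lborel) + (\<integral>\<^sup>+y\<in>{a + real n..a + real n + 1}. h y \<partial>lborel)"
      by (rule nn_integral_add) auto
    also have "\<dots> < top"
      using Suc le_less_trans[OF eLp_unit_interval[OF p m] fin] by simp
    finally show ?case .
  qed
  have "(\<integral>\<^sup>+y\<in>{a..b}. h y \<partial>lborel) < top" for a b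
  proof -
    obtain n :: nat where "b - a \<le> real n" using real_arch_simple by blast
    then have "(\<integral>\<^sup>+y\<in>{a..b}. h y \<partial>lborel) \<le> (\<integral>\<^sup>+y\<in>{a..a + real n}. h y \<partial>lborel)"
      by (intro nn_set_integral_set_mono) auto
    then show ?thesis using n le_less_trans by blast
  qed
  then show ?thesis by (simp add: loc_finite_def)
qed

section \<open>The norm of \<open>W\<^sup>1\<^sup>,\<^sup>p\<close>\<close>

lemma W1p_norm_eq:
  assumes p: "1 \<le> p" and g: "weak_deriv f g"
  shows "W1p_norm p f = eLp p (\<lambda>x. ennreal \<bar>f x\<bar>) + eLp p (\<lambda>x. ennreal \<bar>g x\<bar>)"
proof -
  define g' where "g' = (SOME g. g \<in> borel_measurable lborel \<and> weak_deriv f g)"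
  have "\<exists>g. g \<in> borel_measurable lborel \<and> weak_deriv f g"
    using g loc_integrable_measurable by (auto simp: weak_deriv_iff)
  then have "g' \<in> borel_measurable lborel \<and> weak_deriv f g'"
    unfolding g'_def by (rule someI_ex)
  then have "AE x in lborel. g' x = g x" using weak_deriv_unique g by blast
  then have "eLp p (\<lambda>x. ennreal \<bar>g' x\<bar>) = eLp p (\<lambda>x. ennreal \<bar>g x\<bar>)"
    by (intro eLp_cong_AE p) (auto elim: eventually_mono)
  then show ?thesis by (simp add: W1p_norm_def Lp_norm_eq_eLp g'_def)
qed

text \<open>Elements of \<open>W1p p\<close> are arbitrary on null sets, so norm and membership are
  read off the primitive \<open>F\<close> that agrees with \<open>f\<close> almost
  everywhere.\<close>

lemma W1p_primitiveI:
  assumes p: "1 \<le> p" and F: "primitive F g" and fm: "f \<in> borel_measurable borel" and eq: "AE x in lborel. f x = F x"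
  shows "W1p_norm p f = eLp p (\<lambda>x. ennreal \<bar>F x\<bar>) + eLp p (\<lambda>x. ennreal \<bar>g x\<bar>)"
    and "W1p_norm p f < top \<Longrightarrow> f \<in> W1p p"
proof -
  have "AE x in lborel. F x = f x" using eq by eventually_elim simp
  then have w: "weak_deriv f g"
    using weak_deriv_cong_AE[OF primitive_weak_deriv[OF F]] fm by simp
  have e: "eLp p (\<lambda>x. ennreal \<bar>f x\<bar>) = eLp p (\<lambda>x. ennreal \<bar>F x\<bar>)"
    using eq by (intro eLp_cong_AE p) (auto elim: eventually_mono)
  show N: "W1p_norm p f = eLp p (\<lambda>x. ennreal \<bar>F x\<bar>) + eLp p (\<lambda>x. ennreal \<bar>g x\<bar>)"
    using W1p_norm_eq[OF p w] e by simp
  show "f \<in> W1p p" if "W1p_norm p f < top"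
    unfolding W1p_def mem_Collect_eq
  proof (intro conjI exI[of _ g])
    show "g \<in> borel_measurable lborel" using w loc_integrable_measurable by (auto simp: weak_deriv_iff)
  qed (use that fm w N e in \<open>auto simp: Lp_norm_eq_eLp\<close>)
qed

lemma W1p_primitiveE:
  assumes p: "1 \<le> p" and f: "f \<in> W1p p"
  obtains F g where "primitive F g" "AE x in lborel. f x = F x" "f \<in> borel_measurable borel"
    "W1p_norm p f = eLp p (\<lambda>x. ennreal \<bar>F x\<bar>) + eLp p (\<lambda>x. ennreal \<bar>g x\<bar>)" "W1p_norm p f < top"
proof -
  from f obtain g where g: "weak_deriv f g" "Lp_norm p g < top" and fm: "f \<in> borel_measurable borel" "Lp_norm p f < top"
    by (auto simp: W1p_def)
  obtain F where F: "primitive F g" "AE x in lborel. f x = F x" using weak_deriv_primitive[OF g(1)] .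
  have "W1p_norm p f < top" using W1p_norm_eq[OF p g(1)] g fm by (simp add: Lp_norm_eq_eLp)
  then show thesis using that[OF F fm(1)] W1p_primitiveI(1)[OF p F(1) fm(1) F(2)] by simp
qed

lemma W1p_norm_finite: "1 \<le> p \<Longrightarrow> f \<in> W1p p \<Longrightarrow> W1p_norm p f < top"
  by (metis W1p_primitiveE)

text \<open>The bridge from majorants to the norm: \<open>incr_primitive\<close> supplies a weak
  derivative below \<open>G1\<close>.\<close>

lemma W1p_dominated:
  assumes p: "1 \<le> p" and fm: "f \<in> borel_measurable borel" and eq: "AE x in lborel. f x = F x"
    and G0: "AE x in lborel. ennreal \<bar>F x\<bar> \<le> G0 x" and F: "incr F G1" and G1: "loc_finite G1"
  shows "W1p_norm p f \<le> eLp p G0 + eLp p G1"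
    and "eLp p G0 < top \<Longrightarrow> eLp p G1 < top \<Longrightarrow> f \<in> W1p p"
proof -
  obtain g where g: "primitive F g" "AE x in lborel. ennreal \<bar>g x\<bar> \<le> G1 x"
    using incr_primitive[OF F G1] by blast
  show N: "W1p_norm p f \<le> eLp p G0 + eLp p G1"
    unfolding W1p_primitiveI(1)[OF p g(1) fm eq] by (intro add_mono eLp_mono_AE p G0 g)
  show "eLp p G0 < top \<Longrightarrow> eLp p G1 < top \<Longrightarrow> f \<in> W1p p"
    by (rule W1p_primitiveI(2)[OF p g(1) fm eq le_less_trans[OF N]]) simp
qed

lemma W1p_cong_AE:
  assumes p: "1 \<le> p" and f: "f \<in> W1p p" and eq: "AE x in lborel. f x = f' x" and fm: "f' \<in> borel_measurable borel"
  shows "f' \<in> W1p p" "W1p_norm p f' = W1p_norm p f"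
proof -
  obtain F g where F: "primitive F g" "AE x in lborel. f x = F x"
    "W1p_norm p f = eLp p (\<lambda>x. ennreal \<bar>F x\<bar>) + eLp p (\<lambda>x. ennreal \<bar>g x\<bar>)" "W1p_norm p f < top"
    using W1p_primitiveE[OF p f] .
  have e: "AE x in lborel. f' x = F x" using F(2) eq by eventually_elim simp
  show "W1p_norm p f' = W1p_norm p f" using W1p_primitiveI(1)[OF p F(1) fm e] F by simp
  then show "f' \<in> W1p p" using W1p_primitiveI(2)[OF p F(1) fm e] F by simp
qed

lemma W1p_measurable: "f \<in> W1p p \<Longrightarrow> f \<in> borel_measurable borel"
  by (simp add: W1p_def)

lemma
  assumes p: "1 \<le> p" and f: "f \<in> W1p p" and h: "h \<in> W1p p"
  shows W1p_add: "(\<lambda>x. f x + h x) \<in> W1p p"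
    and W1p_norm_add: "W1p_norm p (\<lambda>x. f x + h x) \<le> W1p_norm p f + W1p_norm p h"
proof -
  obtain F g where F: "primitive F g" "AE x in lborel. f x = F x"
    "W1p_norm p f = eLp p (\<lambda>x. ennreal \<bar>F x\<bar>) + eLp p (\<lambda>x. ennreal \<bar>g x\<bar>)" "W1p_norm p f < top"
    using W1p_primitiveE[OF p f] .
  obtain H k where H: "primitive H k" "AE x in lborel. h x = H x"
    "W1p_norm p h = eLp p (\<lambda>x. ennreal \<bar>H x\<bar>) + eLp p (\<lambda>x. ennreal \<bar>k x\<bar>)" "W1p_norm p h < top"
    using W1p_primitiveE[OF p h] .
  have [measurable]: "f \<in> borel_measurable borel" "h \<in> borel_measurable borel" using f h W1p_measurable by auto
  have [measurable]: "F \<in> borel_measurable borel" "H \<in> borel_measurable borel"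
    using primitive_continuous F(1) H(1) by (auto intro: borel_measurable_continuous_onI)
  have [measurable]: "g \<in> borel_measurable borel" "k \<in> borel_measurable borel"
    using loc_integrable_measurable F(1) H(1) by (auto simp: primitive_def)
  have P: "primitive (\<lambda>x. F x + H x) (\<lambda>x. g x + k x)"
    using F(1) H(1) by (auto simp: primitive_def loc_integrable_add loc_integrable_integrable_on
        Henstock_Kurzweil_Integration.integral_add algebra_simps)
  have A: "AE x in lborel. f x + h x = F x + H x" using F(2) H(2) by eventually_elim simp
  have M: "(\<lambda>x. f x + h x) \<in> borel_measurable borel" by measurable
  have tri: "eLp p (\<lambda>x. ennreal \<bar>a x + b x\<bar>) \<le> eLp p (\<lambda>x. ennreal \<bar>a x\<bar>) + eLp p (\<lambda>x. ennreal \<bar>b x\<bar>)"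
    if [measurable]: "a \<in> borel_measurable borel" "b \<in> borel_measurable borel" for a b :: "real \<Rightarrow> real"
  proof -
    have "eLp p (\<lambda>x. ennreal \<bar>a x + b x\<bar>) \<le> eLp p (\<lambda>x. ennreal \<bar>a x\<bar> + ennreal \<bar>b x\<bar>)"
      by (intro eLp_mono p) (simp flip: ennreal_plus)
    also have "\<dots> \<le> eLp p (\<lambda>x. ennreal \<bar>a x\<bar>) + eLp p (\<lambda>x. ennreal \<bar>b x\<bar>)"
      by (intro eLp_add p) measurable
    finally show ?thesis .
  qed
  show N: "W1p_norm p (\<lambda>x. f x + h x) \<le> W1p_norm p f + W1p_norm p h"
    unfolding W1p_primitiveI(1)[OF p P M A] F(3) H(3)
    using add_mono[OF tri[of F H] tri[of g k]] by (simp add: ac_simps)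
  show "(\<lambda>x. f x + h x) \<in> W1p p"
    using W1p_primitiveI(2)[OF p P M A] le_less_trans[OF N] F(4) H(4) by simp
qed

lemma
  assumes p: "1 \<le> p" and f: "f \<in> W1p p"
  shows W1p_cmult: "(\<lambda>x. c * f x) \<in> W1p p"
    and W1p_norm_cmult: "W1p_norm p (\<lambda>x. c * f x) \<le> ennreal \<bar>c\<bar> * W1p_norm p f"
proof -
  obtain F g where F: "primitive F g" "AE x in lborel. f x = F x"
    "W1p_norm p f = eLp p (\<lambda>x. ennreal \<bar>F x\<bar>) + eLp p (\<lambda>x. ennreal \<bar>g x\<bar>)" "W1p_norm p f < top"
    using W1p_primitiveE[OF p f] .
  have [measurable]: "f \<in> borel_measurable borel" using f W1p_measurable by auto
  have [measurable]: "F \<in> borel_measurable borel" "g \<in> borel_measurable borel"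
    using primitive_continuous F(1) loc_integrable_measurable
    by (auto intro: borel_measurable_continuous_onI simp: primitive_def)
  have P: "primitive (\<lambda>x. c * F x) (\<lambda>x. c * g x)"
    using F(1) by (auto simp: primitive_def loc_integrable_cmult simp flip: right_diff_distrib)
  have A: "AE x in lborel. c * f x = c * F x" using F(2) by eventually_elim simp
  have M: "(\<lambda>x. c * f x) \<in> borel_measurable borel" by measurable
  have *: "eLp p (\<lambda>x. ennreal \<bar>c * a x\<bar>) \<le> ennreal \<bar>c\<bar> * eLp p (\<lambda>x. ennreal \<bar>a x\<bar>)"
    if [measurable]: "a \<in> borel_measurable borel" for a :: "real \<Rightarrow> real"
    using eLp_cmult[OF p, of "\<lambda>x. ennreal \<bar>a x\<bar>" "ennreal \<bar>c\<bar>"] by (simp add: abs_mult ennreal_mult)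
  show N: "W1p_norm p (\<lambda>x. c * f x) \<le> ennreal \<bar>c\<bar> * W1p_norm p f"
    unfolding W1p_primitiveI(1)[OF p P M A] F(3) distrib_left
    by (intro add_mono *) measurable
  show "(\<lambda>x. c * f x) \<in> W1p p"
    using W1p_primitiveI(2)[OF p P M A] le_less_trans[OF N] F(4) by (simp add: ennreal_mult_less_top)
qed

lemma
  assumes p: "1 \<le> p" and f: "f \<in> W1p p" and h: "h \<in> W1p p"
  shows W1p_diff: "(\<lambda>x. f x - h x) \<in> W1p p"
    and W1p_norm_diff: "W1p_norm p (\<lambda>x. f x - h x) \<le> W1p_norm p f + W1p_norm p h"
proof -
  show "(\<lambda>x. f x - h x) \<in> W1p p" using W1p_add[OF p f W1p_cmult[OF p h, of "-1"]] by simp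
  have "W1p_norm p (\<lambda>x. f x + (-1) * h x) \<le> W1p_norm p f + W1p_norm p (\<lambda>x. (-1) * h x)"
    by (intro W1p_norm_add p f W1p_cmult h)
  also have "\<dots> \<le> W1p_norm p f + W1p_norm p h"
    using W1p_norm_cmult[OF p h, of "-1"] by (intro add_left_mono) simp
  finally show "W1p_norm p (\<lambda>x. f x - h x) \<le> W1p_norm p f + W1p_norm p h" by simp
qed

text \<open>Average \<open>|F x| \<le> |F y| + \<integral>|g|\<close> over \<open>y \<in> [x, x + 1]\<close>.\<close>
lemma primitive_sup_bound:
  assumes p: "1 \<le> p" and F: "primitive F g"
  shows "ennreal \<bar>F x\<bar> \<le> eLp p (\<lambda>x. ennreal \<bar>F x\<bar>) + eLp p (\<lambda>x. ennreal \<bar>g x\<bar>)"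
proof -
  have [measurable]: "F \<in> borel_measurable borel" "g \<in> borel_measurable borel"
    using primitive_continuous F(1) loc_integrable_measurable
    by (auto intro: borel_measurable_continuous_onI simp: primitive_def)
  define I where "I = (\<integral>\<^sup>+y\<in>{x..x+1}. ennreal \<bar>g y\<bar> \<partial>lborel)"
  have le: "ennreal \<bar>F x\<bar> \<le> ennreal \<bar>F y\<bar> + I" if "y \<in> {x..x+1}" for y
  proof -
    have "ennreal \<bar>F x\<bar> \<le> ennreal \<bar>F y\<bar> + ennreal \<bar>F y - F x\<bar>" by (simp flip: ennreal_plus)
    also have "ennreal \<bar>F y - F x\<bar> \<le> (\<integral>\<^sup>+z\<in>{x..y}. ennreal \<bar>g z\<bar> \<partial>lborel)"
      using primitive_incr[OF F] that by (simp add: incr_def)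
    also have "\<dots> \<le> I" unfolding I_def using that by (intro nn_set_integral_set_mono) auto
    finally show ?thesis by (simp add: add_left_mono)
  qed
  have "ennreal \<bar>F x\<bar> = (\<integral>\<^sup>+y\<in>{x..x+1}. ennreal \<bar>F x\<bar> \<partial>lborel)" by (simp add: nn_integral_cmult)
  also have "\<dots> \<le> (\<integral>\<^sup>+y. ennreal \<bar>F y\<bar> * indicator {x..x+1} y + I * indicator {x..x+1} y \<partial>lborel)"
    using le by (intro nn_integral_mono) (auto simp: indicator_def)
  also have "\<dots> = (\<integral>\<^sup>+y\<in>{x..x+1}. ennreal \<bar>F y\<bar> \<partial>lborel) + I"
    by (subst nn_integral_add) (auto simp: nn_integral_cmult)
  also have "\<dots> \<le> eLp p (\<lambda>x. ennreal \<bar>F x\<bar>) + eLp p (\<lambda>x. ennreal \<bar>g x\<bar>)"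
    unfolding I_def by (intro add_mono eLp_unit_interval p) auto
  finally show ?thesis .
qed

section \<open>The nonlocal force\<close>

text \<open>The substitution \<open>y = x + z\<close> takes \<open>x\<close> out of the kernel, so
  the weight \<open>\<alpha> z\<close> stays fixed when \<open>x\<close> varies and dominates in
  every limit.\<close>

definition force :: "(real \<Rightarrow> real) \<Rightarrow> (real \<Rightarrow> real) \<Rightarrow> (real \<Rightarrow> real) \<Rightarrow> real \<Rightarrow> real" where
  "force \<alpha> w f x = (\<integral>z. \<alpha> z * w (f (x + z) - f x) \<partial>lborel)"

lemma force_eq: "(\<integral>y. \<alpha> (y - x) * w (u y - u x) \<partial>lborel) = force \<alpha> w u x"
  unfolding force_def by (subst lborel_integral_real_affine[of 1 _ x]) auto

locale nonlinearity =
  fixes \<alpha> w w1 w2 :: "real \<Rightarrow> real"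
  assumes \<alpha>: "integrable lborel \<alpha>"
    and w: "\<And>x. (w has_real_derivative w1 x) (at x)"
    and w1: "\<And>x. (w1 has_real_derivative w2 x) (at x)"
    and w2: "continuous_on UNIV w2"
    and w0: "w 0 = 0"
begin

lemma w_cont: "continuous_on UNIV w" and w1_cont: "continuous_on UNIV w1"
  using w w1 by (auto intro!: continuous_at_imp_continuous_on DERIV_isCont)

lemma \<alpha>_measurable [measurable]: "\<alpha> \<in> borel_measurable borel" using \<alpha> by auto
lemma w_measurable [measurable]: "w \<in> borel_measurable borel" using w_cont by (rule borel_measurable_continuous_onI)

text \<open>The interval has radius \<open>2 * R\<close> because \<open>w\<close> is evaluated at
  differences of two values of modulus at most \<open>R\<close>.\<close>

definition deriv_bound :: "real \<Rightarrow> real \<Rightarrow> bool" where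
  "deriv_bound R M \<longleftrightarrow> 0 \<le> R \<and> 0 \<le> M \<and> (\<forall>x. \<bar>x\<bar> \<le> 2 * R \<longrightarrow> \<bar>w1 x\<bar> \<le> M \<and> \<bar>w2 x\<bar> \<le> M)"

lemma deriv_bound_exists: assumes "0 \<le> R" shows "\<exists>M. deriv_bound R M"
proof -
  have "\<exists>C. \<forall>x\<in>{-2*R..2*R}. \<bar>f x\<bar> \<le> C" if "continuous_on UNIV f" for f :: "real \<Rightarrow> real"
  proof -
    have "compact (f ` {-2*R..2*R})"
      using that by (intro compact_continuous_image) (auto intro: continuous_on_subset)
    then show ?thesis using compact_imp_bounded[of "f ` {-2*R..2*R}"] by (auto simp: bounded_iff)
  qed
  from this[OF w1_cont] this[OF w2] obtain C D where
    "\<forall>x\<in>{-2*R..2*R}. \<bar>w1 x\<bar> \<le> C" "\<forall>x\<in>{-2*R..2*R}. \<bar>w2 x\<bar> \<le> D" by auto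
  then have "deriv_bound R (max 0 (max C D))"
    unfolding deriv_bound_def
  proof (intro conjI allI impI)
    fix x assume "\<bar>x\<bar> \<le> 2 * R"
    then have "x \<in> {-2*R..2*R}" by auto
    with \<open>\<forall>x\<in>{-2*R..2*R}. \<bar>w1 x\<bar> \<le> C\<close> \<open>\<forall>x\<in>{-2*R..2*R}. \<bar>w2 x\<bar> \<le> D\<close>
    show "\<bar>w1 x\<bar> \<le> max 0 (max C D)" "\<bar>w2 x\<bar> \<le> max 0 (max C D)" by (auto simp: le_max_iff_disj)
  qed (use assms in auto)
  then show ?thesis ..
qed

lemma Lipschitz_of_deriv_bound:
  fixes f :: "real \<Rightarrow> real"
  assumes D: "\<And>x. (f has_real_derivative f' x) (at x)" and b: "\<And>x. \<bar>x\<bar> \<le> r \<Longrightarrow> \<bar>f' x\<bar> \<le> M"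
    and "\<bar>x\<bar> \<le> r" "\<bar>y\<bar> \<le> r"
  shows "\<bar>f x - f y\<bar> \<le> M * \<bar>x - y\<bar>"
proof -
  have "norm (f x - f y) \<le> M * norm (x - y)"
  proof (rule field_differentiable_bound)
    show "convex {-r..r}" by (rule convex_real_interval)
    show "(f has_field_derivative f' z) (at z within {-r..r})" for z
      using D by (rule has_field_derivative_at_within)
  qed (use assms in \<open>auto simp: abs_le_iff\<close>)
  then show ?thesis by simp
qed

lemma w_Lipschitz:
  assumes "deriv_bound R M" "\<bar>x\<bar> \<le> 2 * R" "\<bar>y\<bar> \<le> 2 * R"
  shows "\<bar>w x - w y\<bar> \<le> M * \<bar>x - y\<bar>" "\<bar>w1 x - w1 y\<bar> \<le> M * \<bar>x - y\<bar>"
  using assms by (auto intro!: Lipschitz_of_deriv_bound[OF w] Lipschitz_of_deriv_bound[OF w1] simp: deriv_bound_def)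

text \<open>Apply the mean value theorem to \<open>\<theta> \<mapsto> w (q1 + \<theta> (p1 - q1)) - w (q0 + \<theta> (p0 - q0))\<close>.\<close>
lemma w_four_point:
  assumes M: "deriv_bound R M"
    and b: "\<bar>p0\<bar> \<le> 2 * R" "\<bar>p1\<bar> \<le> 2 * R" "\<bar>q0\<bar> \<le> 2 * R" "\<bar>q1\<bar> \<le> 2 * R"
  shows "\<bar>(w p1 - w q1) - (w p0 - w q0)\<bar>
    \<le> M * \<bar>(p1 - q1) - (p0 - q0)\<bar> + M * (\<bar>p1 - p0\<bar> + \<bar>q1 - q0\<bar>) * \<bar>p0 - q0\<bar>"
proof -
  let ?c1 = "\<lambda>t. q1 + t * (p1 - q1)" and ?c0 = "\<lambda>t. q0 + t * (p0 - q0)"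
  have D: "((\<lambda>t. w (?c1 t) - w (?c0 t)) has_real_derivative
      w1 (?c1 t) * (p1 - q1) - w1 (?c0 t) * (p0 - q0)) (at t)" for t
  proof -
    have "(?c1 has_real_derivative (p1 - q1)) (at t)" "(?c0 has_real_derivative (p0 - q0)) (at t)"
      by (auto intro!: derivative_eq_intros)
    from DERIV_diff[OF DERIV_chain2[OF w this(1)] DERIV_chain2[OF w this(2)]] show ?thesis .
  qed
  obtain t where t: "0 < t" "t < 1"
    and e: "(w (?c1 1) - w (?c0 1)) - (w (?c1 0) - w (?c0 0)) = (1 - 0) * (w1 (?c1 t) * (p1 - q1) - w1 (?c0 t) * (p0 - q0))"
    using MVT2[of 0 1 "\<lambda>t. w (?c1 t) - w (?c0 t)" "\<lambda>t. w1 (?c1 t) * (p1 - q1) - w1 (?c0 t) * (p0 - q0)"] D by auto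
  have in2: "\<bar>q + t * (p - q)\<bar> \<le> 2 * R" if "\<bar>p\<bar> \<le> 2 * R" "\<bar>q\<bar> \<le> 2 * R" for p q
  proof -
    have "q + t * (p - q) = (1 - t) * q + t * p" by (simp add: algebra_simps)
    also have "\<bar>\<dots>\<bar> \<le> (1 - t) * \<bar>q\<bar> + t * \<bar>p\<bar>"
      using t by (intro order_trans[OF abs_triangle_ineq]) (simp add: abs_mult)
    also have "\<dots> \<le> (1 - t) * (2 * R) + t * (2 * R)"
      using t that by (intro add_mono mult_left_mono) auto
    finally show ?thesis by (simp add: algebra_simps)
  qed
  have M0: "M \<ge> 0" using M by (simp add: deriv_bound_def)
  have "\<bar>(w p1 - w q1) - (w p0 - w q0)\<bar>
    = \<bar>w1 (?c1 t) * ((p1 - q1) - (p0 - q0)) + (w1 (?c1 t) - w1 (?c0 t)) * (p0 - q0)\<bar>"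
    using e by (simp add: algebra_simps)
  also have "\<dots> \<le> \<bar>w1 (?c1 t)\<bar> * \<bar>(p1 - q1) - (p0 - q0)\<bar> + \<bar>w1 (?c1 t) - w1 (?c0 t)\<bar> * \<bar>p0 - q0\<bar>"
    by (intro order_trans[OF abs_triangle_ineq]) (simp add: abs_mult)
  also have "\<dots> \<le> M * \<bar>(p1 - q1) - (p0 - q0)\<bar> + M * (\<bar>p1 - p0\<bar> + \<bar>q1 - q0\<bar>) * \<bar>p0 - q0\<bar>"
  proof (intro add_mono mult_right_mono)
    show "\<bar>w1 (?c1 t)\<bar> \<le> M" using M in2[OF b(2) b(4)] by (simp add: deriv_bound_def)
    have "\<bar>w1 (?c1 t) - w1 (?c0 t)\<bar> \<le> M * \<bar>?c1 t - ?c0 t\<bar>"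
      by (rule w_Lipschitz(2)[OF M in2[OF b(2) b(4)] in2[OF b(1) b(3)]])
    also have "?c1 t - ?c0 t = (1 - t) * (q1 - q0) + t * (p1 - p0)" by (simp add: algebra_simps)
    also have "\<bar>\<dots>\<bar> \<le> (1 - t) * \<bar>q1 - q0\<bar> + t * \<bar>p1 - p0\<bar>"
      using t by (intro order_trans[OF abs_triangle_ineq]) (simp add: abs_mult)
    also have "\<dots> \<le> 1 * \<bar>q1 - q0\<bar> + 1 * \<bar>p1 - p0\<bar>"
      using t by (intro add_mono mult_right_mono) auto
    finally show "\<bar>w1 (?c1 t) - w1 (?c0 t)\<bar> \<le> M * (\<bar>p1 - p0\<bar> + \<bar>q1 - q0\<bar>)"
      using M0 by (simp add: mult_left_mono add.commute)
  qed auto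
  finally show ?thesis .
qed

lemma diff_in: "(\<And>x. \<bar>f x\<bar> \<le> R) \<Longrightarrow> \<bar>f x - f y\<bar> \<le> 2 * R" for f :: "'a \<Rightarrow> real"
  by (rule order_trans[OF abs_triangle_ineq4]) (metis add_mono mult_2)

lemma w_diff_bound:
  assumes M: "deriv_bound R M" and f: "\<And>x. \<bar>f x\<bar> \<le> R"
  shows "\<bar>w (f x - f y)\<bar> \<le> M * (2 * R)"
proof -
  have "R \<ge> 0" "M \<ge> 0" using M by (auto simp: deriv_bound_def)
  then have "\<bar>w (f x - f y) - w 0\<bar> \<le> M * \<bar>(f x - f y) - 0\<bar>"
    by (intro w_Lipschitz[OF M] diff_in f) simp
  also have "\<dots> \<le> M * (2 * R)"
    using diff_in[of f R x y, OF f] \<open>M \<ge> 0\<close> by (intro mult_left_mono) auto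
  finally show ?thesis by (simp add: w0)
qed

lemma force_integrable:
  assumes M: "deriv_bound R M" and fm [measurable]: "f \<in> borel_measurable borel" and f: "\<And>x. \<bar>f x\<bar> \<le> R"
  shows "integrable lborel (\<lambda>z. \<alpha> z * w (f (x + z) - f x))"
proof (rule Bochner_Integration.integrable_bound)
  show "integrable lborel (\<lambda>z. \<alpha> z * (M * (2 * R)))" using \<alpha> by simp
  show "AE z in lborel. norm (\<alpha> z * w (f (x + z) - f x)) \<le> norm (\<alpha> z * (M * (2 * R)))"
    using w_diff_bound[OF M, of f] f M
    by (intro AE_I2) (auto simp: abs_mult deriv_bound_def intro!: mult_left_mono)
qed measurable

text \<open>The uniform bound on \<open>U\<close> makes a multiple of \<open>\<alpha>\<close> a
  majorant independent of \<open>(t, x)\<close>, so sequential continuity is dominated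
  convergence.\<close>

lemma force_continuous:
  assumes M: "deriv_bound R M" and U: "continuous_on UNIV (\<lambda>(t::real, x::real). U t x)" and b: "\<And>t x. \<bar>U t x\<bar> \<le> R"
  shows "continuous_on UNIV (\<lambda>(t, x). force \<alpha> w (U t) x)"
proof -
  have cU: "((\<lambda>n. U (fst (s n)) (snd (s n))) \<longlonglongrightarrow> U t x)" if "s \<longlonglongrightarrow> (t, x)" for s t x
    using continuous_on_tendsto_compose[OF U that] by (simp add: case_prod_beta)
  have [measurable]: "U t \<in> borel_measurable borel" for t
  proof -
    have "continuous_on UNIV (\<lambda>x. (\<lambda>(t, x). U t x) (t, x))"
      by (rule continuous_on_compose2[OF U]) (auto intro!: continuous_intros)
    then show ?thesis by (simp add: borel_measurable_continuous_onI)
  qed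
  have "(\<lambda>n. (\<lambda>(t, x). force \<alpha> w (U t) x) (s n)) \<longlonglongrightarrow> (\<lambda>(t, x). force \<alpha> w (U t) x) (t, x)" if s: "s \<longlonglongrightarrow> (t, x)" for s t x
    unfolding case_prod_beta fst_conv snd_conv force_def
  proof (rule integral_dominated_convergence)
    show "integrable lborel (\<lambda>z. norm (\<alpha> z * (M * (2 * R))))" using \<alpha> by (intro integrable_norm) simp
    show "AE z in lborel. norm (\<alpha> z * w (U (fst (s n)) (snd (s n) + z) - U (fst (s n)) (snd (s n)))) \<le> norm (\<alpha> z * (M * (2 * R)))" for n
      using w_diff_bound[OF M, of "U (fst (s n))"] b M
      by (intro AE_I2) (auto simp: abs_mult deriv_bound_def intro!: mult_left_mono)
    have "(\<lambda>n. w (U (fst (s n)) (snd (s n) + z) - U (fst (s n)) (snd (s n)))) \<longlonglongrightarrow> w (U t (x + z) - U t x)" for z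
    proof (rule continuous_on_tendsto_compose[OF w_cont])
      have "(\<lambda>n. (fst (s n), snd (s n) + z)) \<longlonglongrightarrow> (t, x + z)"
        using tendsto_fst[OF s] tendsto_snd[OF s] by (auto intro!: tendsto_intros)
      from cU[OF this] cU[OF s]
      show "(\<lambda>n. U (fst (s n)) (snd (s n) + z) - U (fst (s n)) (snd (s n))) \<longlonglongrightarrow> U t (x + z) - U t x"
        by (auto intro: tendsto_diff)
    qed auto
    then show "AE z in lborel. (\<lambda>n. \<alpha> z * w (U (fst (s n)) (snd (s n) + z) - U (fst (s n)) (snd (s n)))) \<longlonglongrightarrow> \<alpha> z * w (U t (x + z) - U t x)"
      by (auto intro!: tendsto_mult)
  qed measurable
  then show ?thesis
    by (auto simp: continuous_on_sequentially comp_def)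
qed

section \<open>Estimates for differences of forces, pointwise and in increments\<close>

lemma integral_ennreal_bound:
  assumes "\<And>z. ennreal \<bar>f z\<bar> \<le> ennreal \<bar>\<alpha> z\<bar> * h z" "integrable lborel f"
  shows "ennreal \<bar>\<integral>z. f z \<partial>lborel\<bar> \<le> (\<integral>\<^sup>+z. ennreal \<bar>\<alpha> z\<bar> * h z \<partial>lborel)"
proof -
  have "ennreal (norm (\<integral>z. f z \<partial>lborel)) \<le> (\<integral>\<^sup>+z. ennreal (norm (f z)) \<partial>lborel)"
    by (rule integral_norm_bound_ennreal[OF assms(2)])
  also have "\<dots> \<le> (\<integral>\<^sup>+z. ennreal \<bar>\<alpha> z\<bar> * h z \<partial>lborel)"
    by (rule nn_integral_mono) (simp add: assms(1))
  finally show ?thesis by simp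
qed

lemma force_diff_bound:
  assumes M: "deriv_bound R M"
    and [measurable]: "f \<in> borel_measurable borel" "g \<in> borel_measurable borel"
    and f: "\<And>x. \<bar>f x\<bar> \<le> R" and g: "\<And>x. \<bar>g x\<bar> \<le> R"
  shows "ennreal \<bar>force \<alpha> w f x - force \<alpha> w g x\<bar> \<le> ennreal M * abs_conv \<alpha> (\<lambda>x. ennreal \<bar>f x - g x\<bar>) x"
proof -
  have M0: "M \<ge> 0" using M by (simp add: deriv_bound_def)
  have i: "integrable lborel (\<lambda>z. \<alpha> z * w (f (x + z) - f x) - \<alpha> z * w (g (x + z) - g x))"
    by (intro Bochner_Integration.integrable_diff force_integrable[where f=f, OF M _ f] force_integrable[where f=g, OF M _ g]) measurable
  have "ennreal \<bar>force \<alpha> w f x - force \<alpha> w g x\<bar> = ennreal \<bar>\<integral>z. \<alpha> z * w (f (x + z) - f x) - \<alpha> z * w (g (x + z) - g x) \<partial>lborel\<bar>"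
    using force_integrable[where f=f, OF M _ f, of x] force_integrable[where f=g, OF M _ g, of x] by (simp add: force_def)
  also have "\<dots> \<le> (\<integral>\<^sup>+z. ennreal \<bar>\<alpha> z\<bar> * (ennreal M * (ennreal \<bar>f (x + z) - g (x + z)\<bar> + ennreal \<bar>f x - g x\<bar>)) \<partial>lborel)"
  proof (rule integral_ennreal_bound[OF _ i])
    fix z
    have "\<bar>w (f (x + z) - f x) - w (g (x + z) - g x)\<bar> \<le> M * \<bar>(f (x + z) - f x) - (g (x + z) - g x)\<bar>"
      by (intro w_Lipschitz[OF M] diff_in f g)
    also have "\<dots> \<le> M * (\<bar>f (x + z) - g (x + z)\<bar> + \<bar>f x - g x\<bar>)"
      using M0 by (intro mult_left_mono) auto
    finally have "\<bar>\<alpha> z\<bar> * \<bar>w (f (x + z) - f x) - w (g (x + z) - g x)\<bar> \<le> \<bar>\<alpha> z\<bar> * (M * (\<bar>f (x + z) - g (x + z)\<bar> + \<bar>f x - g x\<bar>))"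
      by (rule mult_left_mono) simp
    then show "ennreal \<bar>\<alpha> z * w (f (x + z) - f x) - \<alpha> z * w (g (x + z) - g x)\<bar>
      \<le> ennreal \<bar>\<alpha> z\<bar> * (ennreal M * (ennreal \<bar>f (x + z) - g (x + z)\<bar> + ennreal \<bar>f x - g x\<bar>))"
      using M0 by (simp add: abs_mult flip: ennreal_mult ennreal_plus right_diff_distrib)
  qed
  also have "\<dots> = ennreal M * abs_conv \<alpha> (\<lambda>x. ennreal \<bar>f x - g x\<bar>) x"
    by (simp add: abs_conv_def nn_integral_cmult[symmetric] mult.left_commute)
  finally show ?thesis .
qed

text \<open>An increment over a shifted interval is bounded by the integral of the shifted majorant.
  The sum that appears is the one in \<open>abs_conv\<close>.\<close>

lemma incr_translate:
  assumes f: "incr f G" and [measurable]: "G \<in> borel_measurable borel" and ab: "a \<le> b"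
  shows "ennreal \<bar>(f (b + z) - f b) - (f (a + z) - f a)\<bar> \<le> (\<integral>\<^sup>+x\<in>{a..b}. (G (x + z) + G x) \<partial>lborel)"
proof -
  have "(\<integral>\<^sup>+x\<in>{a + z..b + z}. G x \<partial>lborel) = (\<integral>\<^sup>+x\<in>{a..b}. G (x + z) \<partial>lborel)"
    by (subst nn_integral_real_affine[of _ 1 z])
       (auto simp: indicator_def add.commute intro!: nn_integral_cong)
  then have 1: "ennreal \<bar>f (b + z) - f (a + z)\<bar> \<le> (\<integral>\<^sup>+x\<in>{a..b}. G (x + z) \<partial>lborel)"
    using f ab by (simp add: incr_def) (metis add_le_cancel_right)
  have 2: "ennreal \<bar>f b - f a\<bar> \<le> (\<integral>\<^sup>+x\<in>{a..b}. G x \<partial>lborel)"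
    using f ab by (simp add: incr_def)
  have "ennreal \<bar>(f (b + z) - f b) - (f (a + z) - f a)\<bar> \<le> ennreal \<bar>f (b + z) - f (a + z)\<bar> + ennreal \<bar>f b - f a\<bar>"
    by (simp flip: ennreal_plus)
  also note add_mono[OF 1 2]
  also have "(\<integral>\<^sup>+x\<in>{a..b}. G (x + z) \<partial>lborel) + (\<integral>\<^sup>+x\<in>{a..b}. G x \<partial>lborel) = (\<integral>\<^sup>+x\<in>{a..b}. (G (x + z) + G x) \<partial>lborel)"
    by (subst nn_integral_add[symmetric]) (auto simp: distrib_right)
  finally show ?thesis .
qed

text \<open>Tonelli brings the integral over \<open>[a, b]\<close> outside, so that the estimate for
  the force has again the form of \<open>incr\<close>.\<close>

lemma abs_conv_Fubini:
  assumes [measurable]: "G \<in> borel_measurable borel"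
  shows "(\<integral>\<^sup>+z. ennreal \<bar>\<alpha> z\<bar> * (\<integral>\<^sup>+x\<in>{a..b}. (G (x + z) + G x) \<partial>lborel) \<partial>lborel) = (\<integral>\<^sup>+x\<in>{a..b}. abs_conv \<alpha> G x \<partial>lborel)"
proof -
  have "(\<integral>\<^sup>+z. ennreal \<bar>\<alpha> z\<bar> * (\<integral>\<^sup>+x\<in>{a..b}. (G (x + z) + G x) \<partial>lborel) \<partial>lborel)
    = (\<integral>\<^sup>+z. (\<integral>\<^sup>+x. ennreal \<bar>\<alpha> z\<bar> * ((G (x + z) + G x) * indicator {a..b} x) \<partial>lborel) \<partial>lborel)"
    by (intro nn_integral_cong nn_integral_cmult[symmetric]) measurable
  also have "\<dots> = (\<integral>\<^sup>+x. (\<integral>\<^sup>+z. ennreal \<bar>\<alpha> z\<bar> * ((G (x + z) + G x) * indicator {a..b} x) \<partial>lborel) \<partial>lborel)"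
    by (rule lborel_pair.Fubini') measurable
  also have "\<dots> = (\<integral>\<^sup>+x\<in>{a..b}. abs_conv \<alpha> G x \<partial>lborel)"
    unfolding abs_conv_def
    by (intro nn_integral_cong) (auto simp: indicator_def)
  finally show ?thesis .
qed

text \<open>Apply \<open>w_four_point\<close> to the differences at \<open>a\<close> and at
  \<open>b\<close>. The change of \<open>f - g\<close> is paid by \<open>E\<close>; the changes of
  \<open>f\<close> and of \<open>g\<close> are each paid by \<open>G\<close> and multiplied by a
  difference of at most \<open>2 * \<epsilon>\<close>, which accounts for the constant 4.\<close>

lemma force_diff_incr:
  assumes M: "deriv_bound R M"
    and [measurable]: "f \<in> borel_measurable borel" "g \<in> borel_measurable borel" "G \<in> borel_measurable borel" "E \<in> borel_measurable borel"
    and f: "\<And>x. \<bar>f x\<bar> \<le> R" and g: "\<And>x. \<bar>g x\<bar> \<le> R"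
    and fG: "incr f G" and gG: "incr g G" and E: "incr (\<lambda>x. f x - g x) E"
    and \<epsilon>: "\<And>x. \<bar>f x - g x\<bar> \<le> \<epsilon>"
  shows "incr (\<lambda>x. force \<alpha> w f x - force \<alpha> w g x) (\<lambda>x. ennreal M * abs_conv \<alpha> E x + ennreal (4 * M * \<epsilon>) * abs_conv \<alpha> G x)"
  unfolding incr_def
proof (intro allI impI)
  fix a b :: real assume ab: "a \<le> b"
  have M0: "M \<ge> 0" using M by (simp add: deriv_bound_def)
  have \<epsilon>0: "\<epsilon> \<ge> 0" using \<epsilon>[of 0] by simp
  let ?F = "\<lambda>x z. \<alpha> z * w (f (x + z) - f x)" and ?G = "\<lambda>x z. \<alpha> z * w (g (x + z) - g x)"
  define X where "X z = (\<integral>\<^sup>+x\<in>{a..b}. (G (x + z) + G x) \<partial>lborel)" for z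
  define Y where "Y z = (\<integral>\<^sup>+x\<in>{a..b}. (E (x + z) + E x) \<partial>lborel)" for z
  have [measurable]: "X \<in> borel_measurable borel" "Y \<in> borel_measurable borel"
    unfolding X_def Y_def by measurable
  have iF: "integrable lborel (?F x)" and iG: "integrable lborel (?G x)" for x
    by (intro force_integrable[where f=f, OF M _ f] force_integrable[where f=g, OF M _ g]; measurable)+
  have i: "integrable lborel (\<lambda>z. (?F b z - ?G b z) - (?F a z - ?G a z))"
    by (intro Bochner_Integration.integrable_diff iF iG)
  have "ennreal \<bar>(force \<alpha> w f b - force \<alpha> w g b) - (force \<alpha> w f a - force \<alpha> w g a)\<bar>
    = ennreal \<bar>\<integral>z. (?F b z - ?G b z) - (?F a z - ?G a z) \<partial>lborel\<bar>"
    using iF iG by (simp add: force_def)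
  also have "\<dots> \<le> (\<integral>\<^sup>+z. ennreal \<bar>\<alpha> z\<bar> * (ennreal M * Y z + ennreal (4 * M * \<epsilon>) * X z) \<partial>lborel)"
  proof (rule integral_ennreal_bound[OF _ i])
    fix z
    define p0 p1 q0 q1 where "p0 = f (a + z) - f a" and "p1 = f (b + z) - f b"
      and "q0 = g (a + z) - g a" and "q1 = g (b + z) - g b"
    have X: "ennreal \<bar>p1 - p0\<bar> \<le> X z" "ennreal \<bar>q1 - q0\<bar> \<le> X z"
      unfolding X_def p0_def p1_def q0_def q1_def by (intro incr_translate fG gG ab; measurable)+
    have Y: "ennreal \<bar>(p1 - q1) - (p0 - q0)\<bar> \<le> Y z"
      using incr_translate[OF E _ ab, of z] by (simp add: Y_def p0_def p1_def q0_def q1_def algebra_simps)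
    have d0: "\<bar>p0 - q0\<bar> \<le> 2 * \<epsilon>" using \<epsilon>[of "a + z"] \<epsilon>[of a] by (simp add: p0_def q0_def)
    have "\<bar>(w p1 - w q1) - (w p0 - w q0)\<bar> \<le> M * \<bar>(p1 - q1) - (p0 - q0)\<bar> + M * (\<bar>p1 - p0\<bar> + \<bar>q1 - q0\<bar>) * \<bar>p0 - q0\<bar>"
      unfolding p0_def p1_def q0_def q1_def by (intro w_four_point[OF M] diff_in f g)
    also have "\<dots> \<le> M * \<bar>(p1 - q1) - (p0 - q0)\<bar> + M * (\<bar>p1 - p0\<bar> + \<bar>q1 - q0\<bar>) * (2 * \<epsilon>)"
      using M0 d0 by (intro add_left_mono mult_left_mono) auto
    finally have "ennreal \<bar>(w p1 - w q1) - (w p0 - w q0)\<bar> \<le> ennreal (M * \<bar>(p1 - q1) - (p0 - q0)\<bar> + M * (\<bar>p1 - p0\<bar> + \<bar>q1 - q0\<bar>) * (2 * \<epsilon>))"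
      by (rule ennreal_leI)
    also have "\<dots> = ennreal M * ennreal \<bar>(p1 - q1) - (p0 - q0)\<bar> + ennreal (2 * M * \<epsilon>) * (ennreal \<bar>p1 - p0\<bar> + ennreal \<bar>q1 - q0\<bar>)"
      using M0 \<epsilon>0 by (simp add: mult_ac flip: ennreal_mult ennreal_plus)
    also have "\<dots> \<le> ennreal M * Y z + ennreal (2 * M * \<epsilon>) * (X z + X z)"
      by (intro add_mono mult_left_mono X Y) auto
    also have "ennreal (2 * M * \<epsilon>) * (X z + X z) = ennreal (4 * M * \<epsilon>) * X z"
    proof -
      have "ennreal (4 * M * \<epsilon>) = ennreal (2 * M * \<epsilon>) + ennreal (2 * M * \<epsilon>)"
        using M0 \<epsilon>0 by (simp flip: ennreal_plus)
      then show ?thesis by (simp add: distrib_left distrib_right)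
    qed
    finally have "ennreal \<bar>\<alpha> z\<bar> * ennreal \<bar>(w p1 - w q1) - (w p0 - w q0)\<bar> \<le> ennreal \<bar>\<alpha> z\<bar> * (ennreal M * Y z + ennreal (4 * M * \<epsilon>) * X z)"
      by (rule mult_left_mono) simp
    then show "ennreal \<bar>(?F b z - ?G b z) - (?F a z - ?G a z)\<bar> \<le> ennreal \<bar>\<alpha> z\<bar> * (ennreal M * Y z + ennreal (4 * M * \<epsilon>) * X z)"
      unfolding p0_def p1_def q0_def q1_def
      by (simp add: abs_mult flip: ennreal_mult right_diff_distrib)
  qed
  also have "\<dots> = (\<integral>\<^sup>+z. ennreal M * (ennreal \<bar>\<alpha> z\<bar> * Y z) + ennreal (4 * M * \<epsilon>) * (ennreal \<bar>\<alpha> z\<bar> * X z) \<partial>lborel)"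
    by (intro nn_integral_cong) (simp add: distrib_left mult_ac)
  also have "\<dots> = ennreal M * (\<integral>\<^sup>+z. ennreal \<bar>\<alpha> z\<bar> * Y z \<partial>lborel) + ennreal (4 * M * \<epsilon>) * (\<integral>\<^sup>+z. ennreal \<bar>\<alpha> z\<bar> * X z \<partial>lborel)"
    by (simp add: nn_integral_add nn_integral_cmult)
  also have "\<dots> = ennreal M * (\<integral>\<^sup>+x\<in>{a..b}. abs_conv \<alpha> E x \<partial>lborel) + ennreal (4 * M * \<epsilon>) * (\<integral>\<^sup>+x\<in>{a..b}. abs_conv \<alpha> G x \<partial>lborel)"
    unfolding X_def Y_def by (simp add: abs_conv_Fubini)
  also have "\<dots> = (\<integral>\<^sup>+x. ennreal M * (abs_conv \<alpha> E x * indicator {a..b} x) + ennreal (4 * M * \<epsilon>) * (abs_conv \<alpha> G x * indicator {a..b} x) \<partial>lborel)"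
    by (simp add: nn_integral_add nn_integral_cmult)
  also have "\<dots> = (\<integral>\<^sup>+x\<in>{a..b}. (ennreal M * abs_conv \<alpha> E x + ennreal (4 * M * \<epsilon>) * abs_conv \<alpha> G x) \<partial>lborel)"
    by (intro nn_integral_cong) (simp add: distrib_right mult.assoc)
  finally show "ennreal \<bar>(force \<alpha> w f b - force \<alpha> w g b) - (force \<alpha> w f a - force \<alpha> w g a)\<bar>
    \<le> (\<integral>\<^sup>+x\<in>{a..b}. (ennreal M * abs_conv \<alpha> E x + ennreal (4 * M * \<epsilon>) * abs_conv \<alpha> G x) \<partial>lborel)" .
qed

end

section \<open>Weighted bounds and time integrals\<close>

lemma abs_conv_cmult:
  assumes [measurable]: "\<alpha> \<in> borel_measurable borel" "h \<in> borel_measurable borel"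
  shows "abs_conv \<alpha> (\<lambda>x. c * h x) x = c * abs_conv \<alpha> h x"
  unfolding abs_conv_def by (subst nn_integral_cmult[symmetric]) (auto simp: distrib_left mult_ac)

lemma abs_conv_mono: "(\<And>x. h x \<le> h' x) \<Longrightarrow> abs_conv \<alpha> h x \<le> abs_conv \<alpha> h' x"
  unfolding abs_conv_def by (intro nn_integral_mono mult_left_mono add_mono) auto

lemma abs_conv_suminf:
  assumes [measurable]: "\<alpha> \<in> borel_measurable borel" "\<And>n. h n \<in> borel_measurable borel"
  shows "abs_conv \<alpha> (\<lambda>x. \<Sum>n. h n x) x = (\<Sum>n. abs_conv \<alpha> (h n) x)"
  unfolding abs_conv_def
  by (subst nn_integral_suminf[symmetric])
     (auto simp: suminf_add summableI ennreal_suminf_cmult intro!: nn_integral_cong)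

text \<open>Half of it, twice the norm of \<open>\<alpha>\<close> in L^1 plus 1, bounds the operator
  \<open>abs_conv \<alpha>\<close> on every L^p and is positive even for
  \<open>\<alpha> = 0\<close>. Doubling it leaves ratio 1/2 in the Neumann series.\<close>

definition abs_conv_bound :: "(real \<Rightarrow> real) \<Rightarrow> real" where
  "abs_conv_bound \<alpha> = 4 * (\<integral>x. \<bar>\<alpha> x\<bar> \<partial>lborel) + 2"

lemma abs_conv_bound_pos: "abs_conv_bound \<alpha> > 0"
  by (simp add: abs_conv_bound_def add_nonneg_pos)

lemma abs_conv_eLp_abs_conv_bound:
  assumes p: "1 \<le> p" and \<alpha>: "integrable lborel \<alpha>" and [measurable]: "h \<in> borel_measurable borel"
  shows "eLp p (abs_conv \<alpha> h) \<le> ennreal (abs_conv_bound \<alpha> / 2) * eLp p h"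
  by (rule order_trans[OF abs_conv_eLp[OF assms]]) (auto intro!: mult_right_mono ennreal_leI simp: abs_conv_bound_def)

text \<open>With \<open>B = abs_conv_bound \<alpha> / 2\<close> a bound for the norm of the positive operator \<open>A = abs_conv \<alpha>\<close>, the function
  \<open>H = (\<Sum>n. (A / (2 B)) ^ n H0)\<close> satisfies \<open>A H \<le> 2 B H\<close>.\<close>
lemma majorant_exists:
  assumes p: "1 \<le> p" and \<alpha>: "integrable lborel \<alpha>" and [measurable]: "H0 \<in> borel_measurable borel"
  obtains H where "H \<in> borel_measurable borel" "\<And>x. H0 x \<le> H x" "eLp p H \<le> 2 * eLp p H0"
    "\<And>x. abs_conv \<alpha> H x \<le> ennreal (abs_conv_bound \<alpha>) * H x"
proof -
  have [measurable]: "\<alpha> \<in> borel_measurable borel" using \<alpha> by auto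
  define B where "B = abs_conv_bound \<alpha> / 2"
  have B: "B > 0" using abs_conv_bound_pos by (simp add: B_def)
  \<comment> \<open>Dividing by \<open>B\<close> keeps the norms from growing; the geometric weights
    are added separately, in the form required by \<open>eLp_suminf\<close>.\<close>
  define h where "h n = ((\<lambda>g x. ennreal (1 / B) * abs_conv \<alpha> g x) ^^ n) H0" for n
  have h0: "h 0 = H0" and hS: "h (Suc n) = (\<lambda>x. ennreal (1 / B) * abs_conv \<alpha> (h n) x)" for n
    by (simp_all add: h_def)
  have [measurable]: "h n \<in> borel_measurable borel" for n
    by (induction n) (auto simp: h0 hS)
  have le: "eLp p (h n) \<le> eLp p H0" for n
  proof (induction n)
    case (Suc n)
    have "eLp p (h (Suc n)) \<le> ennreal (1 / B) * eLp p (abs_conv \<alpha> (h n))"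
      unfolding hS by (intro eLp_cmult p) measurable
    also have "\<dots> \<le> ennreal (1 / B) * (ennreal B * eLp p (h n))"
      unfolding B_def by (intro mult_left_mono abs_conv_eLp_abs_conv_bound p \<alpha>) auto
    also have "\<dots> = eLp p (h n)" using B by (simp add: mult.assoc[symmetric] flip: ennreal_mult)
    finally show ?case using Suc by simp
  qed (simp add: h0)
  define H where "H x = (\<Sum>n. ennreal ((1 / 2) ^ n) * h n x)" for x
  have Ah: "abs_conv \<alpha> (h n) x = ennreal B * h (Suc n) x" for n x
    using B by (simp add: hS mult.assoc[symmetric] flip: ennreal_mult)
  show thesis
  proof (rule that)
    show "H \<in> borel_measurable borel" unfolding H_def by measurable
    show "eLp p H \<le> 2 * eLp p H0" unfolding H_def by (intro eLp_suminf p le) measurable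
    show "H0 x \<le> H x" for x
      unfolding H_def using sum_le_suminf[OF summableI, of "{0}" "\<lambda>n. ennreal ((1 / 2) ^ n) * h n x"] by (simp add: h0)
    show "abs_conv \<alpha> H x \<le> ennreal (abs_conv_bound \<alpha>) * H x" for x
    proof -
      have "abs_conv \<alpha> H x = (\<Sum>n. abs_conv \<alpha> (\<lambda>x. ennreal ((1 / 2) ^ n) * h n x) x)"
        unfolding H_def by (intro abs_conv_suminf) measurable
      also have "\<dots> = (\<Sum>n. ennreal (abs_conv_bound \<alpha>) * (ennreal ((1 / 2) ^ Suc n) * h (Suc n) x))"
      proof (intro suminf_cong)
        fix n
        have "ennreal ((1 / 2) ^ n) * ennreal B = ennreal (abs_conv_bound \<alpha>) * ennreal ((1 / 2) ^ Suc n)"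
          using B by (simp add: B_def mult_ac flip: ennreal_mult)
        then show "abs_conv \<alpha> (\<lambda>x. ennreal ((1 / 2) ^ n) * h n x) x = ennreal (abs_conv_bound \<alpha>) * (ennreal ((1 / 2) ^ Suc n) * h (Suc n) x)"
          by (simp add: abs_conv_cmult Ah mult.assoc[symmetric])
      qed
      also have "\<dots> = ennreal (abs_conv_bound \<alpha>) * (\<Sum>n. ennreal ((1 / 2) ^ Suc n) * h (Suc n) x)"
        by (rule ennreal_suminf_cmult)
      \<comment> \<open>Applying the operator shifts the series by one term, so what remains is
        \<open>H\<close> without its first term.\<close>
      also have "(\<Sum>n. ennreal ((1 / 2) ^ Suc n) * h (Suc n) x) \<le> H x"
        unfolding H_def by (subst suminf_offset[OF summableI, of _ 1]) simp
      finally show ?thesis by (simp add: mult_left_mono)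
    qed
  qed
qed

text \<open>One weight \<open>H\<close> controls both values and increments. With \<open>H\<close>
  fixed, the scalar \<open>c\<close> carries all quantitative information: sums, multiples and time
  integrals act on \<open>c\<close> alone.\<close>

definition dominated :: "(real \<Rightarrow> ennreal) \<Rightarrow> real \<Rightarrow> (real \<Rightarrow> real) \<Rightarrow> bool" where
  "dominated H c f \<longleftrightarrow> (\<forall>x. ennreal \<bar>f x\<bar> \<le> ennreal c * H x) \<and> incr f (\<lambda>x. ennreal c * H x)"

lemma incr_mono: "incr f G \<Longrightarrow> (\<And>x. G x \<le> G' x) \<Longrightarrow> incr f G'"
  unfolding incr_def by (meson nn_integral_mono mult_right_mono order_trans zero_le)

lemma incr_add:
  assumes f: "incr f G" and g: "incr g G'" and [measurable]: "G \<in> borel_measurable borel" "G' \<in> borel_measurable borel"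
  shows "incr (\<lambda>x. f x + g x) (\<lambda>x. G x + G' x)"
  unfolding incr_def
proof (intro allI impI)
  fix a b :: real assume "a \<le> b"
  have "ennreal \<bar>f b + g b - (f a + g a)\<bar> \<le> ennreal \<bar>f b - f a\<bar> + ennreal \<bar>g b - g a\<bar>"
    by (simp flip: ennreal_plus)
  also have "\<dots> \<le> (\<integral>\<^sup>+x\<in>{a..b}. G x \<partial>lborel) + (\<integral>\<^sup>+x\<in>{a..b}. G' x \<partial>lborel)"
    using f g \<open>a \<le> b\<close> by (intro add_mono) (auto simp: incr_def)
  also have "\<dots> = (\<integral>\<^sup>+x\<in>{a..b}. (G x + G' x) \<partial>lborel)"
    by (subst nn_integral_add[symmetric]) (auto simp: distrib_right)
  finally show "ennreal \<bar>f b + g b - (f a + g a)\<bar> \<le> (\<integral>\<^sup>+x\<in>{a..b}. (G x + G' x) \<partial>lborel)" .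
qed

lemma dominated_mono: "dominated H c f \<Longrightarrow> c \<le> c' \<Longrightarrow> dominated H c' f"
  unfolding dominated_def by (meson ennreal_leI incr_mono mult_right_mono order_trans zero_le)

lemma dominated_add:
  assumes "dominated H c f" "dominated H c' g" and [measurable]: "H \<in> borel_measurable borel" and "0 \<le> c" "0 \<le> c'"
  shows "dominated H (c + c') (\<lambda>x. f x + g x)"
  unfolding dominated_def
proof (intro conjI allI)
  fix x
  have "ennreal \<bar>f x + g x\<bar> \<le> ennreal \<bar>f x\<bar> + ennreal \<bar>g x\<bar>" by (simp flip: ennreal_plus)
  also have "\<dots> \<le> ennreal c * H x + ennreal c' * H x"
    using assms by (intro add_mono) (auto simp: dominated_def)
  finally show "ennreal \<bar>f x + g x\<bar> \<le> ennreal (c + c') * H x"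
    using assms by (simp add: distrib_right)
next
  have "incr (\<lambda>x. f x + g x) (\<lambda>x. ennreal c * H x + ennreal c' * H x)"
    using assms by (intro incr_add) (auto simp: dominated_def)
  then show "incr (\<lambda>x. f x + g x) (\<lambda>x. ennreal (c + c') * H x)"
    using assms by (simp add: distrib_right)
qed

lemma dominated_cmult:
  assumes "dominated H c f" and [measurable]: "H \<in> borel_measurable borel" and c: "0 \<le> c"
  shows "dominated H (\<bar>k\<bar> * c) (\<lambda>x. k * f x)"
  unfolding dominated_def incr_def
proof (intro conjI allI impI)
  fix x
  have "ennreal \<bar>k\<bar> * ennreal \<bar>f x\<bar> \<le> ennreal \<bar>k\<bar> * (ennreal c * H x)"
    using assms by (intro mult_left_mono) (auto simp: dominated_def)
  then show "ennreal \<bar>k * f x\<bar> \<le> ennreal (\<bar>k\<bar> * c) * H x"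
    using c by (simp add: abs_mult ennreal_mult mult.assoc)
next
  fix a b :: real assume "a \<le> b"
  then have "ennreal \<bar>k\<bar> * ennreal \<bar>f b - f a\<bar> \<le> ennreal \<bar>k\<bar> * (\<integral>\<^sup>+x\<in>{a..b}. (ennreal c * H x) \<partial>lborel)"
    using assms by (intro mult_left_mono) (auto simp: dominated_def incr_def)
  also have "\<dots> = (\<integral>\<^sup>+x\<in>{a..b}. (ennreal (\<bar>k\<bar> * c) * H x) \<partial>lborel)"
    using c by (subst nn_integral_cmult[symmetric]) (auto simp: ennreal_mult mult.assoc)
  finally show "ennreal \<bar>k * f b - k * f a\<bar> \<le> (\<integral>\<^sup>+x\<in>{a..b}. (ennreal (\<bar>k\<bar> * c) * H x) \<partial>lborel)"
    by (simp add: abs_mult ennreal_mult flip: right_diff_distrib)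
qed

lemma ennreal_integral_bound:
  fixes f :: "real \<Rightarrow> real"
  assumes "s \<le> t" "continuous_on {s..t} f" "\<And>r. r \<in> {s..t} \<Longrightarrow> ennreal \<bar>f r\<bar> \<le> B"
  shows "ennreal \<bar>integral {s..t} f\<bar> \<le> ennreal (t - s) * B"
proof (cases B)
  case (real b)
  then have "norm (integral {s..t} f) \<le> b * (t - s)"
    using assms by (intro integral_bound) auto
  then show ?thesis using real assms(1) by (simp add: mult.commute flip: ennreal_mult)
next
  case top
  then show ?thesis using assms(1) by (cases "s = t") (auto simp: ennreal_mult_top)
qed

text \<open>The integral is a real integral for each fixed \<open>x\<close>. An increment in
  \<open>x\<close> is the integral of the increments, so both halves of the bound reduce to
  \<open>ennreal_integral_bound\<close>.\<close>

lemma dominated_integral: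
  fixes k :: "real \<Rightarrow> real \<Rightarrow> real"
  assumes st: "s \<le> t" and c: "\<And>x. continuous_on {s..t} (\<lambda>r. k r x)" and d: "\<And>r. r \<in> {s..t} \<Longrightarrow> dominated H c (k r)"
    and [measurable]: "H \<in> borel_measurable borel" and c0: "0 \<le> c"
  shows "dominated H ((t - s) * c) (\<lambda>x. integral {s..t} (\<lambda>r. k r x))"
  unfolding dominated_def incr_def
proof (intro conjI allI impI)
  fix x
  have "ennreal \<bar>integral {s..t} (\<lambda>r. k r x)\<bar> \<le> ennreal (t - s) * (ennreal c * H x)"
    using d by (intro ennreal_integral_bound st c) (auto simp: dominated_def)
  then show "ennreal \<bar>integral {s..t} (\<lambda>r. k r x)\<bar> \<le> ennreal ((t - s) * c) * H x"
    using c0 st by (simp add: ennreal_mult mult.assoc)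
next
  fix a b :: real assume ab: "a \<le> b"
  have "integral {s..t} (\<lambda>r. k r b) - integral {s..t} (\<lambda>r. k r a) = integral {s..t} (\<lambda>r. k r b - k r a)"
    by (intro Henstock_Kurzweil_Integration.integral_diff[symmetric] integrable_continuous_real c)
  then have "ennreal \<bar>integral {s..t} (\<lambda>r. k r b) - integral {s..t} (\<lambda>r. k r a)\<bar>
    \<le> ennreal (t - s) * (\<integral>\<^sup>+x\<in>{a..b}. (ennreal c * H x) \<partial>lborel)"
    using d ab by (simp only:, intro ennreal_integral_bound st continuous_on_diff c) (auto simp: dominated_def incr_def)
  also have "\<dots> = (\<integral>\<^sup>+x\<in>{a..b}. (ennreal ((t - s) * c) * H x) \<partial>lborel)"
    using c0 st by (subst nn_integral_cmult[symmetric]) (auto simp: ennreal_mult mult.assoc)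
  finally show "ennreal \<bar>integral {s..t} (\<lambda>r. k r b) - integral {s..t} (\<lambda>r. k r a)\<bar>
    \<le> (\<integral>\<^sup>+x\<in>{a..b}. (ennreal ((t - s) * c) * H x) \<partial>lborel)" .
qed

text \<open>Each defining inequality involves the values of the function at one or two points, so it
  passes to pointwise limits, although weak derivatives need not converge there.\<close>

lemma dominated_LIMSEQ:
  assumes lim: "\<And>x. (\<lambda>n. f n x) \<longlonglongrightarrow> g x" and d: "\<And>n. dominated H c (f n)"
  shows "dominated H c g"
  unfolding dominated_def incr_def
proof (intro conjI allI impI)
  fix x
  have "(\<lambda>n. ennreal \<bar>f n x\<bar>) \<longlonglongrightarrow> ennreal \<bar>g x\<bar>" by (intro tendsto_ennrealI tendsto_rabs lim)
  then show "ennreal \<bar>g x\<bar> \<le> ennreal c * H x"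
    by (rule LIMSEQ_le_const2) (use d in \<open>auto simp: dominated_def\<close>)
next
  fix a b :: real assume "a \<le> b"
  have "(\<lambda>n. ennreal \<bar>f n b - f n a\<bar>) \<longlonglongrightarrow> ennreal \<bar>g b - g a\<bar>" by (intro tendsto_ennrealI tendsto_rabs tendsto_diff lim)
  then show "ennreal \<bar>g b - g a\<bar> \<le> (\<integral>\<^sup>+x\<in>{a..b}. (ennreal c * H x) \<partial>lborel)"
    by (rule LIMSEQ_le_const2) (use d \<open>a \<le> b\<close> in \<open>auto simp: dominated_def incr_def\<close>)
qed

text \<open>One copy of \<open>eLp p H\<close> pays for the function and one for its weak
  derivative.\<close>

lemma dominated_W1p:
  assumes p: "1 \<le> p" and [measurable]: "H \<in> borel_measurable borel" and H: "eLp p H < top" and d: "dominated H c f"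
  shows "f \<in> W1p p" "W1p_norm p f \<le> ennreal c * (2 * eLp p H)" "continuous_on UNIV f"
proof -
  have le: "eLp p (\<lambda>x. ennreal c * H x) \<le> ennreal c * eLp p H" by (intro eLp_cmult p) measurable
  also have "\<dots> < top" using H by (simp add: ennreal_mult_less_top)
  finally have fin: "eLp p (\<lambda>x. ennreal c * H x) < top" .
  then have lf: "loc_finite (\<lambda>x. ennreal c * H x)" by (intro eLp_loc_finite[OF p]) measurable
  have inc: "incr f (\<lambda>x. ennreal c * H x)" using d by (simp add: dominated_def)
  show c: "continuous_on UNIV f" by (rule incr_continuous[OF inc lf])
  have m: "f \<in> borel_measurable borel" using c by (rule borel_measurable_continuous_onI)
  have b: "AE x in lborel. ennreal \<bar>f x\<bar> \<le> ennreal c * H x" using d by (simp add: dominated_def)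
  note * = W1p_dominated[OF p m _ b inc lf]
  show "f \<in> W1p p" using *(2) fin by simp
  have "W1p_norm p f \<le> ennreal c * eLp p H + ennreal c * eLp p H"
    using *(1) add_mono[OF le le] by (auto intro: order_trans)
  then show "W1p_norm p f \<le> ennreal c * (2 * eLp p H)" by (simp add: mult_2 distrib_left)
qed

lemma integral_from_0_diff:
  fixes f :: "real \<Rightarrow> real"
  assumes "continuous_on {0..T} f" "0 \<le> s" "s \<le> t" "t \<le> T"
  shows "integral {0..t} f - integral {0..s} f = integral {s..t} f"
  using Henstock_Kurzweil_Integration.integral_combine[OF assms(2,3) integrable_continuous_real[OF continuous_on_subset[OF assms(1)]]] assms
  by simp

text \<open>The difference quotient minus \<open>k t\<close> is the average of
  \<open>k r - k t\<close> over the times between \<open>s\<close> and \<open>t\<close>. It is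
  dominated by \<open>L * \<bar>s - t\<bar>\<close> times \<open>H\<close>, so its norm tends to
  0.\<close>

lemma W1p_norm_derivative:
  assumes p: "1 \<le> p" and Hm [measurable]: "H \<in> borel_measurable borel" and H: "eLp p H < top"
    and W: "\<And>t x. t \<in> {0..T} \<Longrightarrow> W t x = W0 x + integral {0..t} (\<lambda>r. k r x)"
    and k: "\<And>x. continuous_on {0..T} (\<lambda>r. k r x)" and L: "0 \<le> L"
    and d: "\<And>r t. r \<in> {0..T} \<Longrightarrow> t \<in> {0..T} \<Longrightarrow> dominated H (L * \<bar>r - t\<bar>) (\<lambda>x. k r x - k t x)"
    and t: "t \<in> {0..T}"
  shows "((\<lambda>s. W1p_norm p (\<lambda>x. (W s x - W t x) / (s - t) - k t x)) \<longlongrightarrow> 0) (at t within {0..T})"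
proof -
  obtain E where E: "eLp p H = ennreal E" "E \<ge> 0" using H by (cases "eLp p H") auto
  have le: "W1p_norm p (\<lambda>x. (W s x - W t x) / (s - t) - k t x) \<le> ennreal (L * \<bar>s - t\<bar> * (2 * E))"
    if s: "s \<in> {0..T}" and ne: "s \<noteq> t" for s
  proof -
    define a b where "a = min s t" and "b = max s t"
    have ab: "a < b" "0 \<le> a" "b \<le> T" "b - a = \<bar>s - t\<bar>" and tab: "t \<in> {a..b}"
      using s t ne by (auto simp: a_def b_def)
    have cont: "continuous_on {a..b} (\<lambda>r. k r x)" for x
      by (rule continuous_on_subset[OF k]) (use ab in auto)
    have eq: "(W s x - W t x) / (s - t) - k t x = (1 / (b - a)) * integral {a..b} (\<lambda>r. k r x - k t x)" for x
    proof -
      have "W b x - W a x = integral {a..b} (\<lambda>r. k r x)"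
        using W[of a x] W[of b x] ab integral_from_0_diff[OF k[of x], of a b] by simp
      moreover have "(W s x - W t x) / (s - t) = (W b x - W a x) / (b - a)"
        using minus_divide_divide[of "W s x - W t x" "s - t"] by (simp add: a_def b_def min_def max_def)
      moreover have "integral {a..b} (\<lambda>r. k r x - k t x) = integral {a..b} (\<lambda>r. k r x) - (b - a) * k t x"
        using ab by (subst Henstock_Kurzweil_Integration.integral_diff) (auto intro: integrable_continuous_real cont)
      ultimately show ?thesis using ab by (simp add: diff_divide_distrib right_diff_distrib)
    qed
    have "dominated H (\<bar>1 / (b - a)\<bar> * ((b - a) * (L * (b - a)))) (\<lambda>x. (1 / (b - a)) * integral {a..b} (\<lambda>r. k r x - k t x))"
    proof (intro dominated_cmult dominated_integral)
      fix r assume r: "r \<in> {a..b}"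
      then have "\<bar>r - t\<bar> \<le> b - a" using tab by auto
      then show "dominated H (L * (b - a)) (\<lambda>x. k r x - k t x)"
        using r ab t L by (intro dominated_mono[OF d[of r t]] mult_left_mono) auto
    qed (use ab L in \<open>auto intro!: continuous_on_diff cont\<close>)
    moreover have "\<bar>1 / (b - a)\<bar> * ((b - a) * (L * (b - a))) = L * \<bar>s - t\<bar>" using ab by simp
    ultimately have "dominated H (L * \<bar>s - t\<bar>) (\<lambda>x. (W s x - W t x) / (s - t) - k t x)"
      by (simp only: eq)
    then have "W1p_norm p (\<lambda>x. (W s x - W t x) / (s - t) - k t x) \<le> ennreal (L * \<bar>s - t\<bar>) * (2 * eLp p H)"
      by (rule dominated_W1p(2)[OF p Hm H])
    also have "\<dots> = ennreal (L * \<bar>s - t\<bar> * (2 * E))"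
      using E L by (simp add: ennreal_mult)
    finally show ?thesis .
  qed
  have "((\<lambda>s. L * \<bar>s - t\<bar> * (2 * E)) \<longlongrightarrow> L * \<bar>t - t\<bar> * (2 * E)) (at t within {0..T})"
    by (intro tendsto_intros)
  then have "((\<lambda>s. ennreal (L * \<bar>s - t\<bar> * (2 * E))) \<longlongrightarrow> ennreal 0) (at t within {0..T})"
    by (intro tendsto_ennrealI) simp
  then have lim: "((\<lambda>s. ennreal (L * \<bar>s - t\<bar> * (2 * E))) \<longlongrightarrow> 0) (at t within {0..T})" by simp
  show ?thesis
    by (rule tendsto_sandwich[OF _ _ tendsto_const lim])
       (use le in \<open>auto simp: eventually_at_filter\<close>)
qed

section \<open>Joint continuity in time and space\<close>

definition joint_cont :: "(real \<Rightarrow> real \<Rightarrow> real) \<Rightarrow> bool" where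
  "joint_cont k \<longleftrightarrow> continuous_on UNIV (\<lambda>(t, x). k t x)"

lemma joint_cont_slice: assumes "joint_cont k" shows "continuous_on A (\<lambda>t. k t x)" "continuous_on A (k t)"
proof -
  have c: "continuous_on UNIV (\<lambda>z. k (fst z) (snd z))" using assms by (simp add: joint_cont_def case_prod_beta)
  show "continuous_on A (\<lambda>t. k t x)"
    using continuous_on_compose2[OF c, of A "\<lambda>t. (t, x)"] by (simp add: continuous_on_Pair)
  show "continuous_on A (k t)"
    using continuous_on_compose2[OF c, of A "\<lambda>x. (t, x)"] by (simp add: continuous_on_Pair)
qed

text \<open>Freezing time outside \<open>[0, T]\<close> turns curves on \<open>[0, T]\<close> into
  functions on the whole plane, where the type of bounded continuous functions is available.\<close>

definition clamp_time :: "real \<Rightarrow> real \<Rightarrow> real" where "clamp_time T t = max 0 (min T t)"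

text \<open>Rescaling to the unit interval moves the variable upper limit into the integrand;
  continuity of integrals in a parameter then applies.\<close>

lemma joint_cont_integral:
  assumes k: "joint_cont k"
  shows "joint_cont (\<lambda>t x. integral {0..clamp_time T t} (\<lambda>s. k s x))"
proof -
  have eq: "integral {0..\<tau>} (\<lambda>s. k s x) = \<tau> * integral {0..1} (\<lambda>\<sigma>. k (\<tau> * \<sigma>) x)" if "\<tau> \<ge> 0" for \<tau> x
  proof (cases "\<tau> = 0")
    case False
    then have "(\<lambda>x. x / \<tau>) ` {0..\<tau>} = {0..1}" using that by (subst image_divide_atLeastAtMost) auto
    then show ?thesis using integral_stretch_real[of \<tau> 0 \<tau> "\<lambda>s. k s x"] False that by simp
  qed simp
  have c: "continuous_on UNIV (\<lambda>z. k (fst z) (snd z))" using k by (simp add: joint_cont_def case_prod_beta)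
  have "continuous_on UNIV (\<lambda>z. clamp_time T (fst z) * integral (cbox 0 1) (\<lambda>\<sigma>. k (clamp_time T (fst z) * \<sigma>) (snd z)))"
  proof (rule continuous_on_mult)
    show cc: "continuous_on UNIV (\<lambda>z. clamp_time T (fst z))"
      unfolding clamp_time_def by (intro continuous_intros)
    show "continuous_on UNIV (\<lambda>z. integral (cbox 0 1) (\<lambda>\<sigma>. k (clamp_time T (fst z) * \<sigma>) (snd z)))"
    proof (rule integral_continuous_on_param)
      have "continuous_on (UNIV \<times> cbox 0 1) (\<lambda>y. (\<lambda>z. k (fst z) (snd z)) (clamp_time T (fst (fst y)) * snd y, snd (fst y)))"
        unfolding clamp_time_def by (rule continuous_on_compose2[OF c]) (auto intro!: continuous_intros)
      then show "continuous_on (UNIV \<times> cbox 0 1) (\<lambda>(z, \<sigma>). k (clamp_time T (fst z) * \<sigma>) (snd z))"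
        by (simp add: case_prod_beta)
    qed
  qed
  moreover have "clamp_time T t \<ge> 0" for t by (simp add: clamp_time_def)
  ultimately show ?thesis by (simp add: joint_cont_def case_prod_beta eq cbox_interval)
qed

section \<open>Existence\<close>

context nonlinearity begin

abbreviation "C \<equiv> abs_conv_bound \<alpha>"

lemma abs_conv_dominated:
  assumes [measurable]: "H \<in> borel_measurable borel" and AH: "abs_conv \<alpha> H x \<le> ennreal C * H x"
    and "\<And>x. h x \<le> ennreal c * H x" "0 \<le> c"
  shows "abs_conv \<alpha> h x \<le> ennreal (C * c) * H x"
proof -
  have "abs_conv \<alpha> h x \<le> abs_conv \<alpha> (\<lambda>x. ennreal c * H x) x" by (intro abs_conv_mono assms)
  also have "\<dots> = ennreal c * abs_conv \<alpha> H x" by (rule abs_conv_cmult) measurable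
  also have "\<dots> \<le> ennreal c * (ennreal C * H x)" by (intro mult_left_mono AH) simp
  also have "\<dots> = ennreal (C * c) * H x"
    using assms abs_conv_bound_pos[of \<alpha>] by (simp add: ennreal_mult mult_ac)
  finally show ?thesis .
qed

text \<open>Three sizes enter: \<open>e\<close> is the weighted size of \<open>f - g\<close>,
  \<open>\<epsilon>\<close> its sup norm, and \<open>c\<close> the weighted size of \<open>f\<close>
  and \<open>g\<close>. The product of \<open>\<epsilon>\<close> and \<open>c\<close> comes from the
  change of \<open>w'\<close>.\<close>

lemma force_diff_dominated:
  assumes M: "deriv_bound R M"
    and [measurable]: "f \<in> borel_measurable borel" "g \<in> borel_measurable borel"
    and f: "\<And>x. \<bar>f x\<bar> \<le> R" and g: "\<And>x. \<bar>g x\<bar> \<le> R"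
    and Hm [measurable]: "H \<in> borel_measurable borel" and AH: "\<And>x. abs_conv \<alpha> H x \<le> ennreal C * H x"
    and df: "dominated H c f" and dg: "dominated H c g" and e: "dominated H e (\<lambda>x. f x - g x)"
    and \<epsilon>: "\<And>x. \<bar>f x - g x\<bar> \<le> \<epsilon>" and nn: "0 \<le> c" "0 \<le> e"
  shows "dominated H (M * C * e + 4 * M * \<epsilon> * C * c) (\<lambda>x. force \<alpha> w f x - force \<alpha> w g x)"
proof -
  have M0: "0 \<le> M" using M by (simp add: deriv_bound_def)
  have \<epsilon>0: "0 \<le> \<epsilon>" using \<epsilon>[of 0] by simp
  have C0: "0 \<le> C" using abs_conv_bound_pos[of \<alpha>] by simp
  note nonneg = M0 \<epsilon>0 C0 nn
  have E: "ennreal M * abs_conv \<alpha> h x \<le> ennreal (M * C * e) * H x" if "\<And>x. h x \<le> ennreal e * H x" for h x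
  proof -
    have "ennreal M * abs_conv \<alpha> h x \<le> ennreal M * (ennreal (C * e) * H x)"
      by (intro mult_left_mono abs_conv_dominated AH that nn) auto
    then show ?thesis using nonneg by (simp add: ennreal_mult mult.assoc)
  qed
  have G: "ennreal (4 * M * \<epsilon>) * abs_conv \<alpha> (\<lambda>x. ennreal c * H x) x \<le> ennreal (4 * M * \<epsilon> * C * c) * H x" for x
  proof -
    have "ennreal (4 * M * \<epsilon>) * abs_conv \<alpha> (\<lambda>x. ennreal c * H x) x \<le> ennreal (4 * M * \<epsilon>) * (ennreal (C * c) * H x)"
      by (intro mult_left_mono abs_conv_dominated AH nn) auto
    then show ?thesis using nonneg by (simp add: ennreal_mult mult.assoc)
  qed
  have sum: "ennreal (M * C * e) * H x + ennreal (4 * M * \<epsilon> * C * c) * H x = ennreal (M * C * e + 4 * M * \<epsilon> * C * c) * H x" for x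
    using nonneg by (simp add: distrib_right)
  have "ennreal \<bar>force \<alpha> w f x - force \<alpha> w g x\<bar> \<le> ennreal (M * C * e + 4 * M * \<epsilon> * C * c) * H x" for x
  proof -
    have "ennreal \<bar>force \<alpha> w f x - force \<alpha> w g x\<bar> \<le> ennreal M * abs_conv \<alpha> (\<lambda>x. ennreal \<bar>f x - g x\<bar>) x"
      by (intro force_diff_bound[OF M] f g) measurable
    also have "\<dots> \<le> ennreal (M * C * e) * H x" using e by (intro E) (simp add: dominated_def)
    also have "\<dots> \<le> ennreal (M * C * e + 4 * M * \<epsilon> * C * c) * H x"
      unfolding sum[symmetric] by simp
    finally show ?thesis .
  qed
  moreover have "incr (\<lambda>x. force \<alpha> w f x - force \<alpha> w g x) (\<lambda>x. ennreal (M * C * e + 4 * M * \<epsilon> * C * c) * H x)"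
  proof (rule incr_mono)
    show "incr (\<lambda>x. force \<alpha> w f x - force \<alpha> w g x)
      (\<lambda>x. ennreal M * abs_conv \<alpha> (\<lambda>x. ennreal e * H x) x + ennreal (4 * M * \<epsilon>) * abs_conv \<alpha> (\<lambda>x. ennreal c * H x) x)"
      using df dg e by (intro force_diff_incr[OF M] f g \<epsilon>) (auto simp: dominated_def)
    show "ennreal M * abs_conv \<alpha> (\<lambda>x. ennreal e * H x) x + ennreal (4 * M * \<epsilon>) * abs_conv \<alpha> (\<lambda>x. ennreal c * H x) x
      \<le> ennreal (M * C * e + 4 * M * \<epsilon> * C * c) * H x" for x
      unfolding sum[symmetric] by (intro add_mono E G) simp
  qed
  ultimately show ?thesis by (simp add: dominated_def)
qed

lemma force_zero: "force \<alpha> w (\<lambda>x. 0) = (\<lambda>x. 0)"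
  by (simp add: force_def w0 fun_eq_iff)

lemma dominated_zero: "dominated H c (\<lambda>x. 0)"
  by (simp add: dominated_def incr_def)

text \<open>The part \<open>M * C\<close> comes from the Lipschitz bound of \<open>w\<close>, the
  part \<open>4 * M * R * C\<close> from that of \<open>w'\<close> on functions bounded by
  \<open>R\<close>. The same constant serves the weighted growth bound and the Lipschitz bounds in
  sup norm and in W^{1,p}.\<close>

definition kappa :: "real \<Rightarrow> real \<Rightarrow> real" where "kappa R M = M * C * (1 + 4 * R)"

lemma kappa_nonneg: "deriv_bound R M \<Longrightarrow> 0 \<le> kappa R M"
  using abs_conv_bound_pos[of \<alpha>] by (auto simp: kappa_def deriv_bound_def)

text \<open>Compare with the zero function, whose force vanishes because
  \<open>w 0 = 0\<close>.\<close>

lemma force_dominated: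
  assumes M: "deriv_bound R M" and [measurable]: "f \<in> borel_measurable borel" and f: "\<And>x. \<bar>f x\<bar> \<le> R"
    and Hm: "H \<in> borel_measurable borel" and AH: "\<And>x. abs_conv \<alpha> H x \<le> ennreal C * H x"
    and df: "dominated H c f" and nn: "0 \<le> c"
  shows "dominated H (kappa R M * c) (force \<alpha> w f)"
proof -
  have "dominated H (M * C * c + 4 * M * R * C * c) (\<lambda>x. force \<alpha> w f x - force \<alpha> w (\<lambda>x. 0) x)"
    using M df f by (intro force_diff_dominated[OF M] f Hm AH dominated_zero nn) (auto simp: deriv_bound_def)
  then show ?thesis by (simp add: force_zero kappa_def algebra_simps)
qed

text \<open>The constant 1 is itself an admissible weight: \<open>abs_conv \<alpha>\<close> maps it
  to twice the L^1 norm of \<open>\<alpha>\<close>, which is below \<open>C\<close>.\<close>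

lemma force_sup_diff:
  assumes M: "deriv_bound R M"
    and [measurable]: "f \<in> borel_measurable borel" "g \<in> borel_measurable borel"
    and f: "\<And>x. \<bar>f x\<bar> \<le> R" and g: "\<And>x. \<bar>g x\<bar> \<le> R" and d: "\<And>x. \<bar>f x - g x\<bar> \<le> d"
  shows "\<bar>force \<alpha> w f x - force \<alpha> w g x\<bar> \<le> kappa R M * d"
proof -
  have nn: "0 \<le> M" "0 \<le> R" "0 \<le> d" "0 \<le> C" using M d[of 0] abs_conv_bound_pos[of \<alpha>] by (auto simp: deriv_bound_def)
  have "abs_conv \<alpha> (\<lambda>_. ennreal 1) y \<le> ennreal C * ennreal 1" for y
  proof -
    have "abs_conv \<alpha> (\<lambda>_. ennreal 1) y = ennreal (\<integral>x. \<bar>\<alpha> x\<bar> \<partial>lborel) * 2"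
      unfolding abs_conv_def using \<alpha> by (simp add: nn_integral_multc nn_integral_eq_integral)
    also have "\<dots> = ennreal ((\<integral>x. \<bar>\<alpha> x\<bar> \<partial>lborel) * 2)" by (simp add: ennreal_mult)
    also have "\<dots> \<le> ennreal C" by (rule ennreal_leI) (simp add: abs_conv_bound_def)
    finally show ?thesis by simp
  qed
  then have "ennreal M * abs_conv \<alpha> (\<lambda>x. ennreal \<bar>f x - g x\<bar>) x \<le> ennreal M * (ennreal (C * d) * ennreal 1)"
    using d nn by (intro mult_left_mono abs_conv_dominated) (auto simp: ennreal_leI)
  moreover have "ennreal \<bar>force \<alpha> w f x - force \<alpha> w g x\<bar> \<le> ennreal M * abs_conv \<alpha> (\<lambda>x. ennreal \<bar>f x - g x\<bar>) x"
    by (intro force_diff_bound[OF M] f g) measurable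
  ultimately have "ennreal \<bar>force \<alpha> w f x - force \<alpha> w g x\<bar> \<le> ennreal M * (ennreal (C * d) * ennreal 1)"
    by (rule order_trans[rotated])
  also have "\<dots> = ennreal (M * (C * d))" using nn by (simp add: ennreal_mult)
  finally have "ennreal \<bar>force \<alpha> w f x - force \<alpha> w g x\<bar> \<le> ennreal (M * (C * d))" .
  then have "\<bar>force \<alpha> w f x - force \<alpha> w g x\<bar> \<le> M * C * d"
    using nn by (subst (asm) ennreal_le_iff) (auto simp: mult.assoc)
  also have "\<dots> \<le> kappa R M * d"
  proof (rule mult_right_mono)
    show "M * C \<le> kappa R M" using nn by (simp add: kappa_def distrib_left)
  qed (use nn in simp)
  finally show ?thesis .
qed

section \<open>The Picard operator\<close>

definition Vop :: "real \<Rightarrow> (real \<Rightarrow> real) \<Rightarrow> (real \<Rightarrow> real \<Rightarrow> real) \<Rightarrow> real \<Rightarrow> real \<Rightarrow> real" where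
  "Vop T \<psi> U t x = \<psi> x + integral {0..clamp_time T t} (\<lambda>s. force \<alpha> w (U s) x)"

text \<open>Integrating the velocity \<open>Vop\<close> once more makes the second order problem a
  fixed point equation for the position alone; the two integrations produce the factor
  \<open>T^2\<close>.\<close>

definition Uop :: "real \<Rightarrow> (real \<Rightarrow> real) \<Rightarrow> (real \<Rightarrow> real) \<Rightarrow> (real \<Rightarrow> real \<Rightarrow> real) \<Rightarrow> real \<Rightarrow> real \<Rightarrow> real" where
  "Uop T \<phi> \<psi> U t x = \<phi> x + integral {0..clamp_time T t} (\<lambda>s. Vop T \<psi> U s x)"

lemma joint_cont_add: "joint_cont U \<Longrightarrow> continuous_on UNIV f \<Longrightarrow> joint_cont (\<lambda>t x. f x + U t x)"
  unfolding joint_cont_def case_prod_beta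
  by (intro continuous_on_add continuous_on_compose2[of UNIV f UNIV snd] continuous_on_snd continuous_on_id) auto

lemma clamp_time_bounds: "0 \<le> T \<Longrightarrow> 0 \<le> clamp_time T t" "0 \<le> T \<Longrightarrow> clamp_time T t \<le> T"
  by (auto simp: clamp_time_def)

lemma clamp_time_id: "t \<in> {0..T} \<Longrightarrow> clamp_time T t = t"
  by (auto simp: clamp_time_def)

lemma abs_integral_bound:
  fixes f :: "real \<Rightarrow> real"
  assumes "0 \<le> t" "t \<le> T" "continuous_on UNIV f" "\<And>s. \<bar>f s\<bar> \<le> B"
  shows "\<bar>integral {0..t} f\<bar> \<le> T * B"
proof -
  have "norm (integral {0..t} f) \<le> B * (t - 0)"
    using assms by (intro integral_bound) (auto intro: continuous_on_subset)
  also have "\<dots> \<le> T * B" using assms(1,2) assms(4)[of 0] by (simp add: mult.commute mult_left_mono)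
  finally show ?thesis by simp
qed

context
  fixes R M T :: real and \<phi> \<psi> :: "real \<Rightarrow> real" and H :: "real \<Rightarrow> ennreal"
  assumes M: "deriv_bound R M" and T: "0 < T" "T \<le> 1" "T^2 * kappa R M \<le> 1 / 2"
    and c\<phi>: "continuous_on UNIV \<phi>" and c\<psi>: "continuous_on UNIV \<psi>"
    and b\<phi>: "\<And>x. \<bar>\<phi> x\<bar> \<le> R / 4" and b\<psi>: "\<And>x. \<bar>\<psi> x\<bar> \<le> R / 4"
    and Hm [measurable]: "H \<in> borel_measurable borel" and AH: "\<And>x. abs_conv \<alpha> H x \<le> ennreal C * H x"
    and d\<phi>: "dominated H 1 \<phi>" and d\<psi>: "dominated H 1 \<psi>"
begin

text \<open>The constants close up under \<open>Uop\<close>: position, velocity and force contribute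
  \<open>R/4 + R/4 + R/2 = R\<close> to the sup bound and \<open>1 + 1 + 2 = 4\<close> to the
  weight, by \<open>T \<le> 1\<close> and \<open>T^2 * kappa R M \<le> 1 / 2\<close>.\<close>

definition admissible :: "(real \<Rightarrow> real \<Rightarrow> real) \<Rightarrow> bool" where
  "admissible U \<longleftrightarrow> joint_cont U \<and> (\<forall>t x. \<bar>U t x\<bar> \<le> R) \<and> (\<forall>t. dominated H 4 (U t))"

lemma R0: "0 \<le> R" and T0: "0 \<le> T" using M T by (auto simp: deriv_bound_def)

lemma admissible_meas: "admissible U \<Longrightarrow> U t \<in> borel_measurable borel"
  by (auto simp: admissible_def intro: borel_measurable_continuous_onI joint_cont_slice)

lemma admissible_force:
  assumes U: "admissible U"
  shows "joint_cont (\<lambda>t. force \<alpha> w (U t))" "\<bar>force \<alpha> w (U t) x\<bar> \<le> kappa R M * R" "dominated H (kappa R M * 4) (force \<alpha> w (U t))"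
proof -
  show "joint_cont (\<lambda>t. force \<alpha> w (U t))"
    using force_continuous[OF M, of U] U by (auto simp: admissible_def joint_cont_def)
  show "\<bar>force \<alpha> w (U t) x\<bar> \<le> kappa R M * R"
    using force_sup_diff[OF M admissible_meas[OF U, of t], of "\<lambda>x. 0" R x] U R0
    by (simp add: force_zero admissible_def)
  show "dominated H (kappa R M * 4) (force \<alpha> w (U t))"
    using U by (intro force_dominated[OF M admissible_meas[OF U]] Hm AH) (auto simp: admissible_def)
qed

lemma Vop_props:
  assumes U: "admissible U"
  shows "joint_cont (Vop T \<psi> U)" "\<bar>Vop T \<psi> U t x\<bar> \<le> R / 4 + T * (kappa R M * R)"
    "dominated H (1 + T * (kappa R M * 4)) (Vop T \<psi> U t)"
proof -
  note k = admissible_force[OF U]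
  note cl = clamp_time_bounds[OF T0]
  show "joint_cont (Vop T \<psi> U)"
    unfolding Vop_def[abs_def] by (intro joint_cont_add c\<psi> joint_cont_integral k)
  have "\<bar>integral {0..clamp_time T t} (\<lambda>s. force \<alpha> w (U s) x)\<bar> \<le> T * (kappa R M * R)"
    by (intro abs_integral_bound cl joint_cont_slice(1)[OF k(1)] k(2))
  then show "\<bar>Vop T \<psi> U t x\<bar> \<le> R / 4 + T * (kappa R M * R)"
    unfolding Vop_def using b\<psi>[of x] by linarith
  have "dominated H ((clamp_time T t - 0) * (kappa R M * 4)) (\<lambda>x. integral {0..clamp_time T t} (\<lambda>s. force \<alpha> w (U s) x))"
    using kappa_nonneg[OF M] by (intro dominated_integral cl joint_cont_slice(1)[OF k(1)] k(3) Hm) auto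
  then have "dominated H (T * (kappa R M * 4)) (\<lambda>x. integral {0..clamp_time T t} (\<lambda>s. force \<alpha> w (U s) x))"
    by (rule dominated_mono) (use cl kappa_nonneg[OF M] in \<open>auto intro!: mult_right_mono\<close>)
  then show "dominated H (1 + T * (kappa R M * 4)) (Vop T \<psi> U t)"
    unfolding Vop_def[abs_def] using kappa_nonneg[OF M] T0 by (intro dominated_add d\<psi> Hm) auto
qed

lemma Uop_admissible:
  assumes U: "admissible U" shows "admissible (Uop T \<phi> \<psi> U)"
  unfolding admissible_def
proof (intro conjI allI)
  note v = Vop_props[OF U]
  note cl = clamp_time_bounds[OF T0]
  show "joint_cont (Uop T \<phi> \<psi> U)"
    unfolding Uop_def[abs_def] by (intro joint_cont_add c\<phi> joint_cont_integral v)
  fix t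
  have TT: "T * (T * (kappa R M * r)) \<le> r / 2" if "r \<ge> 0" for r
    using mult_right_mono[OF T(3) that] by (simp add: power2_eq_square mult_ac)
  show "\<bar>Uop T \<phi> \<psi> U t x\<bar> \<le> R" for x
  proof -
    have "\<bar>integral {0..clamp_time T t} (\<lambda>s. Vop T \<psi> U s x)\<bar> \<le> T * (R / 4 + T * (kappa R M * R))"
      by (intro abs_integral_bound cl joint_cont_slice(1)[OF v(1)] v(2))
    also have "\<dots> \<le> R / 4 + R / 2"
      using TT[OF R0] mult_right_mono[OF T(2), of "R / 4"] R0 by (simp add: distrib_left)
    finally show ?thesis unfolding Uop_def using b\<phi>[of x] by linarith
  qed
  have nn: "0 \<le> 1 + T * (kappa R M * 4)" using kappa_nonneg[OF M] T0 by simp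
  have "dominated H ((clamp_time T t - 0) * (1 + T * (kappa R M * 4))) (\<lambda>x. integral {0..clamp_time T t} (\<lambda>s. Vop T \<psi> U s x))"
    by (intro dominated_integral cl joint_cont_slice(1)[OF v(1)] v(3) Hm nn)
  then have "dominated H (T * (1 + T * (kappa R M * 4))) (\<lambda>x. integral {0..clamp_time T t} (\<lambda>s. Vop T \<psi> U s x))"
    by (rule dominated_mono) (use cl nn in \<open>auto intro!: mult_right_mono\<close>)
  moreover have "T * (1 + T * (kappa R M * 4)) \<le> 3"
    using TT[of 4] T by (simp add: distrib_left)
  ultimately have "dominated H 3 (\<lambda>x. integral {0..clamp_time T t} (\<lambda>s. Vop T \<psi> U s x))" by (rule dominated_mono)
  then have "dominated H (1 + 3) (Uop T \<phi> \<psi> U t)"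
    unfolding Uop_def[abs_def] by (intro dominated_add d\<phi> Hm) auto
  then show "dominated H 4 (Uop T \<phi> \<psi> U t)" by simp
qed

lemma Uop_contraction:
  assumes U: "admissible U" and U': "admissible U'" and d: "\<And>t x. \<bar>U t x - U' t x\<bar> \<le> d"
  shows "\<bar>Uop T \<phi> \<psi> U t x - Uop T \<phi> \<psi> U' t x\<bar> \<le> d / 2"
proof -
  note cl = clamp_time_bounds[OF T0]
  have d0: "d \<ge> 0" using d[of 0 0] by simp
  have kd: "\<bar>force \<alpha> w (U t) x - force \<alpha> w (U' t) x\<bar> \<le> kappa R M * d" for t x
    using U U' by (intro force_sup_diff[OF M] admissible_meas d) (auto simp: admissible_def)
  have c: "continuous_on A (\<lambda>t. force \<alpha> w (U t) x)" "continuous_on A (\<lambda>t. force \<alpha> w (U' t) x)" for A x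
    using joint_cont_slice(1)[OF admissible_force(1)] U U' by auto
  have cv: "continuous_on A (\<lambda>t. Vop T \<psi> U t x)" "continuous_on A (\<lambda>t. Vop T \<psi> U' t x)" for A x
    using joint_cont_slice(1)[OF Vop_props(1)] U U' by auto
  have v: "\<bar>Vop T \<psi> U t x - Vop T \<psi> U' t x\<bar> \<le> T * (kappa R M * d)" for t x
  proof -
    have "Vop T \<psi> U t x - Vop T \<psi> U' t x = integral {0..clamp_time T t} (\<lambda>s. force \<alpha> w (U s) x - force \<alpha> w (U' s) x)"
      unfolding Vop_def
      by (subst Henstock_Kurzweil_Integration.integral_diff) (auto intro!: integrable_continuous_real c)
    also have "\<bar>\<dots>\<bar> \<le> T * (kappa R M * d)"
      by (intro abs_integral_bound cl continuous_on_diff c kd)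
    finally show ?thesis .
  qed
  have eq: "Uop T \<phi> \<psi> U t x - Uop T \<phi> \<psi> U' t x = integral {0..clamp_time T t} (\<lambda>s. Vop T \<psi> U s x - Vop T \<psi> U' s x)"
    unfolding Uop_def
    by (subst Henstock_Kurzweil_Integration.integral_diff) (auto intro!: integrable_continuous_real cv)
  have "\<bar>Uop T \<phi> \<psi> U t x - Uop T \<phi> \<psi> U' t x\<bar> \<le> T * (T * (kappa R M * d))"
    unfolding eq
  proof (rule abs_integral_bound)
    show "continuous_on UNIV (\<lambda>s. Vop T \<psi> U s x - Vop T \<psi> U' s x)" by (intro continuous_on_diff cv)
    show "\<bar>Vop T \<psi> U s x - Vop T \<psi> U' s x\<bar> \<le> T * (kappa R M * d)" for s by (rule v)
  qed (rule cl)+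
  also have "\<dots> \<le> d / 2"
  proof -
    have "T * (T * (kappa R M * d)) = T^2 * kappa R M * d" by (simp add: power2_eq_square)
    also have "\<dots> \<le> 1 / 2 * d" by (rule mult_right_mono[OF T(3) d0])
    finally show ?thesis by simp
  qed
  finally show ?thesis .
qed

lemma fixpoint_exists: "\<exists>U. admissible U \<and> Uop T \<phi> \<psi> U = U"
proof -
  define S :: "((real \<times> real) \<Rightarrow>\<^sub>C real) set" where "S = {u. admissible (\<lambda>t x. apply_bcontfun u (t, x))}"
  \<comment> \<open>\<open>Bcontfun\<close> is inverted by \<open>apply_bcontfun\<close> only on
    bounded continuous functions; \<open>app\<close> ensures this on admissible ones, so
    \<open>F\<close> is evaluated on \<open>S\<close> only.\<close>
  define F where "F u = Bcontfun (\<lambda>(t, x). Uop T \<phi> \<psi> (\<lambda>t x. apply_bcontfun u (t, x)) t x)" for u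
  have app: "apply_bcontfun (Bcontfun (\<lambda>(t, x). U t x)) = (\<lambda>(t, x). U t x)" if "admissible U" for U
    using that by (intro Bcontfun_inverse bcontfun_normI[of _ R]) (auto simp: admissible_def joint_cont_def)
  have FS: "F u (t, x) = Uop T \<phi> \<psi> (\<lambda>t x. apply_bcontfun u (t, x)) t x" if "u \<in> S" for u t x
    using that unfolding F_def by (subst app) (auto simp: S_def intro: Uop_admissible)
  have "\<exists>!u\<in>S. F u = u"
  proof (rule Banach_fix[where c="1/2"])
    have "closed S"
      unfolding closed_sequential_limits
    proof (intro allI impI, elim conjE)
      fix u l assume u: "\<forall>n. u n \<in> S" and l: "u \<longlonglongrightarrow> l"
      have lim: "(\<lambda>n. apply_bcontfun (u n) z) \<longlonglongrightarrow> apply_bcontfun l z" for z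
      proof (rule metric_tendsto_imp_tendsto[OF l])
        show "\<forall>\<^sub>F n in sequentially. dist (u n z) (l z) \<le> dist (u n) l" by (simp add: dist_bounded)
      qed
      show "l \<in> S"
        unfolding S_def admissible_def mem_Collect_eq
      proof (intro conjI allI)
        show "joint_cont (\<lambda>t x. l (t, x))" by (simp add: joint_cont_def case_prod_beta)
        fix t x
        have "(\<lambda>n. \<bar>apply_bcontfun (u n) (t, x)\<bar>) \<longlonglongrightarrow> \<bar>apply_bcontfun l (t, x)\<bar>" by (intro tendsto_rabs lim)
        then show "\<bar>apply_bcontfun l (t, x)\<bar> \<le> R"
          by (rule LIMSEQ_le_const2) (use u in \<open>auto simp: S_def admissible_def\<close>)
      next
        fix t
        show "dominated H 4 (\<lambda>x. l (t, x))"
          by (rule dominated_LIMSEQ[of "\<lambda>n x. u n (t, x)"]) (use lim u in \<open>auto simp: S_def admissible_def\<close>)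
      qed
    qed
    then show "complete S" by (simp add: complete_eq_closed)
    have "admissible (\<lambda>t x. 0)" using R0 by (simp add: admissible_def joint_cont_def dominated_zero case_prod_beta)
    then have "Bcontfun (\<lambda>(t, x). 0) \<in> S" using app[of "\<lambda>t x. 0"] by (simp add: S_def)
    then show "S \<noteq> {}" by auto
    show "F ` S \<subseteq> S"
    proof safe
      fix u assume "u \<in> S"
      then have "(\<lambda>t x. F u (t, x)) = Uop T \<phi> \<psi> (\<lambda>t x. apply_bcontfun u (t, x))" using FS by auto
      then show "F u \<in> S" using \<open>u \<in> S\<close> Uop_admissible by (simp add: S_def)
    qed
    show "dist (F u) (F v) \<le> 1 / 2 * dist u v" if "u \<in> S" "v \<in> S" for u v
    proof (rule dist_bound)
      fix z :: "real \<times> real"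
      obtain t x where z: "z = (t, x)" by force
      show "dist (F u z) (F v z) \<le> 1 / 2 * dist u v"
        unfolding z FS[OF that(1)] FS[OF that(2)] dist_real_def
        using that dist_bounded[of u _ v] Uop_contraction[of "\<lambda>t x. u (t, x)" "\<lambda>t x. v (t, x)" "dist u v" t x]
        by (simp add: S_def dist_real_def)
    qed
  qed auto
  then obtain u where u: "u \<in> S" "F u = u" by auto
  have "Uop T \<phi> \<psi> (\<lambda>t x. u (t, x)) t x = u (t, x)" for t x
    using FS[OF u(1), of t x] unfolding u(2) by (rule sym)
  then have "Uop T \<phi> \<psi> (\<lambda>t x. u (t, x)) = (\<lambda>t x. u (t, x))" by (intro ext)
  then show ?thesis using u(1) by (intro exI[of _ "\<lambda>t x. u (t, x)"]) (simp add: S_def)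
qed

text \<open>The fixed point equation holds for each \<open>x\<close>. It makes \<open>U\<close> and
  then the force Lipschitz in time with respect to \<open>H\<close>, and likewise the velocity
  \<open>V\<close>; by \<open>W1p_norm_derivative\<close> the pointwise time derivatives are then
  derivatives in W^{1,p}.\<close>

lemma solution_exists:
  assumes p: "1 \<le> p" and H: "eLp p H < top"
  shows "\<exists>U V. is_solution p \<alpha> w T \<phi> \<psi> U \<and> C2_W p T U V (\<lambda>t. force \<alpha> w (U t)) \<and> U 0 = \<phi> \<and> V 0 = \<psi> \<and>
    (\<forall>t. continuous_on UNIV (U t)) \<and> (\<forall>t x. \<bar>U t x\<bar> \<le> R) \<and> (\<forall>t. dominated H 4 (U t))"
proof -
  obtain U where U: "admissible U" "Uop T \<phi> \<psi> U = U" using fixpoint_exists by blast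
  define V where "V = Vop T \<psi> U"
  let ?k = "\<lambda>t. force \<alpha> w (U t)"
  have V: "V t x = \<psi> x + integral {0..t} (\<lambda>s. ?k s x)" if "t \<in> {0..T}" for t x
    using clamp_time_id[OF that] by (simp add: V_def Vop_def)
  have UV: "U t x = \<phi> x + integral {0..t} (\<lambda>s. V s x)" if "t \<in> {0..T}" for t x
    using clamp_time_id[OF that] U(2) unfolding V_def by (metis Uop_def)
  have k0: "0 \<le> kappa R M" by (rule kappa_nonneg[OF M])
  then have k4: "0 \<le> kappa R M * 4" by (rule mult_nonneg_nonneg) simp
  define c where "c = 1 + T * (kappa R M * 4)"
  have c0: "0 \<le> c" using k0 T0 by (simp add: c_def)
  define R' where "R' = R / 4 + T * (kappa R M * R)"
  note kp = admissible_force[OF U(1)] and vp = Vop_props[OF U(1), folded V_def c_def R'_def]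
  have ck: "continuous_on A (\<lambda>t. ?k t x)" and cV: "continuous_on A (\<lambda>t. V t x)" for A x
    using joint_cont_slice(1) kp(1) vp(1) by auto
  have dif: "dominated H (L * \<bar>s - t\<bar>) (\<lambda>x. W s x - W t x)"
    if W: "\<And>t x. t \<in> {0..T} \<Longrightarrow> W t x = W0 x + integral {0..t} (\<lambda>s. k s x)"
      and k: "\<And>A x. continuous_on A (\<lambda>s. k s x)" "\<And>s. dominated H L (k s)" and L: "0 \<le> L"
      and st: "s \<in> {0..T}" "t \<in> {0..T}" for W W0 k L s t
  proof -
    have *: "dominated H ((b - a) * L) (\<lambda>x. W b x - W a x)" if "a \<le> b" "a \<in> {0..T}" "b \<in> {0..T}" for a b
    proof -
      have "W b x - W a x = integral {a..b} (\<lambda>s. k s x)" for x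
        using integral_from_0_diff[OF k(1), where s=a and t=b and T=T] that by (simp add: W)
      then show ?thesis using that by (simp only:) (intro dominated_integral k L Hm)
    qed
    show ?thesis
    proof (cases "t \<le> s")
      case True then show ?thesis using *[OF True st(2,1)] by (simp add: mult.commute)
    next
      case False
      then have "dominated H (\<bar>-1\<bar> * ((t - s) * L)) (\<lambda>x. (-1) * (W t x - W s x))"
        using st L by (intro dominated_cmult * Hm) auto
      then show ?thesis using False by (simp add: mult.commute)
    qed
  qed
  have dU: "dominated H (c * \<bar>s - t\<bar>) (\<lambda>x. U s x - U t x)" if "s \<in> {0..T}" "t \<in> {0..T}" for s t
    by (rule dif[OF UV cV vp(3) c0 that])
  have dV: "dominated H (kappa R M * 4 * \<bar>s - t\<bar>) (\<lambda>x. V s x - V t x)" if "s \<in> {0..T}" "t \<in> {0..T}" for s t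
    by (rule dif[OF V ck kp(3) k4 that])
  \<comment> \<open>Besides the weighted distance \<open>dU\<close>,
    \<open>force_diff_dominated\<close> also asks for the sup distance.\<close>
  have sU: "\<bar>U s x - U t x\<bar> \<le> R' * \<bar>s - t\<bar>" if st: "s \<in> {0..T}" "t \<in> {0..T}" for s t x
  proof -
    have *: "\<bar>U b x - U a x\<bar> \<le> R' * (b - a)" if "a \<le> b" "a \<in> {0..T}" "b \<in> {0..T}" for a b
    proof -
      have "U b x - U a x = integral {a..b} (\<lambda>s. V s x)"
        using integral_from_0_diff[OF cV, where s=a and t=b and T=T] that by (simp add: UV)
      moreover have "norm (integral {a..b} (\<lambda>s. V s x)) \<le> R' * (b - a)"
        using that vp(2) by (intro integral_bound cV) auto
      ultimately show ?thesis by simp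
    qed
    show ?thesis using *[of s t] *[of t s] st by (cases "s \<le> t") (auto simp: abs_minus_commute)
  qed
  \<comment> \<open>The constant of \<open>force_diff_dominated\<close> for
    \<open>e = c * \<bar>s - t\<bar>\<close>, \<open>\<epsilon> = R' * \<bar>s - t\<bar>\<close> and
    weight bound 4, divided by \<open>\<bar>s - t\<bar>\<close>.\<close>
  define L where "L = M * C * c + 4 * M * R' * C * 4"
  have R'0: "0 \<le> R'" using k0 T0 R0 by (simp add: R'_def)
  have L0: "0 \<le> L" using M abs_conv_bound_pos[of \<alpha>] c0 R'0 by (auto simp: L_def deriv_bound_def)
  have dk: "dominated H (L * \<bar>s - t\<bar>) (\<lambda>x. ?k s x - ?k t x)" if "s \<in> {0..T}" "t \<in> {0..T}" for s t
  proof -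
    have "dominated H (M * C * (c * \<bar>s - t\<bar>) + 4 * M * (R' * \<bar>s - t\<bar>) * C * 4) (\<lambda>x. ?k s x - ?k t x)"
      using U(1) c0 dU[OF that] sU[OF that]
      by (intro force_diff_dominated[OF M] admissible_meas Hm AH) (auto simp: admissible_def)
    then show ?thesis by (simp add: L_def algebra_simps)
  qed
  have C2: "C2_W p T U V ?k"
    unfolding C2_W_def
  proof (intro conjI ballI)
    fix t assume t: "t \<in> {0..T}"
    show "U t \<in> W1p p" by (rule dominated_W1p(1)[OF p Hm H, of 4]) (use U(1) in \<open>simp add: admissible_def\<close>)
    show "V t \<in> W1p p" "?k t \<in> W1p p"
      by (rule dominated_W1p(1)[OF p Hm H vp(3)], rule dominated_W1p(1)[OF p Hm H kp(3)])
    show "((\<lambda>s. W1p_norm p (\<lambda>x. (U s x - U t x) / (s - t) - V t x)) \<longlongrightarrow> 0) (at t within {0..T})"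
      by (rule W1p_norm_derivative[OF p Hm H UV cV k4 dV t])
    show "((\<lambda>s. W1p_norm p (\<lambda>x. (V s x - V t x) / (s - t) - ?k t x)) \<longlongrightarrow> 0) (at t within {0..T})"
      by (rule W1p_norm_derivative[OF p Hm H V ck L0 dk t])
    obtain E where E: "eLp p H = ennreal E" "E \<ge> 0" using H by (cases "eLp p H") auto
    have le: "W1p_dist p (?k s) (?k t) \<le> ennreal (L * \<bar>s - t\<bar> * (2 * E))" if "s \<in> {0..T}" for s
      using dominated_W1p(2)[OF p Hm H dk[OF that t]] E L0 by (simp add: W1p_dist_def ennreal_mult)
    have "((\<lambda>s. L * \<bar>s - t\<bar> * (2 * E)) \<longlongrightarrow> L * \<bar>t - t\<bar> * (2 * E)) (at t within {0..T})"
      by (intro tendsto_intros)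
    then have "((\<lambda>s. ennreal (L * \<bar>s - t\<bar> * (2 * E))) \<longlongrightarrow> ennreal 0) (at t within {0..T})"
      by (intro tendsto_ennrealI) simp
    then have lim: "((\<lambda>s. ennreal (L * \<bar>s - t\<bar> * (2 * E))) \<longlongrightarrow> 0) (at t within {0..T})" by simp
    show "((\<lambda>s. W1p_dist p (?k s) (?k t)) \<longlongrightarrow> 0) (at t within {0..T})"
      by (rule tendsto_sandwich[OF _ _ tendsto_const lim]) (use le in \<open>auto simp: eventually_at_filter\<close>)
  qed
  have init: "U 0 = \<phi>" "V 0 = \<psi>" using UV[of 0] V[of 0] T0 by auto
  have "is_solution p \<alpha> w T \<phi> \<psi> U"
    unfolding is_solution_def using C2 init by (intro exI[of _ V] exI[of _ ?k]) (simp add: force_eq)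
  then show ?thesis using C2 init U(1) joint_cont_slice(2) by (intro exI[of _ U] exI[of _ V]) (auto simp: admissible_def)
qed

end

end

section \<open>Curves in \<open>W\<^sup>1\<^sup>,\<^sup>p\<close>\<close>

lemma W1p_norm_commute:
  assumes p: "1 \<le> p" and f: "f \<in> W1p p" and g: "g \<in> W1p p"
  shows "W1p_norm p (\<lambda>x. f x - g x) = W1p_norm p (\<lambda>x. g x - f x)"
proof -
  have *: "W1p_norm p (\<lambda>x. a x - b x) \<le> W1p_norm p (\<lambda>x. b x - a x)" if "a \<in> W1p p" "b \<in> W1p p" for a b
    using W1p_norm_cmult[OF p W1p_diff[OF p that(2,1)], of "-1"] by simp
  show ?thesis by (intro antisym * f g)
qed

lemma W1p_norm_zero: "1 \<le> p \<Longrightarrow> f \<in> W1p p \<Longrightarrow> W1p_norm p (\<lambda>x. 0) = 0"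
  using W1p_norm_cmult[of p f 0] by simp

lemma W1p_norm_triangle3:
  assumes p: "1 \<le> p" and W: "f \<in> W1p p" "g \<in> W1p p" "h \<in> W1p p"
  shows "W1p_norm p (\<lambda>x. f x - h x) \<le> W1p_norm p (\<lambda>x. f x - g x) + W1p_norm p (\<lambda>x. g x - h x)"
  using W1p_norm_add[OF p W1p_diff[OF p W(1,2)] W1p_diff[OF p W(2,3)]] by simp

lemma W1p_norm_le_diff:
  assumes p: "1 \<le> p" and W: "f \<in> W1p p" "g \<in> W1p p"
  shows "W1p_norm p f \<le> W1p_norm p g + W1p_norm p (\<lambda>x. f x - g x)"
  using W1p_norm_add[OF p W(2) W1p_diff[OF p W]] by simp

definition W1p_has_derivative :: "ennreal \<Rightarrow> real \<Rightarrow> (real \<Rightarrow> real \<Rightarrow> real) \<Rightarrow> (real \<Rightarrow> real \<Rightarrow> real) \<Rightarrow> bool" where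
  "W1p_has_derivative p T e e' \<longleftrightarrow> (\<forall>t\<in>{0..T}. e t \<in> W1p p \<and> e' t \<in> W1p p \<and>
     ((\<lambda>s. W1p_norm p (\<lambda>x. (e s x - e t x) / (s - t) - e' t x)) \<longlongrightarrow> 0) (at t within {0..T}))"

lemma W1p_quotient:
  assumes p: "1 \<le> p" and W: "f \<in> W1p p" "g \<in> W1p p" "h \<in> W1p p"
  shows "(\<lambda>x. (f x - g x) / c - h x) \<in> W1p p"
  using W1p_diff[OF p W1p_cmult[OF p W1p_diff[OF p W(1,2)], of "1 / c"] W(3)] by simp

lemma W1p_has_derivative_diff:
  assumes p: "1 \<le> p" and u: "W1p_has_derivative p T u u'" and v: "W1p_has_derivative p T v v'"
  shows "W1p_has_derivative p T (\<lambda>t x. u t x - v t x) (\<lambda>t x. u' t x - v' t x)"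
  unfolding W1p_has_derivative_def
proof (intro ballI conjI)
  fix t assume t: "t \<in> {0..T}"
  have W: "u s \<in> W1p p" "v s \<in> W1p p" "u' s \<in> W1p p" "v' s \<in> W1p p" if "s \<in> {0..T}" for s
    using u v that by (auto simp: W1p_has_derivative_def)
  show "(\<lambda>x. u t x - v t x) \<in> W1p p" "(\<lambda>x. u' t x - v' t x) \<in> W1p p"
    using W t by (auto intro: W1p_diff[OF p])
  let ?q = "\<lambda>u u' s x. (u s x - u t x) / (s - t) - u' t x"
  have "((\<lambda>s. W1p_norm p (?q u u' s) + W1p_norm p (?q v v' s)) \<longlongrightarrow> 0 + 0) (at t within {0..T})"
    using u v t by (intro tendsto_add) (auto simp: W1p_has_derivative_def)
  then have lim: "((\<lambda>s. W1p_norm p (?q u u' s) + W1p_norm p (?q v v' s)) \<longlongrightarrow> 0) (at t within {0..T})" by simp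
  have le: "W1p_norm p (\<lambda>x. (u s x - v s x - (u t x - v t x)) / (s - t) - (u' t x - v' t x))
      \<le> W1p_norm p (?q u u' s) + W1p_norm p (?q v v' s)" if "s \<in> {0..T}" for s
  proof -
    have "(\<lambda>x. (u s x - v s x - (u t x - v t x)) / (s - t) - (u' t x - v' t x)) = (\<lambda>x. ?q u u' s x - ?q v v' s x)"
      by (simp add: diff_divide_distrib fun_eq_iff)
    then show ?thesis
      using W1p_norm_diff[OF p W1p_quotient[OF p W(1)[OF that] W(1)[OF t] W(3)[OF t], of "s - t"]
          W1p_quotient[OF p W(2)[OF that] W(2)[OF t] W(4)[OF t], of "s - t"]] by simp
  qed
  show "((\<lambda>s. W1p_norm p (\<lambda>x. (u s x - v s x - (u t x - v t x)) / (s - t) - (u' t x - v' t x))) \<longlongrightarrow> 0) (at t within {0..T})"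
    by (rule tendsto_sandwich[OF _ _ tendsto_const lim]) (use le in \<open>auto simp: eventually_at_filter\<close>)
qed

lemma W1p_increment_le:
  assumes p: "1 \<le> p" and e: "W1p_has_derivative p T e e'" and s: "s \<in> {0..T}" and t: "t \<in> {0..T}"
    and q: "s \<noteq> t \<Longrightarrow> W1p_norm p (\<lambda>x. (e s x - e t x) / (s - t) - e' t x) \<le> ennreal \<epsilon>"
    and m: "W1p_norm p (e' t) \<le> ennreal m" and nn: "0 \<le> \<epsilon>" "0 \<le> m"
  shows "W1p_norm p (\<lambda>x. e s x - e t x) \<le> ennreal ((m + \<epsilon>) * \<bar>s - t\<bar>)"
proof (cases "s = t")
  case True
  then show ?thesis using W1p_norm_zero[OF p, of "e t"] e t by (simp add: W1p_has_derivative_def)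
next
  case False
  have W: "e s \<in> W1p p" "e t \<in> W1p p" "e' t \<in> W1p p" using e s t by (auto simp: W1p_has_derivative_def)
  let ?q = "\<lambda>x. (e s x - e t x) / (s - t) - e' t x"
  have qW: "?q \<in> W1p p" by (intro W1p_quotient p W)
  have "(\<lambda>x. e s x - e t x) = (\<lambda>x. (s - t) * (?q x + e' t x))" using False by (simp add: fun_eq_iff)
  then have "W1p_norm p (\<lambda>x. e s x - e t x) \<le> ennreal \<bar>s - t\<bar> * W1p_norm p (\<lambda>x. ?q x + e' t x)"
    using W1p_norm_cmult[OF p W1p_add[OF p qW W(3)], of "s - t"] by simp
  also have "\<dots> \<le> ennreal \<bar>s - t\<bar> * (ennreal \<epsilon> + ennreal m)"
    using q[OF False] m by (intro mult_left_mono order_trans[OF W1p_norm_add[OF p qW W(3)]] add_mono) auto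
  also have "\<dots> = ennreal ((m + \<epsilon>) * \<bar>s - t\<bar>)" using nn by (simp add: mult.commute add.commute flip: ennreal_mult ennreal_plus)
  finally show ?thesis .
qed

lemma tendsto_0_ennreal_le:
  fixes f :: "real \<Rightarrow> ennreal"
  assumes "(f \<longlongrightarrow> 0) (at t within S)" "0 < \<epsilon>"
  obtains d where "0 < d" "\<And>s. s \<in> S \<Longrightarrow> s \<noteq> t \<Longrightarrow> \<bar>s - t\<bar> < d \<Longrightarrow> f s \<le> ennreal \<epsilon>"
proof -
  have "\<forall>\<^sub>F s in at t within S. f s < ennreal \<epsilon>" using assms by (intro order_tendstoD) auto
  then show thesis using that by (auto simp: eventually_at dist_real_def intro: less_imp_le)
qed

text \<open>With slack \<open>\<epsilon>\<close>, the bound holds on short intervals around each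
  point by differentiability and is additive over adjacent intervals; the \<open>Bolzano\<close>
  bisection principle makes it global. No integral of a curve with values in W^{1,p} is
  formed.\<close>

lemma W1p_mean_value:
  assumes p: "1 \<le> p" and e: "W1p_has_derivative p T e e'" and ab: "0 \<le> a" "a \<le> b" "b \<le> T"
    and m: "\<And>s. s \<in> {a..b} \<Longrightarrow> W1p_norm p (e' s) \<le> ennreal m" "0 \<le> m"
  shows "W1p_norm p (\<lambda>x. e b x - e a x) \<le> ennreal (m * (b - a))"
proof -
  have W: "e s \<in> W1p p" "e' s \<in> W1p p" if "s \<in> {0..T}" for s using e that by (auto simp: W1p_has_derivative_def)
  have eps: "W1p_norm p (\<lambda>x. e b x - e a x) \<le> ennreal ((m + \<epsilon>) * (b - a))" if \<epsilon>: "\<epsilon> > 0" for \<epsilon>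
  proof -
    define P where "P c d \<longleftrightarrow> (a \<le> c \<longrightarrow> c \<le> d \<longrightarrow> d \<le> b \<longrightarrow>
      W1p_norm p (\<lambda>x. e d x - e c x) \<le> ennreal ((m + \<epsilon>) * (d - c)))" for c d
    have "P a b" using ab(2)
    proof (induction rule: Bolzano)
      case (trans x y z)
      show ?case unfolding P_def
      proof (intro impI)
        assume *: "a \<le> x" "x \<le> z" "z \<le> b"
        have "W1p_norm p (\<lambda>v. e z v - e x v) \<le> W1p_norm p (\<lambda>v. e z v - e y v) + W1p_norm p (\<lambda>v. e y v - e x v)"
          using * trans ab by (intro W1p_norm_triangle3 p W) auto
        also have "\<dots> \<le> ennreal ((m + \<epsilon>) * (z - y)) + ennreal ((m + \<epsilon>) * (y - x))"
          using * trans by (intro add_mono) (auto simp: P_def)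
        also have "\<dots> = ennreal ((m + \<epsilon>) * (z - y) + (m + \<epsilon>) * (y - x))"
          using * trans m(2) \<epsilon> by (intro ennreal_plus[symmetric] mult_nonneg_nonneg) auto
        also have "(m + \<epsilon>) * (z - y) + (m + \<epsilon>) * (y - x) = (m + \<epsilon>) * (z - x)" by (simp add: algebra_simps)
        finally show "W1p_norm p (\<lambda>v. e z v - e x v) \<le> ennreal ((m + \<epsilon>) * (z - x))" .
      qed
    next
      case (local x)
      then have xT: "x \<in> {0..T}" using ab by auto
      obtain d where d: "0 < d" "\<And>s. s \<in> {0..T} \<Longrightarrow> s \<noteq> x \<Longrightarrow> \<bar>s - x\<bar> < d \<Longrightarrow>
        W1p_norm p (\<lambda>v. (e s v - e x v) / (s - x) - e' x v) \<le> ennreal \<epsilon>"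
        using tendsto_0_ennreal_le[of "\<lambda>s. W1p_norm p (\<lambda>v. (e s v - e x v) / (s - x) - e' x v)" x "{0..T}" \<epsilon>] e xT \<epsilon>
        by (auto simp: W1p_has_derivative_def)
      have one: "W1p_norm p (\<lambda>v. e s v - e x v) \<le> ennreal ((m + \<epsilon>) * \<bar>s - x\<bar>)" if "s \<in> {0..T}" "\<bar>s - x\<bar> < d" for s
        using that d(2) m local \<epsilon> by (intro W1p_increment_le[OF p e that(1) xT]) auto
      \<comment> \<open>The derivative at \<open>x\<close> controls increments starting from
        \<open>x\<close> only, so the interval is split there.\<close>
      have "P c y" if c: "c \<le> x" "x \<le> y" "y - c < d" for c y
        unfolding P_def
      proof (intro impI)
        assume *: "a \<le> c" "c \<le> y" "y \<le> b"
        then have T: "c \<in> {0..T}" "y \<in> {0..T}" using ab by auto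
        have "W1p_norm p (\<lambda>v. e y v - e c v) \<le> W1p_norm p (\<lambda>v. e y v - e x v) + W1p_norm p (\<lambda>v. e x v - e c v)"
          by (intro W1p_norm_triangle3 p W T xT)
        also have "W1p_norm p (\<lambda>v. e x v - e c v) = W1p_norm p (\<lambda>v. e c v - e x v)"
          by (intro W1p_norm_commute p W T xT)
        also have "W1p_norm p (\<lambda>v. e y v - e x v) + \<dots> \<le> ennreal ((m + \<epsilon>) * \<bar>y - x\<bar>) + ennreal ((m + \<epsilon>) * \<bar>c - x\<bar>)"
          using c by (intro add_mono one T) auto
        also have "\<dots> = ennreal ((m + \<epsilon>) * \<bar>y - x\<bar> + (m + \<epsilon>) * \<bar>c - x\<bar>)"
          using m(2) \<epsilon> by (intro ennreal_plus[symmetric] mult_nonneg_nonneg) auto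
        also have "(m + \<epsilon>) * \<bar>y - x\<bar> + (m + \<epsilon>) * \<bar>c - x\<bar> = (m + \<epsilon>) * (y - c)"
          using c by (simp add: algebra_simps)
        finally show "W1p_norm p (\<lambda>v. e y v - e c v) \<le> ennreal ((m + \<epsilon>) * (y - c))" .
      qed
      then show ?case using d(1) by blast
    qed
    then show ?thesis using ab by (simp add: P_def)
  qed
  show ?thesis
  proof (rule ennreal_le_epsilon)
    fix \<delta> :: real assume \<delta>: "\<delta> > 0"
    \<comment> \<open>The added 1 keeps the denominator positive when \<open>a = b\<close>.\<close>
    define \<epsilon> where "\<epsilon> = \<delta> / (b - a + 1)"
    have \<epsilon>: "\<epsilon> > 0" "\<epsilon> * (b - a) \<le> \<delta>" using \<delta> ab by (auto simp: \<epsilon>_def field_simps)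
    have "ennreal ((m + \<epsilon>) * (b - a)) \<le> ennreal (m * (b - a)) + ennreal \<delta>"
      using ab m(2) \<epsilon> \<delta> by (subst ennreal_plus[symmetric]) (auto simp: distrib_right intro!: ennreal_leI)
    with eps[OF \<epsilon>(1)] show "W1p_norm p (\<lambda>x. e b x - e a x) \<le> ennreal (m * (b - a)) + ennreal \<delta>"
      by (rule order_trans)
  qed
qed

lemma W1p_norm_real:
  assumes "1 \<le> p" "f \<in> W1p p" shows "W1p_norm p f = ennreal (enn2real (W1p_norm p f))"
  using W1p_norm_finite[OF assms] by simp

text \<open>Boundedness of the difference quotients near \<open>t\<close> gives a linear bound on
  the change of the norm; this continuity is what \<open>first_exit\<close> requires.\<close>

lemma W1p_norm_continuous:
  assumes p: "1 \<le> p" and e: "W1p_has_derivative p T e e'"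
  shows "continuous_on {0..T} (\<lambda>t. enn2real (W1p_norm p (e t)))"
  unfolding continuous_on_def
proof
  fix t assume t: "t \<in> {0..T}"
  have W: "e s \<in> W1p p" "e' s \<in> W1p p" if "s \<in> {0..T}" for s using e that by (auto simp: W1p_has_derivative_def)
  obtain d where d: "0 < d" "\<And>s. s \<in> {0..T} \<Longrightarrow> s \<noteq> t \<Longrightarrow> \<bar>s - t\<bar> < d \<Longrightarrow>
    W1p_norm p (\<lambda>v. (e s v - e t v) / (s - t) - e' t v) \<le> ennreal 1"
    using tendsto_0_ennreal_le[of "\<lambda>s. W1p_norm p (\<lambda>v. (e s v - e t v) / (s - t) - e' t v)" t "{0..T}" 1] e t
    by (auto simp: W1p_has_derivative_def)
  define m where "m = enn2real (W1p_norm p (e' t))"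
  let ?\<theta> = "\<lambda>t. enn2real (W1p_norm p (e t))"
  have le: "\<bar>?\<theta> s - ?\<theta> t\<bar> \<le> (m + 1) * \<bar>s - t\<bar>" if s: "s \<in> {0..T}" "\<bar>s - t\<bar> < d" for s
  proof -
    have inc: "W1p_norm p (\<lambda>x. e s x - e t x) \<le> ennreal ((m + 1) * \<bar>s - t\<bar>)"
      using s d(2) W1p_norm_real[OF p W(2)[OF t]] by (intro W1p_increment_le[OF p e s(1) t]) (auto simp: m_def)
    have 1: "ennreal (?\<theta> s) \<le> ennreal (?\<theta> t) + ennreal ((m + 1) * \<bar>s - t\<bar>)"
      using order_trans[OF W1p_norm_le_diff[OF p W(1)[OF s(1)] W(1)[OF t]] add_left_mono[OF inc]]
      unfolding W1p_norm_real[OF p W(1)[OF s(1)], symmetric] W1p_norm_real[OF p W(1)[OF t], symmetric] .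
    have 2: "ennreal (?\<theta> t) \<le> ennreal (?\<theta> s) + ennreal ((m + 1) * \<bar>s - t\<bar>)"
      using order_trans[OF W1p_norm_le_diff[OF p W(1)[OF t] W(1)[OF s(1)]]
          add_left_mono[OF inc[unfolded W1p_norm_commute[OF p W(1)[OF s(1)] W(1)[OF t]]]]]
      unfolding W1p_norm_real[OF p W(1)[OF s(1)], symmetric] W1p_norm_real[OF p W(1)[OF t], symmetric] .
    have "0 \<le> (m + 1) * \<bar>s - t\<bar>" by (simp add: m_def)
    with 1 2 have "?\<theta> s \<le> ?\<theta> t + (m + 1) * \<bar>s - t\<bar>" "?\<theta> t \<le> ?\<theta> s + (m + 1) * \<bar>s - t\<bar>"
      by (simp_all del: ennreal_enn2real_if flip: ennreal_plus)
    then show ?thesis by linarith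
  qed
  have "((\<lambda>s. (m + 1) * \<bar>s - t\<bar>) \<longlongrightarrow> (m + 1) * \<bar>t - t\<bar>) (at t within {0..T})" by (intro tendsto_intros)
  then have "((\<lambda>s. (m + 1) * \<bar>s - t\<bar>) \<longlongrightarrow> 0) (at t within {0..T})" by simp
  then have "((\<lambda>s. ?\<theta> s - ?\<theta> t) \<longlongrightarrow> 0) (at t within {0..T})"
  proof (rule Lim_null_comparison[rotated])
    show "\<forall>\<^sub>F s in at t within {0..T}. norm (?\<theta> s - ?\<theta> t) \<le> (m + 1) * \<bar>s - t\<bar>"
      unfolding eventually_at using d(1) le by (intro exI[of _ d]) (auto simp: dist_real_def)
  qed
  then show "(?\<theta> \<longlongrightarrow> ?\<theta> t) (at t within {0..T})" by (simp add: LIM_zero_iff)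
qed

lemma W1p_sup:
  assumes p: "1 \<le> p" and F: "primitive F g"
    and N: "eLp p (\<lambda>x. ennreal \<bar>F x\<bar>) + eLp p (\<lambda>x. ennreal \<bar>g x\<bar>) \<le> ennreal r" and r: "0 \<le> r"
  shows "\<bar>F x\<bar> \<le> r"
  using order_trans[OF primitive_sup_bound[OF p F, of x] N] r by (subst (asm) ennreal_le_iff) auto

lemma W1p_norm_eq_0:
  assumes p: "1 \<le> p" and f: "f \<in> W1p p" and 0: "W1p_norm p f = 0"
  shows "AE x in lborel. f x = 0"
proof -
  obtain F g where F: "primitive F g" "AE x in lborel. f x = F x"
    "W1p_norm p f = eLp p (\<lambda>x. ennreal \<bar>F x\<bar>) + eLp p (\<lambda>x. ennreal \<bar>g x\<bar>)"
    using W1p_primitiveE[OF p f] by metis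
  have "\<bar>F x\<bar> \<le> 0" for x using F(3) 0 by (intro W1p_sup[OF p F(1)]) auto
  then show ?thesis using F(2) by simp
qed

context nonlinearity begin

text \<open>The equation is posed for arbitrary representatives, while the estimates are about
  continuous ones. At a point where \<open>u\<close> and \<open>F\<close> agree, the integrands
  agree for almost every \<open>y\<close>.\<close>

lemma force_cong_AE:
  assumes [measurable]: "u \<in> borel_measurable borel" "F \<in> borel_measurable borel" and eq: "AE x in lborel. u x = F x"
  shows "AE x in lborel. (\<integral>y. \<alpha> (y - x) * w (u y - u x) \<partial>lborel) = force \<alpha> w F x"
  using eq
proof eventually_elim
  case (elim x)
  have "(\<integral>y. \<alpha> (y - x) * w (u y - u x) \<partial>lborel) = (\<integral>y. \<alpha> (y - x) * w (F y - F x) \<partial>lborel)"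
    by (rule integral_cong_AE) (use eq elim in \<open>auto elim: eventually_mono\<close>)
  then show ?case by (simp add: force_eq)
qed

text \<open>For arbitrary solutions no common weight with
  \<open>abs_conv \<alpha> H \<le> C * H\<close> is at hand, so the increments are bounded by the
  weak derivatives themselves and the majorants are measured in L^p. The functions \<open>k\<close>
  and \<open>l\<close> stand for second time derivatives, known almost everywhere.\<close>

lemma force_W1p_Lipschitz:
  assumes p: "1 \<le> p" and M: "deriv_bound R M" and u: "u \<in> W1p p" "W1p_norm p u \<le> ennreal R"
    and v: "v \<in> W1p p" "W1p_norm p v \<le> ennreal R" and uv: "W1p_norm p (\<lambda>x. u x - v x) \<le> ennreal e" "0 \<le> e"
    and k: "k \<in> borel_measurable borel" "AE x in lborel. k x = (\<integral>y. \<alpha> (y - x) * w (u y - u x) \<partial>lborel)"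
    and l: "l \<in> borel_measurable borel" "AE x in lborel. l x = (\<integral>y. \<alpha> (y - x) * w (v y - v x) \<partial>lborel)"
  shows "W1p_norm p (\<lambda>x. k x - l x) \<le> ennreal (kappa R M * e)"
proof -
  have nn: "0 \<le> R" "0 \<le> M" "0 \<le> C" using M abs_conv_bound_pos[of \<alpha>] by (auto simp: deriv_bound_def)
  obtain F g where F: "primitive F g" "AE x in lborel. u x = F x"
    "W1p_norm p u = eLp p (\<lambda>x. ennreal \<bar>F x\<bar>) + eLp p (\<lambda>x. ennreal \<bar>g x\<bar>)"
    using W1p_primitiveE[OF p u(1)] by metis
  obtain G h where G: "primitive G h" "AE x in lborel. v x = G x"
    "W1p_norm p v = eLp p (\<lambda>x. ennreal \<bar>G x\<bar>) + eLp p (\<lambda>x. ennreal \<bar>h x\<bar>)"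
    using W1p_primitiveE[OF p v(1)] by metis
  have [measurable]: "u \<in> borel_measurable borel" "v \<in> borel_measurable borel"
    "k \<in> borel_measurable borel" "l \<in> borel_measurable borel" using u v k l W1p_measurable by auto
  have [measurable]: "F \<in> borel_measurable borel" "G \<in> borel_measurable borel"
    using primitive_continuous F(1) G(1) by (auto intro: borel_measurable_continuous_onI)
  have [measurable]: "g \<in> borel_measurable borel" "h \<in> borel_measurable borel"
    using loc_integrable_measurable F(1) G(1) by (auto simp: primitive_def)
  have bF: "\<bar>F x\<bar> \<le> R" and bG: "\<bar>G x\<bar> \<le> R" for x
    using u v F(3) G(3) nn by (intro W1p_sup[OF p F(1)] W1p_sup[OF p G(1)]; simp)+
  have P: "primitive (\<lambda>x. F x - G x) (\<lambda>x. g x - h x)"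
    using F(1) G(1) by (auto simp: primitive_def loc_integrable_diff loc_integrable_integrable_on
        Henstock_Kurzweil_Integration.integral_diff algebra_simps)
  have N: "W1p_norm p (\<lambda>x. u x - v x) = eLp p (\<lambda>x. ennreal \<bar>F x - G x\<bar>) + eLp p (\<lambda>x. ennreal \<bar>g x - h x\<bar>)"
    using F(2) G(2) by (intro W1p_primitiveI(1)[OF p P]) (auto elim: eventually_elim2)
  have bd: "\<bar>F x - G x\<bar> \<le> e" for x using uv N by (intro W1p_sup[OF p P]) auto
  define E where "E x = ennreal \<bar>g x - h x\<bar>" for x
  \<comment> \<open>A common majorant for the increments of both representatives, as
    \<open>force_diff_incr\<close> demands; its norm is at most \<open>2 * R\<close>.\<close>
  define Q where "Q x = ennreal \<bar>g x\<bar> + ennreal \<bar>h x\<bar>" for x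
  have [measurable]: "E \<in> borel_measurable borel" "Q \<in> borel_measurable borel" unfolding E_def Q_def by measurable
  define G1 where "G1 x = ennreal M * abs_conv \<alpha> E x + ennreal (4 * M * e) * abs_conv \<alpha> Q x" for x
  define G0 where "G0 x = ennreal M * abs_conv \<alpha> (\<lambda>x. ennreal \<bar>F x - G x\<bar>) x" for x
  have [measurable]: "G1 \<in> borel_measurable borel" unfolding G1_def by measurable
  have inc: "incr (\<lambda>x. force \<alpha> w F x - force \<alpha> w G x) G1"
    unfolding G1_def
  proof (rule force_diff_incr[OF M])
    show "incr F Q" by (rule incr_mono[OF primitive_incr[OF F(1)]]) (simp add: Q_def)
    show "incr G Q" by (rule incr_mono[OF primitive_incr[OF G(1)]]) (simp add: Q_def)
    show "incr (\<lambda>x. F x - G x) E" using primitive_incr[OF P] by (simp add: E_def[abs_def])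
  qed (use bF bG bd in auto)
  have A: "eLp p (\<lambda>x. ennreal c * abs_conv \<alpha> f x) \<le> ennreal (c * (C / 2)) * eLp p f"
    if [measurable]: "f \<in> borel_measurable borel" and "0 \<le> c" for f c
  proof -
    have "eLp p (\<lambda>x. ennreal c * abs_conv \<alpha> f x) \<le> ennreal c * eLp p (abs_conv \<alpha> f)" by (intro eLp_cmult p) measurable
    also have "\<dots> \<le> ennreal c * (ennreal (C / 2) * eLp p f)" by (intro mult_left_mono abs_conv_eLp_abs_conv_bound p \<alpha>) auto
    also have "\<dots> = ennreal (c * (C / 2)) * eLp p f" using that nn by (simp add: mult.assoc[symmetric] flip: ennreal_mult)
    finally show ?thesis .
  qed
  have fg: "eLp p Q \<le> ennreal (2 * R)"
  proof -
    have "eLp p Q \<le> eLp p (\<lambda>x. ennreal \<bar>g x\<bar>) + eLp p (\<lambda>x. ennreal \<bar>h x\<bar>)"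
      unfolding Q_def by (intro eLp_add p) measurable
    also have "\<dots> \<le> W1p_norm p u + W1p_norm p v" unfolding F(3) G(3) by (intro add_mono) auto
    also have "\<dots> \<le> ennreal R + ennreal R" by (intro add_mono u v)
    also have "\<dots> = ennreal (2 * R)" using nn by (simp flip: ennreal_plus)
    finally show ?thesis .
  qed
  have e0: "eLp p (\<lambda>x. ennreal \<bar>F x - G x\<bar>) \<le> ennreal e" and e1: "eLp p E \<le> ennreal e"
    using uv(1) unfolding N E_def by (auto intro: order_trans[rotated])
  have n0: "eLp p G0 \<le> ennreal (M * (C / 2) * e)"
    using order_trans[OF A[of "\<lambda>x. ennreal \<bar>F x - G x\<bar>" M] mult_left_mono[OF e0]] nn uv(2)
    by (simp add: G0_def[abs_def] flip: ennreal_mult)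
  have n1: "eLp p G1 \<le> ennreal (M * (C / 2) * e + 4 * M * e * (C / 2) * (2 * R))"
  proof -
    have "eLp p G1 \<le> eLp p (\<lambda>x. ennreal M * abs_conv \<alpha> E x) + eLp p (\<lambda>x. ennreal (4 * M * e) * abs_conv \<alpha> Q x)"
      unfolding G1_def by (intro eLp_add p) measurable
    also have "\<dots> \<le> ennreal (M * (C / 2)) * eLp p E + ennreal (4 * M * e * (C / 2)) * eLp p Q"
      using nn uv(2) by (intro add_mono A) auto
    also have "\<dots> \<le> ennreal (M * (C / 2)) * ennreal e + ennreal (4 * M * e * (C / 2)) * ennreal (2 * R)"
      by (intro add_mono mult_left_mono e1 fg) auto
    also have "\<dots> = ennreal (M * (C / 2) * e + 4 * M * e * (C / 2) * (2 * R))"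
      using nn uv(2) by (simp flip: ennreal_mult ennreal_plus)
    finally show ?thesis .
  qed
  have lf: "loc_finite G1" by (rule eLp_loc_finite[OF p]) (auto intro: le_less_trans[OF n1])
  have AEk: "AE x in lborel. k x - l x = force \<alpha> w F x - force \<alpha> w G x"
  proof -
    have "AE x in lborel. (\<integral>y. \<alpha> (y - x) * w (u y - u x) \<partial>lborel) = force \<alpha> w F x"
      "AE x in lborel. (\<integral>y. \<alpha> (y - x) * w (v y - v x) \<partial>lborel) = force \<alpha> w G x"
      by (intro force_cong_AE F(2) G(2); measurable)+
    with k(2) l(2) show ?thesis by eventually_elim simp
  qed
  have "AE x in lborel. ennreal \<bar>force \<alpha> w F x - force \<alpha> w G x\<bar> \<le> G0 x"
    unfolding G0_def using bF bG by (intro AE_I2 force_diff_bound[OF M]) auto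
  then have "W1p_norm p (\<lambda>x. k x - l x) \<le> eLp p G0 + eLp p G1"
    by (intro W1p_dominated(1)[OF p _ AEk _ inc lf]) measurable
  \<comment> \<open>The two halves of \<open>M * C * e\<close> come from the function and from its
    derivative; the last term is \<open>4 * M * R * C * e\<close>, so the sum is exactly
    \<open>kappa R M * e\<close>.\<close>
  also have "\<dots> \<le> ennreal (M * (C / 2) * e) + ennreal (M * (C / 2) * e + 4 * M * e * (C / 2) * (2 * R))"
    by (intro add_mono n0 n1)
  also have "\<dots> = ennreal (kappa R M * e)"
    using nn uv(2) by (subst ennreal_plus[symmetric]) (auto simp: kappa_def algebra_simps)
  finally show ?thesis .
qed

end

section \<open>Stability and well-posedness\<close>

lemma C2_W_has_derivative:
  "C2_W p T u u1 u2 \<Longrightarrow> W1p_has_derivative p T u u1" "C2_W p T u u1 u2 \<Longrightarrow> W1p_has_derivative p T u1 u2"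
  by (auto simp: C2_W_def W1p_has_derivative_def)

text \<open>A bootstrap: up to the first time at which the value is 1 the hypothesis of
  \<open>step\<close> holds, and \<open>step\<close> then makes that value smaller than 1. The
  intermediate value theorem guarantees that the level 1 is met before it is exceeded.\<close>

lemma first_exit:
  fixes \<theta> :: "real \<Rightarrow> real"
  assumes c: "continuous_on {0..T} \<theta>" and T: "0 \<le> T" and 0: "\<theta> 0 < 1"
    and step: "\<And>t0. t0 \<in> {0..T} \<Longrightarrow> (\<And>s. s \<in> {0..t0} \<Longrightarrow> \<theta> s \<le> 1) \<Longrightarrow> \<theta> t0 < 1"
    and t: "t \<in> {0..T}"
  shows "\<theta> t \<le> 1"
proof (rule ccontr)
  assume "\<not> \<theta> t \<le> 1"
  define B where "B = {s\<in>{0..T}. \<theta> s = 1}"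
  have ivt: "\<exists>r. 0 \<le> r \<and> r \<le> s \<and> \<theta> r = 1" if "s \<in> {0..T}" "\<theta> s \<ge> 1" for s
    using that 0 by (intro IVT' continuous_on_subset[OF c]) auto
  have "B \<noteq> {}" using ivt[OF t] \<open>\<not> \<theta> t \<le> 1\<close> t by (fastforce simp: B_def)
  moreover have "compact B"
  proof -
    have "closed ({0..T} \<inter> \<theta> -` {1})" by (rule continuous_closed_preimage[OF c]) auto
    moreover have "B = {0..T} \<inter> \<theta> -` {1}" by (auto simp: B_def)
    ultimately show ?thesis using compact_eq_bounded_closed bounded_subset[OF bounded_closed_interval, of B 0 T] by (auto simp: B_def)
  qed
  ultimately obtain t0 where t0: "t0 \<in> B" "\<And>s. s \<in> B \<Longrightarrow> t0 \<le> s" using compact_attains_inf by metis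
  have "\<theta> s \<le> 1" if "s \<in> {0..t0}" for s
  proof (rule ccontr)
    assume "\<not> \<theta> s \<le> 1"
    moreover have "s \<in> {0..T}" using that t0(1) by (auto simp: B_def)
    ultimately obtain r where r: "0 \<le> r" "r \<le> s" "\<theta> r = 1" using ivt[of s] by auto
    then have "r \<in> B" using that t0(1) by (auto simp: B_def)
    then have "s = t0" using t0(2)[of r] r that by auto
    then show False using \<open>\<not> \<theta> s \<le> 1\<close> t0(1) by (simp add: B_def)
  qed
  then show False using step[of t0] t0(1) by (auto simp: B_def)
qed

context nonlinearity begin

text \<open>Nothing bounds \<open>V\<close> a priori, so it is compared with \<open>U\<close> only
  as long as their distance is at most 1; both then stay in the ball of radius
  \<open>\<rho> + 1\<close>, where \<open>M\<close> applies. On such a time interval the distance is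
  at most \<open>2 * \<delta> < 1\<close>, and \<open>first_exit\<close> removes the
  restriction.\<close>

lemma stability:
  assumes p: "1 \<le> p" and M: "deriv_bound (\<rho> + 1) M" and \<rho>: "0 \<le> \<rho>"
    and T: "0 < T" "T \<le> 1" "T^2 * kappa (\<rho> + 1) M \<le> 1 / 2"
    and U: "is_solution p \<alpha> w T \<phi> \<psi> U" and V: "is_solution p \<alpha> w T \<phi>' \<psi>' V"
    and m: "\<phi> \<in> W1p p" "\<psi> \<in> W1p p" "\<phi>' \<in> W1p p" "\<psi>' \<in> W1p p"
    and bU: "\<And>t. t \<in> {0..T} \<Longrightarrow> W1p_norm p (U t) \<le> ennreal \<rho>"
    and d: "W1p_dist p \<phi>' \<phi> + W1p_dist p \<psi>' \<psi> \<le> ennreal \<delta>" "0 \<le> \<delta>" "2 * \<delta> < 1"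
    and t: "t \<in> {0..T}"
  shows "W1p_norm p (\<lambda>x. V t x - U t x) \<le> ennreal (2 * \<delta>)"
proof -
  obtain U1 U2 where CU: "C2_W p T U U1 U2"
    and eU: "\<And>t. t \<in> {0<..T} \<Longrightarrow> AE x in lborel. U2 t x = (\<integral>y. \<alpha> (y - x) * w (U t y - U t x) \<partial>lborel)"
    and iU: "AE x in lborel. U 0 x = \<phi> x" "AE x in lborel. U1 0 x = \<psi> x"
    using U by (auto simp: is_solution_def)
  obtain V1 V2 where CV: "C2_W p T V V1 V2"
    and eV: "\<And>t. t \<in> {0<..T} \<Longrightarrow> AE x in lborel. V2 t x = (\<integral>y. \<alpha> (y - x) * w (V t y - V t x) \<partial>lborel)"
    and iV: "AE x in lborel. V 0 x = \<phi>' x" "AE x in lborel. V1 0 x = \<psi>' x"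
    using V by (auto simp: is_solution_def)
  define e e1 e2 where "e t x = V t x - U t x" and "e1 t x = V1 t x - U1 t x" and "e2 t x = V2 t x - U2 t x" for t x
  have WU: "U t \<in> W1p p" "U1 t \<in> W1p p" "U2 t \<in> W1p p" and WV: "V t \<in> W1p p" "V1 t \<in> W1p p" "V2 t \<in> W1p p"
    if "t \<in> {0..T}" for t using CU CV that by (auto simp: C2_W_def)
  have We: "e t \<in> W1p p" "e1 t \<in> W1p p" "e2 t \<in> W1p p" if "t \<in> {0..T}" for t
    using WU[OF that] WV[OF that] by (auto simp: e_def[abs_def] e1_def[abs_def] e2_def[abs_def] intro: W1p_diff[OF p])
  have De: "W1p_has_derivative p T e e1" and De1: "W1p_has_derivative p T e1 e2"
    unfolding e_def[abs_def] e1_def[abs_def] e2_def[abs_def]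
    by (intro W1p_has_derivative_diff[OF p] C2_W_has_derivative[OF CU] C2_W_has_derivative[OF CV])+
  define \<theta> where "\<theta> t = enn2real (W1p_norm p (e t))" for t
  have N\<theta>: "W1p_norm p (e t) = ennreal (\<theta> t)" if "t \<in> {0..T}" for t
    unfolding \<theta>_def by (rule W1p_norm_real[OF p We(1)[OF that]])
  have \<theta>0: "0 \<le> \<theta> t" for t by (simp add: \<theta>_def)
  have c\<theta>: "continuous_on {0..T} \<theta>" unfolding \<theta>_def by (rule W1p_norm_continuous[OF p De])
  have T0: "0 \<in> {0..T}" using T by simp
  define d0 d1 where "d0 = enn2real (W1p_norm p (e 0))" and "d1 = enn2real (W1p_norm p (e1 0))"
  have Nd: "W1p_norm p (e 0) = ennreal d0" "W1p_norm p (e1 0) = ennreal d1" "0 \<le> d0" "0 \<le> d1"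
    unfolding d0_def d1_def using W1p_norm_real[OF p] We[OF T0] by auto
  have "d0 + d1 \<le> \<delta>"
  proof -
    have "AE x in lborel. \<phi>' x - \<phi> x = e 0 x" "AE x in lborel. \<psi>' x - \<psi> x = e1 0 x"
      using iU iV by (auto simp: e_def e1_def elim: eventually_elim2)
    then have "W1p_norm p (e 0) = W1p_dist p \<phi>' \<phi>" "W1p_norm p (e1 0) = W1p_dist p \<psi>' \<psi>"
      using We[OF T0] m unfolding W1p_dist_def
      by (auto intro!: W1p_cong_AE(2)[OF p] W1p_diff[OF p] W1p_measurable)
    then have "ennreal d0 + ennreal d1 \<le> ennreal \<delta>" using d(1) Nd by simp
    then show ?thesis using Nd d(2) by (simp flip: ennreal_plus)
  qed
  let ?k = "kappa (\<rho> + 1) M"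
  have k0: "0 \<le> ?k" by (rule kappa_nonneg[OF M])
  have step: "\<theta> t0 \<le> 2 * \<delta>" if t0: "t0 \<in> {0..T}" and le1: "\<And>s. s \<in> {0..t0} \<Longrightarrow> \<theta> s \<le> 1" for t0
  proof -
    have "compact {0..t0}" "{0..t0} \<noteq> {}" "continuous_on {0..t0} \<theta>"
      using t0 by (auto intro: continuous_on_subset[OF c\<theta>])
    then obtain tm where tm: "tm \<in> {0..t0}" "\<And>s. s \<in> {0..t0} \<Longrightarrow> \<theta> s \<le> \<theta> tm"
      using continuous_attains_sup[of "{0..t0}" \<theta>] by blast
    \<comment> \<open>The largest distance on \<open>[0, t0]\<close>; bounding it by half of itself
      plus \<open>\<delta>\<close> replaces a Gronwall inequality.\<close>
    define S where "S = \<theta> tm"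
    have S0: "0 \<le> S" by (simp add: S_def \<theta>0)
    have e2_pos: "W1p_norm p (e2 s) \<le> ennreal (?k * S)" if s: "s \<in> {0<..t0}" for s
    proof -
      have sT: "s \<in> {0..T}" "s \<in> {0<..T}" using s t0 by auto
      have "W1p_norm p (V s) \<le> W1p_norm p (U s) + W1p_norm p (e s)"
        unfolding e_def[abs_def] by (intro W1p_norm_le_diff p WU WV sT)
      also have "\<dots> \<le> ennreal \<rho> + ennreal 1"
        using bU[OF sT(1)] N\<theta>[OF sT(1)] le1[of s] s by (intro add_mono) (auto simp flip: ennreal_1 intro: ennreal_leI)
      also have "\<dots> = ennreal (\<rho> + 1)" using \<rho> by simp
      finally have NV: "W1p_norm p (V s) \<le> ennreal (\<rho> + 1)" .
      have NU: "W1p_norm p (U s) \<le> ennreal (\<rho> + 1)"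
        using order_trans[OF bU[OF sT(1)] ennreal_leI[of \<rho> "\<rho> + 1"]] by simp
      have Ne: "W1p_norm p (\<lambda>x. V s x - U s x) \<le> ennreal S"
        using N\<theta>[OF sT(1)] tm(2)[of s] s by (simp add: e_def[abs_def] S_def ennreal_leI)
      show ?thesis
        unfolding e2_def[abs_def]
        by (rule force_W1p_Lipschitz[OF p M WV(1)[OF sT(1)] NV WU(1)[OF sT(1)] NU Ne S0
              W1p_measurable[OF WV(3)[OF sT(1)]] eV[OF sT(2)] W1p_measurable[OF WU(3)[OF sT(1)]] eU[OF sT(2)]])
    qed
    \<comment> \<open>The equation is imposed for positive times only. The value at time 0 follows
      from continuity of the second derivatives in norm, through a small positive time
      \<open>r \<le> t0\<close>.\<close>
    have e2_bound: "W1p_norm p (e2 s) \<le> ennreal (?k * S)" if s: "s \<in> {0..t0}" and "0 < t0" for s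
    proof (cases "s = 0")
      case False
      then show ?thesis using e2_pos s by simp
    next
      case True
      show ?thesis
      proof (rule ennreal_le_epsilon)
        fix \<epsilon> :: real assume \<epsilon>: "\<epsilon> > 0"
        have lim: "((\<lambda>s. W1p_dist p (V2 s) (V2 0) + W1p_dist p (U2 s) (U2 0)) \<longlongrightarrow> 0 + 0) (at 0 within {0..T})"
          using CU CV T0 by (intro tendsto_add) (auto simp: C2_W_def)
        then have lim: "((\<lambda>s. W1p_dist p (V2 s) (V2 0) + W1p_dist p (U2 s) (U2 0)) \<longlongrightarrow> 0) (at 0 within {0..T})" by simp
        obtain \<eta> where \<eta>: "0 < \<eta>" "\<And>s. s \<in> {0..T} \<Longrightarrow> s \<noteq> 0 \<Longrightarrow> \<bar>s - 0\<bar> < \<eta> \<Longrightarrow>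
            W1p_dist p (V2 s) (V2 0) + W1p_dist p (U2 s) (U2 0) \<le> ennreal \<epsilon>"
          by (rule tendsto_0_ennreal_le[OF lim \<epsilon>]) blast
        define r where "r = min (\<eta> / 2) t0"
        have r: "r \<in> {0<..t0}" "r \<in> {0..T}" "r \<noteq> 0" "\<bar>r - 0\<bar> < \<eta>" using \<eta>(1) \<open>0 < t0\<close> t0 by (auto simp: r_def)
        have "W1p_norm p (e2 0) \<le> W1p_norm p (e2 r) + W1p_norm p (\<lambda>x. e2 0 x - e2 r x)"
          by (intro W1p_norm_le_diff p We T0 r)
        also have "W1p_norm p (\<lambda>x. e2 0 x - e2 r x) = W1p_norm p (\<lambda>x. e2 r x - e2 0 x)"
          by (intro W1p_norm_commute p We T0 r)
        also have "(\<lambda>x. e2 r x - e2 0 x) = (\<lambda>x. (V2 r x - V2 0 x) - (U2 r x - U2 0 x))" by (simp add: e2_def fun_eq_iff)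
        also have "W1p_norm p (\<lambda>x. (V2 r x - V2 0 x) - (U2 r x - U2 0 x)) \<le> ennreal \<epsilon>"
          unfolding W1p_dist_def[symmetric]
          using \<eta>(2)[OF r(2-4)] unfolding W1p_dist_def
          by (intro order_trans[OF W1p_norm_diff[OF p W1p_diff[OF p] W1p_diff[OF p]]] WU WV T0 r)
        finally have "W1p_norm p (e2 0) \<le> W1p_norm p (e2 r) + ennreal \<epsilon>" by (simp add: add_left_mono)
        also have "\<dots> \<le> ennreal (?k * S) + ennreal \<epsilon>" by (intro add_right_mono e2_pos r)
        finally show "W1p_norm p (e2 s) \<le> ennreal (?k * S) + ennreal \<epsilon>" using True by simp
      qed
    qed
    show ?thesis
    proof (cases "t0 = 0")
      case True
      then show ?thesis using \<open>d0 + d1 \<le> \<delta>\<close> Nd(3,4) d(2) unfolding \<theta>_def True d0_def[symmetric] by simp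
    next
      case False
      then have tp: "0 < t0" using t0 by simp
      have kS: "0 \<le> ?k * S" using k0 S0 by simp
      have e1_bound: "W1p_norm p (e1 s) \<le> ennreal (d1 + ?k * S * T)" if s: "s \<in> {0..t0}" for s
      proof -
        have sT: "s \<in> {0..T}" using s t0 by auto
        have "W1p_norm p (e1 s) \<le> W1p_norm p (e1 0) + W1p_norm p (\<lambda>x. e1 s x - e1 0 x)"
          by (intro W1p_norm_le_diff p We T0 sT)
        also have "\<dots> \<le> ennreal d1 + ennreal (?k * S * (s - 0))"
          using s sT by (intro add_mono W1p_mean_value[OF p De1] e2_bound tp kS) (auto simp: Nd)
        also have "\<dots> \<le> ennreal d1 + ennreal (?k * S * T)"
          using s sT kS by (intro add_left_mono ennreal_leI mult_left_mono) auto
        also have "\<dots> = ennreal (d1 + ?k * S * T)" using Nd kS T by (intro ennreal_plus[symmetric]) auto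
        finally show ?thesis .
      qed
      have n: "0 \<le> d1 + ?k * S * T" using Nd kS T by simp
      have tmT: "tm \<in> {0..T}" using tm(1) t0 by auto
      have "W1p_norm p (e tm) \<le> W1p_norm p (e 0) + W1p_norm p (\<lambda>x. e tm x - e 0 x)"
        by (intro W1p_norm_le_diff p We T0 tmT)
      also have "\<dots> \<le> ennreal d0 + ennreal ((d1 + ?k * S * T) * (tm - 0))"
        using tm(1) tmT by (intro add_mono W1p_mean_value[OF p De] e1_bound n) (auto simp: Nd)
      also have "\<dots> = ennreal (d0 + (d1 + ?k * S * T) * tm)"
        using Nd n tmT by (simp add: ennreal_plus)
      finally have "S \<le> d0 + (d1 + ?k * S * T) * tm"
        using N\<theta>[OF tmT] Nd n tmT by (simp add: S_def del: ennreal_plus)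
      also have "\<dots> \<le> d0 + (d1 + ?k * S * T) * T"
        using n tmT by (intro add_left_mono mult_left_mono) auto
      also have "\<dots> = d0 + d1 * T + (T^2 * ?k) * S" by (simp add: algebra_simps power2_eq_square)
      \<comment> \<open>Here \<open>T^2 * kappa\<close> is at most 1/2, so half of \<open>S\<close>
        is absorbed into the left-hand side.\<close>
      also have "\<dots> \<le> d0 + d1 * 1 + (1 / 2) * S"
        using Nd T S0 by (intro add_mono mult_left_mono mult_right_mono) auto
      finally have "S \<le> 2 * \<delta>" using \<open>d0 + d1 \<le> \<delta>\<close> by simp
      then show ?thesis using tm(2)[of t0] t0 by (simp add: S_def)
    qed
  qed
  have le1: "\<theta> s \<le> 1" if "s \<in> {0..T}" for s
  proof (rule first_exit[OF c\<theta> _ _ _ that])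
    show "\<theta> 0 < 1" using \<open>d0 + d1 \<le> \<delta>\<close> Nd(3,4) d unfolding \<theta>_def d0_def[symmetric] by simp
    show "\<theta> t0 < 1" if "t0 \<in> {0..T}" "\<And>s. s \<in> {0..t0} \<Longrightarrow> \<theta> s \<le> 1" for t0
      using step[OF that] d(3) by simp
  qed (use T in simp)
  have "\<theta> t \<le> 2 * \<delta>" using t by (intro step le1) auto
  then show ?thesis using N\<theta>[OF t] by (simp add: e_def[abs_def] ennreal_leI)
qed

text \<open>The time \<open>T\<close> depends on the data only through the bound \<open>r\<close>,
  so one \<open>T\<close> serves all nearby data. The bound \<open>16 * r\<close> is
  \<open>4 * 2 * (2 * r)\<close>: weight constant 4, the factor 2 of \<open>dominated_W1p\<close>,
  and \<open>eLp p H \<le> 2 * r\<close>. The radius \<open>16 * r + 1\<close> is the one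
  \<open>stability\<close> uses for \<open>\<rho> = 16 * r\<close>.\<close>

lemma solution_of_bounded_data:
  assumes p: "1 \<le> p" and r: "0 \<le> r" and M: "deriv_bound (16 * r + 1) M"
    and T: "0 < T" "T \<le> 1" "T^2 * kappa (16 * r + 1) M \<le> 1 / 2"
    and W: "\<phi> \<in> W1p p" "\<psi> \<in> W1p p" and N: "W1p_norm p \<phi> + W1p_norm p \<psi> \<le> ennreal r"
  shows "\<exists>U. is_solution p \<alpha> w T \<phi> \<psi> U \<and> (\<forall>t. W1p_norm p (U t) \<le> ennreal (16 * r))"
proof -
  obtain F f where F: "primitive F f" "AE x in lborel. \<phi> x = F x"
    "W1p_norm p \<phi> = eLp p (\<lambda>x. ennreal \<bar>F x\<bar>) + eLp p (\<lambda>x. ennreal \<bar>f x\<bar>)"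
    using W1p_primitiveE[OF p W(1)] by metis
  obtain G g where G: "primitive G g" "AE x in lborel. \<psi> x = G x"
    "W1p_norm p \<psi> = eLp p (\<lambda>x. ennreal \<bar>G x\<bar>) + eLp p (\<lambda>x. ennreal \<bar>g x\<bar>)"
    using W1p_primitiveE[OF p W(2)] by metis
  have [measurable]: "F \<in> borel_measurable borel" "G \<in> borel_measurable borel"
    using primitive_continuous F(1) G(1) by (auto intro: borel_measurable_continuous_onI)
  have [measurable]: "f \<in> borel_measurable borel" "g \<in> borel_measurable borel"
    using loc_integrable_measurable F(1) G(1) by (auto simp: primitive_def)
  \<comment> \<open>The sum dominates values and derivatives of both data, so a single weight with
    constant 1 works for \<open>F\<close> and \<open>G\<close>.\<close>
  define H0 where "H0 x = (ennreal \<bar>F x\<bar> + ennreal \<bar>f x\<bar>) + (ennreal \<bar>G x\<bar> + ennreal \<bar>g x\<bar>)" for x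
  have [measurable]: "H0 \<in> borel_measurable borel" unfolding H0_def by measurable
  have "eLp p H0 \<le> W1p_norm p \<phi> + W1p_norm p \<psi>"
    unfolding H0_def F(3) G(3)
    by (intro order_trans[OF eLp_add[OF p]] add_mono eLp_add p) measurable
  then have H0r: "eLp p H0 \<le> ennreal r" using N by (rule order_trans)
  obtain H where Hm: "H \<in> borel_measurable borel" and HH: "\<And>x. H0 x \<le> H x" and eH: "eLp p H \<le> 2 * eLp p H0"
    and AH: "\<And>x. abs_conv \<alpha> H x \<le> ennreal C * H x"
    by (rule majorant_exists[OF p \<alpha>, of H0]) measurable
  have "eLp p H \<le> 2 * ennreal r" using order_trans[OF eH mult_left_mono[OF H0r]] by simp
  then have Hr: "eLp p H \<le> ennreal (2 * r)" using r by (simp add: ennreal_mult)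
  then have Hfin: "eLp p H < top" by (rule le_less_trans) simp
  have le: "ennreal \<bar>F x\<bar> \<le> H0 x" "ennreal \<bar>f x\<bar> \<le> H0 x" "ennreal \<bar>G x\<bar> \<le> H0 x" "ennreal \<bar>g x\<bar> \<le> H0 x" for x
    unfolding H0_def by (auto intro: add_increasing add_increasing2)
  have dF: "dominated H 1 F" and dG: "dominated H 1 G"
    using order_trans[OF le(1) HH] order_trans[OF le(3) HH]
      incr_mono[OF primitive_incr[OF F(1)] order_trans[OF le(2) HH]]
      incr_mono[OF primitive_incr[OF G(1)] order_trans[OF le(4) HH]]
    by (auto simp: dominated_def)
  have nF: "W1p_norm p \<phi> \<le> ennreal r" and nG: "W1p_norm p \<psi> \<le> ennreal r"
    using N by (auto intro: order_trans[rotated])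
  have bF: "\<bar>F x\<bar> \<le> (16 * r + 1) / 4" and bG: "\<bar>G x\<bar> \<le> (16 * r + 1) / 4" for x
    using W1p_sup[OF p F(1) nF[unfolded F(3)] r, of x] W1p_sup[OF p G(1) nG[unfolded G(3)] r, of x] r by auto
  obtain U V where U: "C2_W p T U V (\<lambda>t. force \<alpha> w (U t))" "U 0 = F" "V 0 = G" "\<And>t. dominated H 4 (U t)"
    using solution_exists[OF M T primitive_continuous[OF F(1)] primitive_continuous[OF G(1)] bF bG Hm AH dF dG p Hfin]
    by blast
  have "is_solution p \<alpha> w T \<phi> \<psi> U"
    unfolding is_solution_def
    using U F(2) G(2) by (intro exI[of _ V] exI[of _ "\<lambda>t. force \<alpha> w (U t)"]) (auto simp: force_eq elim: eventually_mono)
  moreover have "W1p_norm p (U t) \<le> ennreal (16 * r)" for t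
  proof -
    have "W1p_norm p (U t) \<le> ennreal 4 * (2 * eLp p H)" by (rule dominated_W1p(2)[OF p Hm Hfin U(4)])
    also have "\<dots> \<le> ennreal 4 * (2 * ennreal (2 * r))" by (intro mult_left_mono Hr) auto
    also have "\<dots> = ennreal (16 * r)" using r by (simp add: ennreal_mult flip: mult.assoc)
    finally show ?thesis .
  qed
  ultimately show ?thesis by blast
qed

lemma exists_well_posed:
  assumes p: "1 \<le> p" and W: "\<phi> \<in> W1p p" "\<psi> \<in> W1p p"
  shows "\<exists>T>0. well_posed p \<alpha> w T \<phi> \<psi>"
proof -
  define r0 where "r0 = enn2real (W1p_norm p \<phi> + W1p_norm p \<psi>)"
  have r0: "W1p_norm p \<phi> + W1p_norm p \<psi> = ennreal r0" "0 \<le> r0"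
    using W1p_norm_finite[OF p W(1)] W1p_norm_finite[OF p W(2)] by (auto simp: r0_def)
  \<comment> \<open>The extra 1 makes room for perturbed data at distance at most 1.\<close>
  define r where "r = r0 + 1"
  have r: "0 \<le> r" using r0 by (simp add: r_def)
  obtain M where M: "deriv_bound (16 * r + 1) M" using deriv_bound_exists[of "16 * r + 1"] r by auto
  let ?k = "kappa (16 * r + 1) M"
  have k0: "0 \<le> ?k" by (rule kappa_nonneg[OF M])
  \<comment> \<open>This choice gives \<open>T \<le> 1\<close> and
    \<open>T * kappa \<le> 1 / 2\<close>, hence also the condition with \<open>T^2\<close>.\<close>
  define T where "T = 1 / (1 + 2 * ?k)"
  have T: "0 < T" "T \<le> 1" using k0 by (auto simp: T_def)
  have "T * ?k \<le> 1 / 2" using k0 by (simp add: T_def field_simps)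
  moreover have "T^2 * ?k \<le> T * ?k" using T k0 by (intro mult_right_mono) (auto simp: power2_eq_square mult_le_cancel_left1)
  ultimately have T3: "T^2 * ?k \<le> 1 / 2" by simp
  have "W1p_norm p \<phi> + W1p_norm p \<psi> \<le> ennreal r" using r0 by (simp add: r_def ennreal_leI del: ennreal_plus)
  from solution_of_bounded_data[OF p r M T T3 W this]
  obtain U where U: "is_solution p \<alpha> w T \<phi> \<psi> U" "\<And>t. W1p_norm p (U t) \<le> ennreal (16 * r)" by blast
  have sol_W: "u t \<in> W1p p" if "is_solution p \<alpha> w T \<phi>' \<psi>' u" "t \<in> {0..T}" for u t \<phi>' \<psi>'
    using that by (auto simp: is_solution_def C2_W_def)
  have stab: "W1p_norm p (\<lambda>x. V t x - U t x) \<le> ennreal (2 * \<delta>)"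
    if "is_solution p \<alpha> w T \<phi>' \<psi>' V" "\<phi>' \<in> W1p p" "\<psi>' \<in> W1p p"
      "W1p_dist p \<phi>' \<phi> + W1p_dist p \<psi>' \<psi> \<le> ennreal \<delta>" "0 \<le> \<delta>" "2 * \<delta> < 1" "t \<in> {0..T}" for V \<phi>' \<psi>' \<delta> t
    by (rule stability[OF p M _ T T3 U(1) that(1) W that(2,3) U(2) that(4-7)]) (use r in auto)
  have uniq: "AE x in lborel. u t x = U t x" if u: "is_solution p \<alpha> w T \<phi> \<psi> u" and t: "t \<in> {0..T}" for u t
  proof -
    \<comment> \<open>Uniqueness is stability with \<open>\<delta> = 0\<close>.\<close>
    have "W1p_norm p (\<lambda>x. u t x - U t x) \<le> ennreal (2 * 0)"
      using W1p_norm_zero[OF p W(1)] by (intro stab[OF u W _ _ _ t]) (auto simp: W1p_dist_def)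
    then have "AE x in lborel. u t x - U t x = 0"
      by (intro W1p_norm_eq_0[OF p] W1p_diff[OF p] sol_W[OF u t] sol_W[OF U(1) t]) simp
    then show ?thesis by simp
  qed
  have "well_posed p \<alpha> w T \<phi> \<psi>"
    unfolding well_posed_def
  proof (intro conjI allI impI ballI)
    show "\<exists>u. is_solution p \<alpha> w T \<phi> \<psi> u" using U(1) by blast
  next
    fix u v t assume "is_solution p \<alpha> w T \<phi> \<psi> u \<and> is_solution p \<alpha> w T \<phi> \<psi> v" "t \<in> {0..T}"
    then show "AE x in lborel. u t x = v t x"
      using uniq[of u t] uniq[of v t] by (auto elim: eventually_elim2)
  next
    fix u and \<epsilon> :: real assume u: "is_solution p \<alpha> w T \<phi> \<psi> u" and \<epsilon>: "\<epsilon> > 0"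
    \<comment> \<open>The bound 1/4 ensures \<open>2 * \<delta> < 1\<close> for
      \<open>stability\<close>, and \<open>\<epsilon> / 2\<close> turns its conclusion
      \<open>2 * \<delta>\<close> into \<open>\<epsilon>\<close>.\<close>
    define \<delta> where "\<delta> = min (1 / 4) (\<epsilon> / 2)"
    have \<delta>: "\<delta> > 0" "2 * \<delta> < 1" "2 * \<delta> \<le> \<epsilon>" "\<delta> \<le> 1" using \<epsilon> by (auto simp: \<delta>_def)
    show "\<exists>\<delta>>0. \<forall>\<phi>' \<psi>'. \<phi>' \<in> W1p p \<and> \<psi>' \<in> W1p p \<and> W1p_dist p \<phi>' \<phi> + W1p_dist p \<psi>' \<psi> < ennreal \<delta> \<longrightarrow>
      (\<exists>u'. is_solution p \<alpha> w T \<phi>' \<psi>' u') \<and>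
      (\<forall>u'. is_solution p \<alpha> w T \<phi>' \<psi>' u' \<longrightarrow> (\<forall>t\<in>{0..T}. W1p_dist p (u' t) (u t) \<le> ennreal \<epsilon>))"
    proof (intro exI[of _ \<delta>] conjI allI impI ballI \<delta>(1), goal_cases)
      case (1 \<phi>' \<psi>')
      then have W': "\<phi>' \<in> W1p p" "\<psi>' \<in> W1p p" and d: "W1p_dist p \<phi>' \<phi> + W1p_dist p \<psi>' \<psi> \<le> ennreal \<delta>" by auto
      have "W1p_norm p \<phi>' + W1p_norm p \<psi>' \<le> (W1p_norm p \<phi> + W1p_dist p \<phi>' \<phi>) + (W1p_norm p \<psi> + W1p_dist p \<psi>' \<psi>)"
        unfolding W1p_dist_def by (intro add_mono W1p_norm_le_diff p W W')
      also have "\<dots> = (W1p_norm p \<phi> + W1p_norm p \<psi>) + (W1p_dist p \<phi>' \<phi> + W1p_dist p \<psi>' \<psi>)"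
        by (simp add: ac_simps)
      also have "\<dots> \<le> ennreal r0 + ennreal \<delta>" using d by (intro add_mono) (auto simp: r0)
      also have "\<dots> \<le> ennreal r" using r0 \<delta> by (simp add: r_def flip: ennreal_plus)
      finally show ?case using solution_of_bounded_data[OF p r M T T3 W'] by blast
    next
      case (2 \<phi>' \<psi>' u' t)
      then have W': "\<phi>' \<in> W1p p" "\<psi>' \<in> W1p p" and d: "W1p_dist p \<phi>' \<phi> + W1p_dist p \<psi>' \<psi> \<le> ennreal \<delta>"
        and u': "is_solution p \<alpha> w T \<phi>' \<psi>' u'" and t: "t \<in> {0..T}" by auto
      \<comment> \<open>Stability was set up around the constructed solution \<open>U\<close>, whose
        norm is bounded; by uniqueness the given solution \<open>u\<close> may replace it.\<close>
      have "AE x in lborel. u' t x - U t x = u' t x - u t x"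
        using uniq[OF u t] by eventually_elim simp
      then have "W1p_norm p (\<lambda>x. u' t x - u t x) = W1p_norm p (\<lambda>x. u' t x - U t x)"
        using W1p_measurable[OF sol_W[OF u t]] W1p_measurable[OF sol_W[OF u' t]]
        by (intro W1p_cong_AE(2)[OF p] W1p_diff[OF p] sol_W[OF u' t] sol_W[OF U(1) t]) auto
      also have "\<dots> \<le> ennreal (2 * \<delta>)" using \<delta> by (intro stab[OF u' W' d _ _ t]) auto
      also have "\<dots> \<le> ennreal \<epsilon>" using \<delta> by (intro ennreal_leI) auto
      finally show ?case by (simp add: W1p_dist_def)
    qed
  qed
  then show ?thesis using T(1) by blast
qed

end

theorem theorem2p4:
  fixes p :: ennreal and \<alpha> w \<phi> \<psi> :: "real \<Rightarrow> real"
  assumes "1 \<le> p"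
    and "integrable lborel \<alpha>"
    and "C2_fun w" and "w 0 = 0"
    and "\<phi> \<in> W1p p" and "\<psi> \<in> W1p p"
  shows "\<exists>T>0. well_posed p \<alpha> w T \<phi> \<psi>"
proof -
  obtain w1 w2 where "\<And>x. (w has_real_derivative w1 x) (at x)" "\<And>x. (w1 has_real_derivative w2 x) (at x)"
    "continuous_on UNIV w2"
    using assms(3) by (auto simp: C2_fun_def)
  then interpret nonlinearity \<alpha> w w1 w2 using assms by unfold_locales auto
  show ?thesis using assms by (intro exists_well_posed)
qed

end
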